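(* Every football graph dual to a football pattern on $S^2$ is a finite covering space (as a ribbon graph) of the standard football graph $\Gamma_0$. Equivalently, every football pattern on $S^2$ is obtained from the standard football pattern (the truncated icosahedron) by passing to a branched cover $S^2\to S^2$ branched only in vertices of the pattern, i.e. the given pattern is the lift of the standard pattern under such a branched cover.
   Context: A map on a closed surface is a finite connected graph embedded in the surface such that the complementary components (faces) are open discs. Loops and multiple edges are not excluded. A face is a $k$-gon if its boundary walk has $k$ edges, counted with multiplicity. A football pattern on a closed oriented surface is a map such that at least three edges meet at every vertex, all faces are pentagons and hexagons, across each edge of a pentagon there is a hexagon, and across the edges of each hexagon (in cyclic order) there are alternately pentagons and hexagons. No regularity or metric condition is imposed, so patterns are combinatorial-topological objects. The standard football pattern is the truncated icosahedron, with 12 pentagons, 20 hexagons and exactly three faces at each vertex. A ribbon graph is a graph with a cyclic order on the edge-ends at each vertex. A football graph is a connected ribbon graph with black and white vertices such that: (1) each black vertex has valence five, and all five edges connect it to white vertices; (2) each white vertex has valence six, and its six edges, in cyclic order, alternately connect it to black and white vertices. The dual graph of a football pattern has a black vertex for each pentagon, a white vertex for each hexagon, and an edge for each edge of the pattern, joining the vertices of the two adjacent faces. The cyclic order at a vertex is that of the sides of the polygon. This gives a bijection between finite football graphs and football patterns on closed oriented surfaces. The standard football graph $\Gamma_0$ is the dual graph of the standard football pattern. A covering of football graphs is a covering map of graphs preserving vertex colours and the cyclic orders at vertices. It corresponds to a branched cover of the closed oriented surfaces, mapping one pattern to the other and branched only in vertices of the patterns. *)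

theory Defs
  imports "HOL-Analysis.Analysis" "HOL-Combinatorics.Orbits"
begin

section \<open>Ribbon graphs, football graphs and their coverings\<close>

text \<open>
  A graph is given by its vertices and its edge-ends: \<open>origin h\<close> is the vertex at which the
  edge-end \<open>h\<close> sits and \<open>opp h\<close> is the other end of the same edge. The counterclockwise cyclic
  orders at all vertices are collected in one permutation \<open>rot\<close> of the edge-ends, whose orbits
  are exactly the sets of edge-ends at the single vertices. Loops and multiple edges are allowed,
  and the graph may be infinite (but all valences are finite).
\<close>

record ('v, 'h) ribbon_graph =
  rverts :: "'v set"
  ends :: "'h set"
  origin :: "'h \<Rightarrow> 'v"
  opp :: "'h \<Rightarrow> 'h"
  rot :: "'h \<Rightarrow> 'h"

record ('v, 'h) coloured_ribbon_graph = "('v, 'h) ribbon_graph" +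
  black :: "'v set"

definition ends_at :: "('v, 'h, 'm) ribbon_graph_scheme \<Rightarrow> 'v \<Rightarrow> 'h set" where
  "ends_at G v = {h \<in> ends G. origin G h = v}"

definition is_ribbon_graph :: "('v, 'h, 'm) ribbon_graph_scheme \<Rightarrow> bool" where
  "is_ribbon_graph G \<longleftrightarrow>
     origin G ` ends G \<subseteq> rverts G \<and>
     (\<forall>h\<in>ends G. opp G h \<in> ends G \<and> opp G h \<noteq> h \<and> opp G (opp G h) = h) \<and>
     bij_betw (rot G) (ends G) (ends G) \<and>
     (\<forall>h\<in>ends G. ends_at G (origin G h) = orbit (rot G) h)"

definition is_connected :: "('v, 'h, 'm) ribbon_graph_scheme \<Rightarrow> bool" where
  "is_connected G \<longleftrightarrow>
     rverts G \<noteq> {} \<and>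
     (\<forall>u\<in>rverts G. \<forall>v\<in>rverts G. (u, v) \<in> {(origin G h, origin G (opp G h)) | h. h \<in> ends G}\<^sup>*)"

text \<open>The vertices which are not black are the white ones.\<close>

definition football_graph :: "('v, 'h) coloured_ribbon_graph \<Rightarrow> bool" where
  "football_graph G \<longleftrightarrow>
     is_ribbon_graph G \<and> is_connected G \<and> black G \<subseteq> rverts G \<and>
     (\<forall>v\<in>black G. card (ends_at G v) = 5 \<and>
        (\<forall>h\<in>ends_at G v. origin G (opp G h) \<notin> black G)) \<and>
     (\<forall>v\<in>rverts G - black G. card (ends_at G v) = 6 \<and>
        (\<forall>h\<in>ends_at G v. origin G (opp G h) \<in> black G \<longleftrightarrow>
                            origin G (opp G (rot G h)) \<notin> black G))"

text \<open>
  A covering consists of a map \<open>p\<close> on vertices and a map \<open>q\<close> on edge-ends.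
\<close>

definition football_covering ::
  "('v, 'h) coloured_ribbon_graph \<Rightarrow> ('w, 'k) coloured_ribbon_graph \<Rightarrow>
   ('v \<Rightarrow> 'w) \<Rightarrow> ('h \<Rightarrow> 'k) \<Rightarrow> bool" where
  "football_covering G H p q \<longleftrightarrow>
     football_graph G \<and> football_graph H \<and>
     p ` rverts G = rverts H \<and>
     (\<forall>h\<in>ends G. q h \<in> ends H \<and> origin H (q h) = p (origin G h) \<and>
        opp H (q h) = q (opp G h) \<and> rot H (q h) = q (rot G h)) \<and>
     (\<forall>v\<in>rverts G. bij_betw q (ends_at G v) (ends_at H (p v))) \<and>
     (\<forall>v\<in>rverts G. p v \<in> black H \<longleftrightarrow> v \<in> black G)"

definition finite_football_covering ::
  "('v, 'h) coloured_ribbon_graph \<Rightarrow> ('w, 'k) coloured_ribbon_graph \<Rightarrow>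
   ('v \<Rightarrow> 'w) \<Rightarrow> ('h \<Rightarrow> 'k) \<Rightarrow> bool" where
  "finite_football_covering G H p q \<longleftrightarrow>
     football_covering G H p q \<and> (\<forall>w\<in>rverts H. finite {v \<in> rverts G. p v = w})"

definition football_graphs_isomorphic ::
  "('v, 'h) coloured_ribbon_graph \<Rightarrow> ('w, 'k) coloured_ribbon_graph \<Rightarrow> bool" where
  "football_graphs_isomorphic G H \<longleftrightarrow>
     (\<exists>p q. football_covering G H p q \<and> inj_on p (rverts G) \<and> inj_on q (ends G))"


section \<open>The standard football graph\<close>

text \<open>
  The neighbours of each vertex of the icosahedron, counterclockwise as seen from outside:
  \<open>0\<close> and \<open>11\<close> are antipodal, \<open>1,\<dots>,5\<close> is the ring around \<open>0\<close> and \<open>6,\<dots>,10\<close> the ring around \<open>11\<close>.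
\<close>

definition icosahedron_nbrs :: "nat list list" where
  "icosahedron_nbrs =
    [[1, 2, 3, 4, 5],
     [0, 5, 10, 6, 2],
     [0, 1, 6, 7, 3],
     [0, 2, 7, 8, 4],
     [0, 3, 8, 9, 5],
     [0, 4, 9, 10, 1],
     [2, 1, 10, 11, 7],
     [3, 2, 6, 11, 8],
     [4, 3, 7, 11, 9],
     [5, 4, 8, 11, 10],
     [1, 5, 9, 11, 6],
     [10, 9, 8, 7, 6]]"

text \<open>The entry following \<open>x\<close> in the list \<open>xs\<close>, read cyclically.\<close>

definition cyclic_next :: "'a list \<Rightarrow> 'a \<Rightarrow> 'a" where
  "cyclic_next xs x = hd (tl (dropWhile (\<lambda>y. y \<noteq> x) (xs @ xs)))"

definition icosahedron :: "(nat, nat \<times> nat) ribbon_graph" where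
  "icosahedron =
     \<lparr>rverts = {..<12},
      ends = {(u, v). u < 12 \<and> v \<in> set (icosahedron_nbrs ! u)},
      origin = fst,
      opp = prod.swap,
      rot = (\<lambda>(u, v). (u, cyclic_next (icosahedron_nbrs ! u) v))\<rparr>"

definition rot_inv :: "('v, 'h, 'm) ribbon_graph_scheme \<Rightarrow> 'h \<Rightarrow> 'h" where
  "rot_inv G = inv_into (ends G) (rot G)"

text \<open>
  Truncating a polyhedron puts a new vertex near the origin of every edge-end \<open>d\<close>. It has three
  neighbours: the new vertex at the other end of the edge of \<open>d\<close>, and the new vertices on the next
  edge-end in counterclockwise and in clockwise direction around the truncated vertex.
\<close>

datatype direction = Along | Ccw | Cw

definition truncation :: "('v, 'h) ribbon_graph \<Rightarrow> ('h, 'h \<times> direction) ribbon_graph" where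
  "truncation G =
     \<lparr>rverts = ends G,
      ends = ends G \<times> UNIV,
      origin = fst,
      opp = (\<lambda>(d, c). case c of Along \<Rightarrow> (opp G d, Along)
                              | Ccw \<Rightarrow> (rot G d, Cw)
                              | Cw \<Rightarrow> (rot_inv G d, Ccw)),
      rot = (\<lambda>(d, c). (d, case c of Along \<Rightarrow> Ccw | Ccw \<Rightarrow> Cw | Cw \<Rightarrow> Along))\<rparr>"

text \<open>
  An edge-end, regarded as an oriented edge leading away from its origin, is followed in the
  counterclockwise boundary walk of the face on its left by the edge-end \<open>face_next\<close>. The dual
  vertices are the faces, given by their boundary walks; the faces with five sides are black.
\<close>

definition face_next :: "('v, 'h, 'm) ribbon_graph_scheme \<Rightarrow> 'h \<Rightarrow> 'h" where
  "face_next G d = rot_inv G (opp G d)"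

definition dual_ribbon_graph :: "('v, 'h) ribbon_graph \<Rightarrow> ('h set, 'h) coloured_ribbon_graph" where
  "dual_ribbon_graph G =
     \<lparr>rverts = orbit (face_next G) ` ends G,
      ends = ends G,
      origin = orbit (face_next G),
      opp = opp G,
      rot = face_next G,
      black = {F \<in> orbit (face_next G) ` ends G. card F = 5}\<rparr>"

definition standard_football_graph ::
  "(((nat \<times> nat) \<times> direction) set, (nat \<times> nat) \<times> direction) coloured_ribbon_graph" where
  "standard_football_graph = dual_ribbon_graph (truncation icosahedron)"


section \<open>Maps and football patterns on surfaces\<close>

text \<open>
  A map on a closed oriented surface is an embedded graph, with vertices \<open>nodes\<close> and with edges
  parametrised by curves, together with its faces. An oriented edge \<open>(e, b)\<close> is \<open>e\<close> in the
  direction of \<open>curve e\<close> if \<open>b\<close> holds and in the opposite direction otherwise. The orientation of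
  the surface enters through \<open>left_face d\<close>, the face to the left of the oriented edge \<open>d\<close>, and
  \<open>walk_next d\<close>, the oriented edge after \<open>d\<close> in the counterclockwise boundary walk of that face.
\<close>

record ('a, 'e) surface_map =
  nodes :: "'a set"
  edges :: "'e set"
  curve :: "'e \<Rightarrow> real \<Rightarrow> 'a"
  left_face :: "'e \<times> bool \<Rightarrow> 'a set"
  walk_next :: "'e \<times> bool \<Rightarrow> 'e \<times> bool"

definition oedges :: "('a, 'e) surface_map \<Rightarrow> ('e \<times> bool) set" where
  "oedges M = edges M \<times> UNIV"

definition flip :: "'e \<times> bool \<Rightarrow> 'e \<times> bool" where
  "flip d = (fst d, \<not> snd d)"

definition ocurve :: "('a, 'e) surface_map \<Rightarrow> 'e \<times> bool \<Rightarrow> real \<Rightarrow> 'a" where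
  "ocurve M d t = curve M (fst d) (if snd d then t else 1 - t)"

definition skeleton :: "('a, 'e) surface_map \<Rightarrow> 'a set" where
  "skeleton M = nodes M \<union> (\<Union>e\<in>edges M. curve M e ` {0..1})"

definition embedded_graph :: "'a::topological_space set \<Rightarrow> ('a, 'e) surface_map \<Rightarrow> bool" where
  "embedded_graph S M \<longleftrightarrow>
     finite (nodes M) \<and> finite (edges M) \<and> nodes M \<subseteq> S \<and>
     (\<forall>e\<in>edges M. path (curve M e) \<and> path_image (curve M e) \<subseteq> S \<and>
        pathstart (curve M e) \<in> nodes M \<and> pathfinish (curve M e) \<in> nodes M \<and>
        inj_on (curve M e) {0<..<1} \<and> curve M e ` {0<..<1} \<inter> nodes M = {}) \<and>
     (\<forall>e\<in>edges M. \<forall>e'\<in>edges M. e \<noteq> e' \<longrightarrow>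
        curve M e ` {0<..<1} \<inter> curve M e' ` {0<..<1} = {}) \<and>
     connected (skeleton M)"

definition faces :: "'a::topological_space set \<Rightarrow> ('a, 'e) surface_map \<Rightarrow> 'a set set" where
  "faces S M = components (S - skeleton M)"

text \<open>The number of edges, with multiplicity, in the boundary walk of the face to the left.\<close>

definition sides :: "('a, 'e) surface_map \<Rightarrow> 'e \<times> bool \<Rightarrow> nat" where
  "sides M d = card (orbit (walk_next M) d)"

text \<open>
  The face to the left of \<open>d\<close> is an open disc, and it has the orbit of \<open>d\<close> under \<open>walk_next\<close> as
  boundary walk: a homeomorphism \<open>g\<close> of the open unit disc with the face extends continuously to
  the closed disc, viewed as a polygon with corners at the roots of unity, and runs on the
  sides of the polygon successively through the edges of the walk.
\<close>

definition disc_with_boundary_walk ::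
  "('a::topological_space, 'e) surface_map \<Rightarrow> 'e \<times> bool \<Rightarrow> bool" where
  "disc_with_boundary_walk M d \<longleftrightarrow>
     (\<exists>g :: complex \<Rightarrow> 'a.
        continuous_on (cball 0 1) g \<and>
        (\<exists>h. homeomorphism (ball 0 1) (left_face M d) g h) \<and>
        (\<forall>i<sides M d. \<forall>t\<in>{0..1}.
           g (cis (2 * pi * (real i + t) / real (sides M d))) = ocurve M ((walk_next M ^^ i) d) t))"

text \<open>
  \<open>walk_next\<close> permutes the oriented edges, so that the boundary walks of the faces together
  traverse every edge exactly once in each direction. This makes the counterclockwise directions
  of the walks compatible with a single orientation of the surface \<open>S\<close>.
\<close>

definition map_on_surface :: "'a::topological_space set \<Rightarrow> ('a, 'e) surface_map \<Rightarrow> bool" where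
  "map_on_surface S M \<longleftrightarrow>
     embedded_graph S M \<and>
     bij_betw (walk_next M) (oedges M) (oedges M) \<and>
     left_face M ` oedges M = faces S M \<and>
     (\<forall>d\<in>oedges M. \<forall>d'\<in>oedges M.
        left_face M d = left_face M d' \<longleftrightarrow> d' \<in> orbit (walk_next M) d) \<and>
     (\<forall>d\<in>oedges M. disc_with_boundary_walk M d)"

definition football_pattern :: "'a::topological_space set \<Rightarrow> ('a, 'e) surface_map \<Rightarrow> bool" where
  "football_pattern S M \<longleftrightarrow>
     map_on_surface S M \<and>
     (\<forall>v\<in>nodes M. 3 \<le> card {d \<in> oedges M. ocurve M d 0 = v}) \<and>
     (\<forall>d\<in>oedges M.
        (sides M d = 5 \<or> sides M d = 6) \<and>
        (sides M d = 5 \<longrightarrow> sides M (flip d) = 6) \<and>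
        (sides M d = 6 \<longrightarrow> (sides M (flip d) = 5 \<longleftrightarrow> sides M (flip (walk_next M d)) = 6)))"

text \<open>
  The dual edge crossing an edge has one end in the face on each side of it; the end in
  \<open>left_face d\<close> is represented by the oriented edge \<open>d\<close>.
\<close>

definition dual_graph :: "('a, 'e) surface_map \<Rightarrow> ('a set, 'e \<times> bool) coloured_ribbon_graph" where
  "dual_graph M =
     \<lparr>rverts = left_face M ` oedges M,
      ends = oedges M,
      origin = left_face M,
      opp = flip,
      rot = walk_next M,
      black = left_face M ` {d \<in> oedges M. sides M d = 5}\<rparr>"

text \<open>
  The standard football pattern is the truncated icosahedron, in any realisation on \<open>S\<close>.
\<close>

definition standard_football_pattern ::
  "'a::topological_space set \<Rightarrow> ('a, 'e) surface_map \<Rightarrow> bool" where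
  "standard_football_pattern S M \<longleftrightarrow>
     football_pattern S M \<and> football_graphs_isomorphic (dual_graph M) standard_football_graph"


section \<open>Branched covers\<close>

text \<open>
  For closed surfaces, the covering over the complement of the finite set \<open>B\<close> has finitely many
  sheets, and near each point over \<open>B\<close> the map \<open>f\<close> has the form \<open>z \<mapsto> z\<^sup>n\<close>.
\<close>

definition branched_cover ::
  "'a::topological_space set \<Rightarrow> 'b::topological_space set \<Rightarrow> 'b set \<Rightarrow> ('a \<Rightarrow> 'b) \<Rightarrow> bool" where
  "branched_cover S T B f \<longleftrightarrow>
     continuous_on S f \<and> f ` S = T \<and>
     finite B \<and> B \<subseteq> T \<and> finite (S \<inter> f -` B) \<and>
     covering_space (S - f -` B) f (T - B)"

text \<open>
  The map \<open>M\<close> is the preimage of \<open>N\<close> under \<open>f\<close>. The last condition says that \<open>f\<close> carries oriented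
  edges, up to reparametrisation, to oriented edges and the faces on their left to the faces on
  the left of the images, i.e. that \<open>f\<close> respects the orientations.
\<close>

definition is_lift ::
  "'a set \<Rightarrow> ('a, 'e) surface_map \<Rightarrow> ('b, 'k) surface_map \<Rightarrow> ('a \<Rightarrow> 'b) \<Rightarrow> bool" where
  "is_lift S M N f \<longleftrightarrow>
     nodes M = S \<inter> f -` nodes N \<and>
     skeleton M = S \<inter> f -` skeleton N \<and>
     (\<forall>d\<in>oedges M. \<exists>d'\<in>oedges N. \<exists>\<tau>.
        strict_mono_on {0..1} \<tau> \<and> \<tau> ` {0..1} = {0..1} \<and>
        (\<forall>t\<in>{0..1}. f (ocurve M d t) = ocurve N d' (\<tau> t)) \<and>
        f ` left_face M d = left_face N d')"

abbreviation two_sphere :: "(real ^ 3) set" where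
  "two_sphere \<equiv> sphere 0 1"

end

theory Submission
  imports Defs
begin

text \<open>
  The idea is to develop a football pattern along the standard one. A covering of the standard
  football graph is a map of oriented edges to edge-ends which commutes with the walk around faces
  and with the reversal of edges. The first condition alone is easily satisfied: each pentagon is
  mapped to a pentagon and each hexagon to a hexagon, respecting the kinds of its sides. Two
  adjacent faces mapped in this way need not fit together across their common edge, but after a
  rotation of the icosahedron on one side they do, since the rotations act transitively on the
  edge-ends of each kind. Around a node the faces have 5, 6, 6, 5, 6, 6, ... sides, so the valence is
  divisible by three, which is the valence of the nodes of the standard pattern. Hence if
  the face maps fit together across all edges at a node but one, then also across the last one.

  Choose face maps which fit together across as many edges as possible (\<open>glued\<close> edges). By the
  rotation argument all faces are connected through glued edges (\<open>glue_one_more\<close>). A cycle of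
  unglued edges would be a Jordan curve that does not separate the faces, so the unglued edges
  form a forest (\<open>forest_has_leaf\<close>). At a leaf all edges but one are glued, hence all
  (\<open>last_edge_glued\<close>). So there are no unglued edges (\<open>equivariant_labelling_exists\<close>). This replaces
  the monodromy argument on the simply connected sphere: the Jordan curve theorem is the only
  place where planarity is used.

  For the branched cover, the polygons parametrising the faces of the pattern are mapped to those
  parametrising the faces of the truncated icosahedron by the identity in the coordinates of the
  polygons (\<open>cover\<close>). On edges the choices agree because the edge-ends do. On nodes they agree
  because the edges leaving a node form a single orbit of the rotation about it, as small punctured
  neighbourhoods of points of the sphere are connected (\<open>turn_transitive\<close>). The map is continuous
  since the sphere is covered by finitely many compact polygons. Open faces are evenly covered, and so
  are the open stars of edges, because the two faces at an edge of the truncated icosahedron are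
  different; these sets cover everything but the nodes.
\<close>

section \<open>Orbits of a permutation of a finite set\<close>

lemma bij_betw_funpow_mem:
  assumes "bij_betw f A A" "x \<in> A"
  shows "(f ^^ i) x \<in> A"
  using assms by (induction i) (auto simp: bij_betw_def)

lemma orbit_subset_carrier:
  assumes "bij_betw f A A" "x \<in> A"
  shows "orbit f x \<subseteq> A"
  using assms by (auto simp: orbit_altdef intro: bij_betw_funpow_mem)

lemma funpow_cancel_on:
  assumes f: "bij_betw f A A" and "x \<in> A" "y \<in> A" "(f ^^ i) x = (f ^^ i) y"
  shows "x = y"
  using assms(4)
proof (induction i)
  case (Suc i)
  then have "(f ^^ i) x = (f ^^ i) y"
    using f assms(2,3) bij_betw_funpow_mem[OF f] by (auto simp: bij_betw_def inj_on_def)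
  then show ?case using Suc.IH by blast
qed simp

lemma self_in_orbit_finite:
  assumes "finite A" and f: "bij_betw f A A" and x: "x \<in> A"
  shows "x \<in> orbit f x"
proof -
  have "range (\<lambda>i. (f ^^ i) x) \<subseteq> A" using bij_betw_funpow_mem[OF f x] by auto
  then have "finite (range (\<lambda>i. (f ^^ i) x))" using assms(1) finite_subset by blast
  then have "\<not> inj (\<lambda>i. (f ^^ i) x)" using finite_imageD by blast
  then obtain i j where "i < j" and eq: "(f ^^ i) x = (f ^^ j) x"
    by (metis (mono_tags, lifting) inj_def linorder_neqE_nat)
  then obtain k where j: "j = i + k" "0 < k" using less_imp_add_positive by blast
  have "(f ^^ i) x = (f ^^ i) ((f ^^ k) x)" using eq j by (simp add: funpow_add)
  then have "x = (f ^^ k) x"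
    using funpow_cancel_on[OF f x bij_betw_funpow_mem[OF f x]] by blast
  then show ?thesis using \<open>0 < k\<close> by (force simp: orbit_altdef)
qed

text \<open>
  The number of sides of a face is defined as the cardinality of an orbit. Walking around the face
  uses it as the period of the orbit.
\<close>

lemma orbit_period:
  assumes "finite A" "bij_betw f A A" "x \<in> A"
  defines "n \<equiv> card (orbit f x)"
  shows "0 < n" "(f ^^ n) x = x" "orbit f x = (\<lambda>i. (f ^^ i) x) ` {..<n}"
    "inj_on (\<lambda>i. (f ^^ i) x) {..<n}"
proof -
  have self: "x \<in> orbit f x" using self_in_orbit_finite assms by metis
  have *: "{0..<funpow_dist1 f x x} = {..<funpow_dist1 f x x}" by auto
  have o: "orbit f x = (\<lambda>i. (f ^^ i) x) ` {..<funpow_dist1 f x x}"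
    using orbit_conv_funpow_dist1[OF self] * by simp
  have i: "inj_on (\<lambda>i. (f ^^ i) x) {..<funpow_dist1 f x x}"
    using inj_on_funpow_dist1[OF self] * by simp
  have n: "n = funpow_dist1 f x x" unfolding n_def using o i by (metis card_image card_lessThan)
  show "0 < n" "(f ^^ n) x = x" "orbit f x = (\<lambda>i. (f ^^ i) x) ` {..<n}"
    "inj_on (\<lambda>i. (f ^^ i) x) {..<n}"
    using o i funpow_dist1_prop[OF self] unfolding n by auto
qed

lemma orbit_same:
  assumes "finite A" "bij_betw f A A" "x \<in> A" "y \<in> orbit f x"
  shows "orbit f y = orbit f x"
proof -
  have "x \<in> orbit f x" using self_in_orbit_finite assms by metis
  then have "cyclic_on f (orbit f x)" by (auto simp: cyclic_on_def)
  then show ?thesis using assms(4) by (simp add: orbit_cyclic_eq3)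
qed

lemma funpow_period_dvd:
  assumes "finite A" "bij_betw f A A" "x \<in> A"
  shows "(f ^^ m) x = x \<longleftrightarrow> card (orbit f x) dvd m"
proof -
  let ?n = "card (orbit f x)"
  note per = orbit_period[OF assms]
  have mod: "(f ^^ m) x = (f ^^ (m mod ?n)) x" using funpow_mod_eq[OF per(2), of m] by (rule sym)
  show ?thesis
  proof
    assume "(f ^^ m) x = x"
    then have "(f ^^ (m mod ?n)) x = (f ^^ 0) x" using mod by simp
    then have "m mod ?n = 0" using per(1,4) by (auto simp: inj_on_def)
    then show "?n dvd m" by auto
  next
    assume "?n dvd m"
    then show "(f ^^ m) x = x" using mod by simp
  qed
qed

lemma invariant_inverse:
  assumes "finite A" "bij_betw f A A" "x \<in> A" "f x \<in> X" "\<And>y. y \<in> X \<Longrightarrow> f y \<in> X"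
  shows "x \<in> X"
proof -
  note per = orbit_period[OF assms(1-3)]
  have "(f ^^ i) (f x) \<in> X" for i using assms(4,5) by (induction i) auto
  from this[of "card (orbit f x) - 1"] show ?thesis
    using per(1,2) by (metis Suc_diff_1 funpow_Suc_right o_apply)
qed

text \<open>
  The value at one representative of each orbit is transported along the orbit. The transport closes
  up because the period of the orbit is also a period, not necessarily the least one, of the value.
\<close>

lemma equivariant_extension:
  assumes A: "finite A" "bij_betw f A A"
    and c: "\<And>x. x \<in> A \<Longrightarrow> (g ^^ card (orbit f x)) (c x) = c x"
  shows "\<exists>q. \<forall>x\<in>A. q (f x) = g (q x) \<and> (\<exists>y\<in>orbit f x. \<exists>i. x = (f ^^ i) y \<and> q x = (g ^^ i) (c y))"
proof -
  define r where "r x = (SOME y. y \<in> orbit f x)" for x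
  define q where "q x = (g ^^ (LEAST i. (f ^^ i) (r x) = x)) (c (r x))" for x
  have r: "r x \<in> orbit f x" for x
    unfolding r_def by (rule someI[of _ "f x"]) (rule orbit.base)
  have rA: "r x \<in> A" if "x \<in> A" for x using r orbit_subset_carrier[OF A(2) that] by blast
  have ro: "orbit f (r x) = orbit f x" if "x \<in> A" for x using orbit_same[OF A that r] .
  have ex: "\<exists>i. (f ^^ i) (r x) = x" if "x \<in> A" for x
    using self_in_orbit_finite[OF A that] orbit_period(3)[OF A rA[OF that]] ro[OF that]
    by (metis imageE)
  have any: "q x = (g ^^ i) (c (r x))" if x: "x \<in> A" and i: "(f ^^ i) (r x) = x" for x i
  proof -
    let ?n = "card (orbit f (r x))"
    define j where "j = (LEAST i. (f ^^ i) (r x) = x)"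
    have j: "(f ^^ j) (r x) = x" unfolding j_def by (rule LeastI_ex[OF ex[OF x]])
    have ji: "j \<le> i" unfolding j_def by (rule Least_le[where P="\<lambda>i. (f ^^ i) (r x) = x", OF i])
    then obtain k where k: "i = j + k" using le_Suc_ex ji by blast
    have "(f ^^ j) ((f ^^ k) (r x)) = (f ^^ j) (r x)" using i j k by (simp add: funpow_add)
    then have "(f ^^ k) (r x) = r x"
      using funpow_cancel_on[OF A(2)] rA[OF x] bij_betw_funpow_mem[OF A(2)] by blast
    then have "?n dvd k" using funpow_period_dvd[OF A rA[OF x]] by simp
    then have "(g ^^ k) (c (r x)) = c (r x)"
      using funpow_mod_eq[OF c[OF rA[OF x]], of k] by auto
    then show ?thesis unfolding q_def j_def[symmetric] k by (simp add: funpow_add)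
  qed
  show ?thesis
  proof (intro exI[of _ q] ballI conjI)
    fix x assume x: "x \<in> A"
    obtain i where i: "(f ^^ i) (r x) = x" using ex[OF x] by blast
    have fx: "f x \<in> A" using A(2) x by (auto simp: bij_betw_def)
    have "orbit f (f x) = orbit f x" using orbit_same[OF A x orbit.base] .
    then have "r (f x) = r x" by (simp add: r_def)
    then have "q (f x) = (g ^^ Suc i) (c (r x))" using any[OF fx, of "Suc i"] i by simp
    then show "q (f x) = g (q x)" using any[OF x i] by simp
    show "\<exists>y\<in>orbit f x. \<exists>i. x = (f ^^ i) y \<and> q x = (g ^^ i) (c y)" using r i any[OF x i] by metis
  qed
qed

section \<open>Football patterns as permutations of their oriented edges\<close>

text \<open>
  The combinatorial data of a football pattern: \<open>E\<close> are the oriented edges, \<open>w\<close> is the step to the next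
  edge on the boundary of the face on the left, and \<open>opp\<close> reverses an edge. A football graph is
  described in the same way by its edge-ends, so that source and target of a covering are treated
  alike.
\<close>

locale football_map =
  fixes E :: "'d set" and w :: "'d \<Rightarrow> 'd" and opp :: "'d \<Rightarrow> 'd"
  assumes fin: "finite E" and bij: "bij_betw w E E"
    and opp_mem: "d \<in> E \<Longrightarrow> opp d \<in> E" and opp_opp: "d \<in> E \<Longrightarrow> opp (opp d) = d"
    and five_or_six: "d \<in> E \<Longrightarrow> card (orbit w d) = 5 \<or> card (orbit w d) = 6"
    and pentagon: "d \<in> E \<Longrightarrow> card (orbit w d) = 5 \<Longrightarrow> card (orbit w (opp d)) = 6"
    and hexagon: "d \<in> E \<Longrightarrow> card (orbit w d) = 6 \<Longrightarrow>
      card (orbit w (opp d)) = 5 \<longleftrightarrow> card (orbit w (opp (w d))) = 6"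
begin

abbreviation len :: "'d \<Rightarrow> nat" where "len d \<equiv> card (orbit w d)"

definition kind :: "'d \<Rightarrow> nat \<times> nat" where "kind d = (len d, len (opp d))"

text \<open>For the oriented edges leaving a node, \<open>turn\<close> is the rotation about that node.\<close>

definition turn :: "'d \<Rightarrow> 'd" where "turn d = w (opp d)"

lemma w_mem: "d \<in> E \<Longrightarrow> w d \<in> E"
  using bij by (auto simp: bij_betw_def)

lemma w_inj: "d \<in> E \<Longrightarrow> d' \<in> E \<Longrightarrow> w d = w d' \<Longrightarrow> d = d'"
  using bij by (auto simp: bij_betw_def inj_on_def)

lemma w_pow_mem: "d \<in> E \<Longrightarrow> (w ^^ i) d \<in> E"
  using bij_betw_funpow_mem[OF bij] .

lemma orbit_mem: "d \<in> E \<Longrightarrow> d' \<in> orbit w d \<Longrightarrow> d' \<in> E"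
  using orbit_subset_carrier[OF bij] by blast

lemma len_w: "d \<in> E \<Longrightarrow> len (w d) = len d"
  using orbit_same[OF fin bij _ orbit.base] by metis

lemma turn_mem: "d \<in> E \<Longrightarrow> turn d \<in> E"
  by (simp add: turn_def w_mem opp_mem)

lemma bij_turn: "bij_betw turn E E"
proof -
  have "inj_on turn E" unfolding turn_def inj_on_def by (metis opp_mem opp_opp w_inj)
  then show ?thesis using endo_inj_surj[OF fin] turn_mem by (auto simp: bij_betw_def image_subset_iff)
qed

lemma kind_cases: "d \<in> E \<Longrightarrow> kind d \<in> {(5,6), (6,5), (6,6)}"
  unfolding kind_def using five_or_six pentagon opp_mem by fastforce

lemma kind_opp: "d \<in> E \<Longrightarrow> kind (opp d) = prod.swap (kind d)"
  by (simp add: kind_def opp_opp)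

lemma kind_w:
  assumes "d \<in> E"
  shows "kind (w d) = (if kind d = (5,6) then (5,6) else if kind d = (6,5) then (6,6) else (6,5))"
proof -
  have "len (w d) = len d" using len_w assms .
  then show ?thesis
    unfolding kind_def
    using hexagon[OF assms] five_or_six[OF assms] pentagon[OF assms] pentagon[OF w_mem[OF assms]]
      five_or_six[OF opp_mem[OF w_mem[OF assms]]] five_or_six[OF opp_mem[OF assms]] by auto
qed

lemma kind_w_pow:
  assumes "d \<in> E"
  shows "kind ((w ^^ i) d) = ((\<lambda>c. if c = (5,6) then (5,6) else if c = (6,5) then (6,6) else (6,5)) ^^ i) (kind d)"
  using assms by (induction i) (simp_all add: kind_w w_pow_mem)

text \<open>
  Around a node the faces have 5, 6, 6, 5, 6, 6, ... sides, so the three kinds of edges recur with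
  period three.
\<close>

lemma turn_period:
  assumes d: "d \<in> E" and m: "(turn ^^ m) d = d"
  shows "3 dvd m"
proof -
  define pos where "pos c = (if c = (5::nat,6::nat) then 0 else if c = (6,6) then 1 else 2::nat)" for c
  have step: "pos (kind (turn x)) = (pos (kind x) + 1) mod 3" if "x \<in> E" for x
    using kind_cases[OF that] kind_w[OF opp_mem[OF that]] kind_opp[OF that]
    by (auto simp: turn_def pos_def)
  have mem: "(turn ^^ i) d \<in> E" for i using bij_betw_funpow_mem[OF bij_turn d] .
  have "pos (kind ((turn ^^ i) d)) = (pos (kind d) + i) mod 3" for i
  proof (induction i)
    case 0 show ?case by (simp add: pos_def)
  next
    case (Suc i) then show ?case using step[OF mem[of i]] by (simp add: mod_Suc_eq)
  qed
  from this[of m] this[of 0] m have "(pos (kind d) + m) mod 3 = (pos (kind d) + 0) mod 3" by simp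
  then have "m mod 3 = 0" by presburger
  then show ?thesis by auto
qed

end

text \<open>
  The hypotheses on the source are topological: \<open>dual_connected\<close> comes from the connectedness of the surface, and
  \<open>forest_has_leaf\<close> is the form in which planarity enters. There \<open>B\<close> is a set of edges whose
  complement connects all faces, and the conclusion gives a node at which exactly one end of an edge
  of \<open>B\<close> lies. The hypotheses on the target are the properties of the truncated icosahedron which
  make the developing process work.
\<close>

locale football_labelling =
  source: football_map E w opp + target: football_map E0 w0 opp0
  for E :: "'d set" and w opp and E0 :: "'k set" and w0 opp0 +
  assumes dual_connected:
      "\<And>X. X \<subseteq> E \<Longrightarrow> X \<noteq> {} \<Longrightarrow> (\<And>d. d \<in> X \<Longrightarrow> w d \<in> X \<and> opp d \<in> X) \<Longrightarrow> X = E"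
    and forest_has_leaf:
      "\<And>B. B \<subseteq> E \<Longrightarrow> B \<noteq> {} \<Longrightarrow> (\<And>d. d \<in> B \<Longrightarrow> opp d \<in> B) \<Longrightarrow>
        (\<And>X. X \<subseteq> E \<Longrightarrow> X \<noteq> {} \<Longrightarrow> (\<And>d. d \<in> X \<Longrightarrow> w d \<in> X) \<Longrightarrow>
          (\<And>d. d \<in> X \<Longrightarrow> d \<notin> B \<Longrightarrow> opp d \<in> X) \<Longrightarrow> X = E) \<Longrightarrow>
        \<exists>d\<in>B. \<forall>i. (source.turn ^^ i) d \<in> B \<longrightarrow> (source.turn ^^ i) d = d"
    and homogeneous:
      "\<And>k k'. k \<in> E0 \<Longrightarrow> k' \<in> E0 \<Longrightarrow> target.kind k = target.kind k' \<Longrightarrow>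
        \<exists>\<phi>. \<phi> k = k' \<and> (\<forall>x\<in>E0. \<phi> x \<in> E0 \<and> \<phi> (w0 x) = w0 (\<phi> x) \<and> \<phi> (opp0 x) = opp0 (\<phi> x))"
    and all_kinds: "{(5,6), (6,5), (6,6)} \<subseteq> target.kind ` E0"
    and trivalent: "\<And>k. k \<in> E0 \<Longrightarrow> (target.turn ^^ 3) k = k"
begin

text \<open>
  A labelling maps each face of the source to a face of the target; \<open>glued q\<close> is the set of
  oriented edges across which the two face maps fit together.
\<close>

definition labelling :: "('d \<Rightarrow> 'k) \<Rightarrow> bool" where
  "labelling q \<longleftrightarrow> (\<forall>d\<in>E. q d \<in> E0 \<and> q (w d) = w0 (q d) \<and> target.kind (q d) = source.kind d)"

definition glued :: "('d \<Rightarrow> 'k) \<Rightarrow> 'd set" where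
  "glued q = {d \<in> E. q (opp d) = opp0 (q d)}"

lemma labellingD:
  assumes "labelling q" "d \<in> E"
  shows "q d \<in> E0" "q (w d) = w0 (q d)" "target.kind (q d) = source.kind d"
  using assms by (auto simp: labelling_def)

lemma labelling_exists: "\<exists>q. labelling q"
proof -
  define c where "c d = (SOME k. k \<in> E0 \<and> target.kind k = source.kind d)" for d
  have c: "c d \<in> E0 \<and> target.kind (c d) = source.kind d" if d: "d \<in> E" for d
  proof -
    have "source.kind d \<in> target.kind ` E0" using source.kind_cases[OF d] all_kinds by blast
    then have "\<exists>k. k \<in> E0 \<and> target.kind k = source.kind d" by force
    then show ?thesis unfolding c_def by (rule someI_ex)
  qed
  have per: "(w0 ^^ source.len d) (c d) = c d" if d: "d \<in> E" for d
  proof -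
    have "target.len (c d) = source.len d" using c[OF d] by (simp add: source.kind_def target.kind_def)
    then show ?thesis using orbit_period(2)[OF target.fin target.bij, of "c d"] c[OF d] by simp
  qed
  obtain q where q: "\<forall>x\<in>E. q (w x) = w0 (q x) \<and>
      (\<exists>y\<in>orbit w x. \<exists>i. x = (w ^^ i) y \<and> q x = (w0 ^^ i) (c y))"
    using equivariant_extension[OF source.fin source.bij per] by blast
  have "q d \<in> E0 \<and> target.kind (q d) = source.kind d" if d: "d \<in> E" for d
  proof -
    obtain y i where y: "y \<in> orbit w d" "d = (w ^^ i) y" "q d = (w0 ^^ i) (c y)" using q d by blast
    have "y \<in> E" using y(1) d source.orbit_mem by blast
    then show ?thesis using c y target.w_pow_mem by (simp add: source.kind_w_pow target.kind_w_pow)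
  qed
  then show ?thesis using q by (auto simp: labelling_def)
qed

lemma glued_opp:
  assumes q: "labelling q" and "d \<in> glued q"
  shows "opp d \<in> glued q"
  using assms labellingD[OF q] source.opp_mem target.opp_opp
  by (simp add: glued_def source.opp_opp)

text \<open>
  Going once around a node of the source means going around a node of the target several times
  completely, because the valence of the former is a multiple of three and the latter has valence
  three. So the face maps on the two sides of the last edge agree as well.
\<close>

lemma last_edge_glued:
  assumes q: "labelling q" and d: "d \<in> E"
    and others: "\<And>i. (source.turn ^^ i) d \<noteq> d \<Longrightarrow> (source.turn ^^ i) d \<in> glued q"
  shows "d \<in> glued q"
proof -
  let ?t = source.turn and ?u = target.turn
  define m where "m = card (orbit ?t d)"
  note per = orbit_period[OF source.fin source.bij_turn d, folded m_def]
  have mem: "(?t ^^ i) d \<in> E" for i using bij_betw_funpow_mem[OF source.bij_turn d] .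
  have ne: "(?t ^^ i) d \<noteq> d" if "0 < i" "i < m" for i
  proof
    assume "(?t ^^ i) d = d"
    then have "(?t ^^ i) d = (?t ^^ 0) d" by simp
    then show False using inj_onD[OF per(4), of i 0] that by simp
  qed
  have step: "q (?t x) = ?u (q x)" if "x \<in> glued q" for x
  proof -
    have "x \<in> E" "q (opp x) = opp0 (q x)" using that by (auto simp: glued_def)
    then show ?thesis using labellingD(2)[OF q source.opp_mem] by (simp add: source.turn_def target.turn_def)
  qed
  have run: "q ((?t ^^ Suc i) d) = (?u ^^ i) (q (?t d))" if "i < m" for i
    using that
  proof (induction i)
    case (Suc i)
    then have "(?t ^^ Suc i) d \<in> glued q" using others[of "Suc i"] ne[of "Suc i"] by blast
    then show ?case using step Suc by simp
  qed simp
  have "0 < m" using per(1) .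
  then have "q d = (?u ^^ (m - 1)) (q (?t d))" using run[of "m - 1"] per(2) by simp
  then have "?u (q d) = (?u ^^ m) (q (?t d))"
    using \<open>0 < m\<close> by (metis Suc_diff_1 funpow.simps(2) o_apply)
  also have "(?u ^^ m) (q (?t d)) = q (?t d)"
  proof -
    have "3 dvd m" using source.turn_period[OF d per(2)] .
    moreover have "(?u ^^ 3) (q (?t d)) = q (?t d)"
      using trivalent labellingD(1)[OF q] source.turn_mem[OF d] by blast
    ultimately show ?thesis using funpow_mod_eq[of 3 ?u "q (?t d)" m] by auto
  qed
  finally have "w0 (opp0 (q d)) = w0 (q (opp d))"
    using labellingD(2)[OF q source.opp_mem[OF d]] by (simp add: source.turn_def target.turn_def)
  then have "opp0 (q d) = q (opp d)"
    using target.w_inj labellingD(1)[OF q] target.opp_mem source.opp_mem d by blast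
  then show ?thesis using d by (simp add: glued_def)
qed

text \<open>
  The set \<open>X\<close> consists of faces which are not connected to the others through glued edges.
  Composing the face maps on one side of an unglued edge with an automorphism of the target glues
  this edge and keeps all other gluings.
\<close>

lemma glue_one_more:
  assumes q: "labelling q" and X: "X \<subseteq> E" "X \<noteq> {}" "X \<noteq> E"
    and closed: "\<And>d. d \<in> X \<Longrightarrow> w d \<in> X" "\<And>d. d \<in> X \<Longrightarrow> d \<in> glued q \<Longrightarrow> opp d \<in> X"
  shows "\<exists>q'. labelling q' \<and> glued q \<subset> glued q'"
proof -
  obtain d where d: "d \<in> X" "opp d \<notin> X" using dual_connected[OF X(1,2)] X(3) closed(1) by blast
  have dE: "d \<in> E" "opp d \<in> E" using d X(1) source.opp_mem by auto
  have "target.kind (q (opp d)) = target.kind (opp0 (q d))"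
    using labellingD[OF q] dE by (simp add: source.kind_opp target.kind_opp)
  then obtain \<phi> where \<phi>: "\<phi> (q (opp d)) = opp0 (q d)"
    "\<And>x. x \<in> E0 \<Longrightarrow> \<phi> x \<in> E0 \<and> \<phi> (w0 x) = w0 (\<phi> x) \<and> \<phi> (opp0 x) = opp0 (\<phi> x)"
    using homogeneous[OF labellingD(1)[OF q dE(2)] target.opp_mem[OF labellingD(1)[OF q dE(1)]]] by blast
  have \<phi>_pow: "\<phi> ((w0 ^^ i) x) = (w0 ^^ i) (\<phi> x)" if "x \<in> E0" for x i
    using that by (induction i) (simp_all add: \<phi>(2) target.w_pow_mem)
  have \<phi>_len: "target.len (\<phi> x) = target.len x" if x: "x \<in> E0" for x
  proof -
    have "(w0 ^^ target.len x) (\<phi> x) = \<phi> x"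
      using \<phi>_pow[OF x, of "target.len x"] orbit_period(2)[OF target.fin target.bij x] by simp
    then have "target.len (\<phi> x) dvd target.len x"
      using funpow_period_dvd[OF target.fin target.bij] \<phi>(2)[OF x] by simp
    then show ?thesis using target.five_or_six[OF x] target.five_or_six[of "\<phi> x"] \<phi>(2)[OF x] by auto
  qed
  have \<phi>_kind: "target.kind (\<phi> x) = target.kind x" if x: "x \<in> E0" for x
    using \<phi>_len[OF x] \<phi>_len[OF target.opp_mem[OF x]] \<phi>(2)[OF x] by (simp add: target.kind_def)
  define q' where "q' x = (if x \<in> X then q x else \<phi> (q x))" for x
  have wX: "w x \<in> X \<longleftrightarrow> x \<in> X" if "x \<in> E" for x
    using invariant_inverse[OF source.fin source.bij that _ closed(1)] closed(1) by blast
  have lab: "labelling q'"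
    unfolding labelling_def q'_def using labellingD[OF q] \<phi>(2) \<phi>_kind wX by simp
  have oppX: "opp x \<in> X \<longleftrightarrow> x \<in> X" if x: "x \<in> glued q" for x
  proof
    assume "opp x \<in> X"
    then have "opp (opp x) \<in> X" using glued_opp[OF q x] closed(2) by blast
    then show "x \<in> X" using x source.opp_opp by (auto simp: glued_def)
  qed (use closed(2) x in blast)
  have "glued q \<subseteq> glued q'"
  proof
    fix x assume x: "x \<in> glued q"
    then have "x \<in> E" "q (opp x) = opp0 (q x)" by (auto simp: glued_def)
    then show "x \<in> glued q'"
      using oppX[OF x] \<phi>(2) labellingD(1)[OF q] by (simp add: glued_def q'_def)
  qed
  moreover have "d \<in> glued q'" using d dE \<phi>(1) by (simp add: glued_def q'_def)
  moreover have "d \<notin> glued q" using d closed(2) by blast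
  ultimately show ?thesis using lab by blast
qed

text \<open>
  A labelling with as many gluings as possible is glued everywhere. By the previous lemma all faces
  are connected across glued edges; therefore the remaining edges form a forest, and at a leaf of
  this forest one more edge would be glued.
\<close>

theorem equivariant_labelling_exists:
  "\<exists>q. \<forall>d\<in>E. q d \<in> E0 \<and> q (w d) = w0 (q d) \<and> q (opp d) = opp0 (q d) \<and>
     target.kind (q d) = source.kind d"
proof -
  obtain q0 where "labelling q0" using labelling_exists by blast
  moreover have "card (glued q) < Suc (card E)" for q
    using card_mono[OF source.fin, of "glued q"] by (auto simp: glued_def le_imp_less_Suc)
  ultimately obtain q where q: "labelling q"
    and max: "\<And>q'. labelling q' \<Longrightarrow> card (glued q') \<le> card (glued q)"
    using ex_has_greatest_nat[of labelling q0 "\<lambda>q. card (glued q)" "Suc (card E)"] by blast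
  have fin: "finite (glued q')" for q' using source.fin by (simp add: glued_def)
  have no_more: "\<not> (labelling q' \<and> glued q \<subset> glued q')" for q'
    by (meson fin leD max psubset_card_mono)
  define B where "B = E - glued q"
  have "B = {}"
  proof (rule ccontr)
    assume B: "B \<noteq> {}"
    have "\<exists>d\<in>B. \<forall>i. (source.turn ^^ i) d \<in> B \<longrightarrow> (source.turn ^^ i) d = d"
    proof (rule forest_has_leaf)
      show "B \<subseteq> E" "B \<noteq> {}" using B by (auto simp: B_def)
      show "opp d \<in> B" if "d \<in> B" for d
        using that glued_opp[OF q, of "opp d"] source.opp_mem source.opp_opp by (auto simp: B_def)
      show "X = E" if "X \<subseteq> E" "X \<noteq> {}" "\<And>d. d \<in> X \<Longrightarrow> w d \<in> X"
        "\<And>d. d \<in> X \<Longrightarrow> d \<notin> B \<Longrightarrow> opp d \<in> X" for X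
        using glue_one_more[OF q that(1,2) _ that(3)] that(4) no_more by (auto simp: B_def)
    qed
    then obtain d where d: "d \<in> B" "\<And>i. (source.turn ^^ i) d \<in> B \<Longrightarrow> (source.turn ^^ i) d = d"
      by blast
    have "d \<in> E" using d(1) by (simp add: B_def)
    moreover have "(source.turn ^^ i) d \<in> glued q" if "(source.turn ^^ i) d \<noteq> d" for i
      using d(2)[of i] that bij_betw_funpow_mem[OF source.bij_turn \<open>d \<in> E\<close>] by (auto simp: B_def)
    ultimately have "d \<in> glued q" using last_edge_glued[OF q] by blast
    then show False using d(1) by (simp add: B_def)
  qed
  then have "E \<subseteq> glued q" by (auto simp: B_def)
  then show ?thesis using labellingD[OF q] by (intro exI[of _ q]) (auto simp: glued_def)
qed

end

section \<open>Football graphs presented by permutations\<close>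

text \<open>
  Football graphs in terms of the permutations of their edge-ends; the vertices are the orbits of the
  rotation. Both the dual graph of a pattern and the standard football graph are given in this form.
\<close>

locale football_presentation =
  football_map "ends G" "rot G" "opp G" for G :: "('v, 'h) coloured_ribbon_graph" +
  assumes opp_ne: "d \<in> ends G \<Longrightarrow> opp G d \<noteq> d"
    and verts: "rverts G = origin G ` ends G"
    and origin_eq: "d \<in> ends G \<Longrightarrow> d' \<in> ends G \<Longrightarrow>
      origin G d = origin G d' \<longleftrightarrow> d' \<in> orbit (rot G) d"
    and black_eq: "black G = origin G ` {d \<in> ends G. len d = 5}"
    and conn: "X \<subseteq> ends G \<Longrightarrow> X \<noteq> {} \<Longrightarrow> (\<And>d. d \<in> X \<Longrightarrow> rot G d \<in> X \<and> opp G d \<in> X) \<Longrightarrow> X = ends G"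
    and nonempty: "ends G \<noteq> {}"
begin

lemma ends_at_origin:
  assumes "d \<in> ends G"
  shows "ends_at G (origin G d) = orbit (rot G) d"
proof -
  have "x \<in> ends G \<and> origin G x = origin G d \<longleftrightarrow> x \<in> orbit (rot G) d" for x
    using origin_eq[OF assms, of x] orbit_mem[OF assms, of x] by metis
  then show ?thesis by (auto simp: ends_at_def)
qed

lemma origin_black:
  assumes "d \<in> ends G"
  shows "origin G d \<in> black G \<longleftrightarrow> len d = 5"
proof
  assume "origin G d \<in> black G"
  then obtain d' where "d' \<in> ends G" "len d' = 5" "origin G d = origin G d'"
    unfolding black_eq by auto
  then show "len d = 5" using origin_eq[OF assms] orbit_same[OF fin bij assms] by metis
qed (use assms in \<open>auto simp: black_eq\<close>)

lemma football_graph: "football_graph G"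
proof -
  have mem: "origin G d \<in> rverts G" if "d \<in> ends G" for d using that verts by blast
  have ex: "\<exists>d\<in>ends G. v = origin G d" if "v \<in> rverts G" for v using that verts by blast
  let ?R = "{(origin G h, origin G (opp G h)) | h. h \<in> ends G}"
  have "(origin G d, origin G d') \<in> ?R\<^sup>*" if d: "d \<in> ends G" "d' \<in> ends G" for d d'
  proof -
    define X where "X = {h \<in> ends G. (origin G d, origin G h) \<in> ?R\<^sup>*}"
    have "X = ends G"
    proof (rule conn)
      show "X \<noteq> {}" using d(1) by (auto simp: X_def)
      fix h assume h: "h \<in> X"
      then have hE: "h \<in> ends G" by (simp add: X_def)
      have "origin G (rot G h) = origin G h"
        using origin_eq[OF hE w_mem[OF hE]] orbit.base[of "rot G" h] by simp
      then have "rot G h \<in> X" using h w_mem by (auto simp: X_def)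
      moreover have "(origin G d, origin G (opp G h)) \<in> ?R\<^sup>*"
        using h hE by (auto simp: X_def intro: rtrancl_into_rtrancl)
      ultimately show "rot G h \<in> X \<and> opp G h \<in> X" using opp_mem[OF hE] by (simp add: X_def)
    qed (simp add: X_def)
    then show ?thesis using d(2) by (auto simp: X_def)
  qed
  then have "is_connected G" using ex nonempty mem unfolding is_connected_def by blast
  moreover have "is_ribbon_graph G"
    unfolding is_ribbon_graph_def using mem opp_mem opp_opp opp_ne bij ends_at_origin by auto
  moreover have "black G \<subseteq> rverts G" unfolding black_eq verts by auto
  moreover have "card (ends_at G v) = 5 \<and> (\<forall>h\<in>ends_at G v. origin G (opp G h) \<notin> black G)"
    if "v \<in> black G" for v
  proof -
    obtain d where d: "d \<in> ends G" "len d = 5" "v = origin G d" using \<open>v \<in> black G\<close> black_eq by auto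
    have "origin G (opp G h) \<notin> black G" if h: "h \<in> orbit (rot G) d" for h
    proof -
      have hE: "h \<in> ends G" using orbit_mem[OF d(1) h] .
      have "len h = 5" using orbit_same[OF fin bij d(1) h] d(2) by simp
      then show ?thesis using pentagon[OF hE] origin_black[OF opp_mem[OF hE]] by simp
    qed
    then show ?thesis using ends_at_origin[OF d(1)] d by simp
  qed
  moreover have "card (ends_at G v) = 6 \<and> (\<forall>h\<in>ends_at G v. origin G (opp G h) \<in> black G \<longleftrightarrow>
        origin G (opp G (rot G h)) \<notin> black G)" if v: "v \<in> rverts G - black G" for v
  proof -
    obtain d where d: "d \<in> ends G" "v = origin G d" using v ex by auto
    then have 6: "len d = 6" using v origin_black[OF d(1)] five_or_six[OF d(1)] by auto
    have "origin G (opp G h) \<in> black G \<longleftrightarrow> origin G (opp G (rot G h)) \<notin> black G"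
      if h: "h \<in> orbit (rot G) d" for h
    proof -
      have hE: "h \<in> ends G" using orbit_mem[OF d(1) h] .
      have "len h = 6" using orbit_same[OF fin bij d(1) h] 6 by simp
      then show ?thesis
        using hexagon[OF hE] origin_black[OF opp_mem[OF hE]] origin_black[OF opp_mem[OF w_mem[OF hE]]]
          five_or_six[OF opp_mem[OF w_mem[OF hE]]] by auto
    qed
    then show ?thesis using ends_at_origin[OF d(1)] d 6 by simp
  qed
  ultimately show ?thesis unfolding football_graph_def by blast
qed

end

text \<open>
  The image is invariant under both permutations, and the target is connected.
\<close>

lemma (in football_presentation) equivariant_surjective:
  assumes E: "E \<noteq> {}"
    and q: "\<And>d. d \<in> E \<Longrightarrow> q d \<in> ends G \<and> q (f d) = rot G (q d) \<and> q (g d) = opp G (q d) \<and>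
      f d \<in> E \<and> g d \<in> E"
  shows "q ` E = ends G"
proof (rule conn)
  show "rot G d \<in> q ` E \<and> opp G d \<in> q ` E" if "d \<in> q ` E" for d
    using that q by (metis (no_types, lifting) image_iff)
qed (use assms in auto)

text \<open>
  Equivariance makes the map surjective from the edge-ends at a vertex to those at the image vertex,
  and equality of the valences makes it injective there.
\<close>

lemma equivariant_covering:
  assumes "football_presentation G" "football_presentation H"
    and q: "\<And>d. d \<in> ends G \<Longrightarrow> q d \<in> ends H \<and> q (rot G d) = rot H (q d) \<and> q (opp G d) = opp H (q d)
      \<and> card (orbit (rot H) (q d)) = card (orbit (rot G) d)"
  shows "\<exists>p. finite_football_covering G H p q"
proof -
  interpret G: football_presentation G by fact
  interpret H: football_presentation H by fact
  define p where "p v = origin H (q (SOME d. d \<in> ends G \<and> origin G d = v))" for v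
  have q_pow: "q ((rot G ^^ i) d) = (rot H ^^ i) (q d)" if "d \<in> ends G" for d i
    using that q by (induction i) (simp_all add: G.w_pow_mem)
  have q_orbit: "q ` orbit (rot G) d = orbit (rot H) (q d)" if d: "d \<in> ends G" for d
  proof -
    have "q ` orbit (rot G) d = q ` (\<lambda>i. (rot G ^^ i) d) ` {..<G.len d}"
      using orbit_period(3)[OF G.fin G.bij d] by simp
    also have "\<dots> = (\<lambda>i. (rot H ^^ i) (q d)) ` {..<H.len (q d)}"
      using q[OF d] q_pow[OF d] by (simp add: image_image)
    finally show ?thesis using orbit_period(3)[OF H.fin H.bij, of "q d"] q[OF d] by simp
  qed
  have p: "p (origin G d) = origin H (q d)" if d: "d \<in> ends G" for d
  proof -
    define d' where "d' = (SOME d'. d' \<in> ends G \<and> origin G d' = origin G d)"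
    have d': "d' \<in> ends G \<and> origin G d' = origin G d" unfolding d'_def by (rule someI[of _ d]) (simp add: d)
    then have "d' \<in> orbit (rot G) d" using G.origin_eq[OF d] by metis
    then have "q d' \<in> orbit (rot H) (q d)" using q_orbit[OF d] by blast
    then show ?thesis using H.origin_eq q d d' unfolding p_def d'_def[symmetric] by metis
  qed
  have ex: "\<exists>d\<in>ends G. v = origin G d" if "v \<in> rverts G" for v using that G.verts by blast
  have surj: "q ` ends G = ends H"
    by (rule H.equivariant_surjective[OF G.nonempty, where f="rot G" and g="opp G"])
      (use q G.w_mem G.opp_mem in auto)
  have "p ` rverts G = rverts H"
  proof -
    have "p ` rverts G = (\<lambda>d. origin H (q d)) ` ends G" unfolding G.verts image_image by (simp add: p)
    also have "\<dots> = origin H ` q ` ends G" by (simp add: image_image)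
    finally show ?thesis by (simp add: surj H.verts)
  qed
  moreover have "bij_betw q (ends_at G v) (ends_at H (p v))" if "v \<in> rverts G" for v
  proof -
    obtain d where d: "d \<in> ends G" "v = origin G d" using ex[OF \<open>v \<in> rverts G\<close>] by blast
    have "finite (orbit (rot G) d)" by (rule finite_subset[OF orbit_subset_carrier[OF G.bij d(1)] G.fin])
    then have "inj_on q (orbit (rot G) d)"
      by (rule eq_card_imp_inj_on) (simp add: q_orbit[OF d(1)] q[OF d(1)])
    then show ?thesis
      using q_orbit[OF d(1)] q[OF d(1)] by (simp add: bij_betw_def d p G.ends_at_origin H.ends_at_origin)
  qed
  moreover have "p v \<in> black H \<longleftrightarrow> v \<in> black G" if "v \<in> rverts G" for v
    using ex[OF that] q by (auto simp: p G.origin_black H.origin_black)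
  moreover have "finite (rverts G)" using G.fin by (simp add: G.verts)
  ultimately have "finite_football_covering G H p q"
    unfolding finite_football_covering_def football_covering_def
    using G.football_graph H.football_graph q p by auto
  then show ?thesis by blast
qed

section \<open>The icosahedron and its rotations\<close>

text \<open>
  The facts about the icosahedron which are needed are identities between its 60 edge-ends; they are
  verified by evaluation on the list of all edge-ends.
\<close>

definition end_list :: "(nat \<times> nat) list" where
  "end_list = concat (map (\<lambda>u. map (Pair u) (icosahedron_nbrs ! u)) [0..<12])"

definition nxt :: "nat \<times> nat \<Rightarrow> nat \<times> nat" where
  "nxt = (\<lambda>(u, v). (u, cyclic_next (icosahedron_nbrs ! u) v))"

text \<open>
  Evaluable form of the inverse of \<open>nxt\<close>, which reads the lists of neighbours backwards.
\<close>

definition prv :: "nat \<times> nat \<Rightarrow> nat \<times> nat" where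
  "prv = (\<lambda>(u, v). (u, cyclic_next (rev (icosahedron_nbrs ! u)) v))"

text \<open>The step along the boundary walk of a triangle of the icosahedron.\<close>

definition tri :: "nat \<times> nat \<Rightarrow> nat \<times> nat" where
  "tri d = prv (prod.swap d)"

definition is_end :: "nat \<times> nat \<Rightarrow> bool" where
  "is_end d \<longleftrightarrow> fst d < 12 \<and> snd d \<in> set (icosahedron_nbrs ! fst d)"

definition relabel :: "nat list \<Rightarrow> nat \<times> nat \<Rightarrow> nat \<times> nat" where
  "relabel xs d = (xs ! fst d, xs ! snd d)"

text \<open>
  The vertex permutations of two rotations of the icosahedron, by a fifth of a turn about the vertex
  \<open>0\<close> and by half a turn about the centre of the edge between \<open>0\<close> and \<open>1\<close>. They generate the rotation group.
\<close>

definition vertex_rotation :: "nat list" where "vertex_rotation = [0,2,3,4,5,1,7,8,9,10,6,11]"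
definition edge_rotation :: "nat list" where "edge_rotation = [1,0,5,10,6,2,4,9,11,7,3,8]"

lemma ends_icosahedron: "ends icosahedron = set end_list"
  unfolding end_list_def icosahedron_def by (auto simp: atLeast0LessThan)

lemma rot_icosahedron: "rot icosahedron = nxt"
  by (simp add: icosahedron_def nxt_def)

lemma opp_icosahedron: "opp icosahedron = prod.swap"
  by (simp add: icosahedron_def)

lemma mem_end_list: "d \<in> set end_list \<longleftrightarrow> is_end d"
  unfolding end_list_def is_end_def by (cases d) auto

lemma end_list_iff: "(u, v) \<in> set end_list \<longleftrightarrow> u < 12 \<and> v \<in> set (icosahedron_nbrs ! u)"
  by (simp add: mem_end_list is_end_def)

lemma end_list_checks:
  "list_all (\<lambda>d. is_end (nxt d) \<and> is_end (prv d) \<and> is_end (prod.swap d) \<and> nxt d \<noteq> d) end_list"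
  "list_all (\<lambda>d. nxt (nxt (nxt (nxt (nxt d)))) = d \<and> prv (nxt d) = d \<and> nxt (prv d) = d) end_list"
  "list_all (\<lambda>d. tri d \<noteq> d \<and> tri (tri (tri d)) = d) end_list"
  "list_all (\<lambda>d. prod.swap d \<noteq> d \<and> tri d \<noteq> prod.swap d \<and> tri (tri d) \<noteq> prod.swap d) end_list"
  "list_all (\<lambda>d. list_all (\<lambda>v. v \<in> set [snd d, snd (nxt d), snd (nxt (nxt d)),
     snd (nxt (nxt (nxt d))), snd (nxt (nxt (nxt (nxt d))))]) (icosahedron_nbrs ! fst d)) end_list"
proof goal_cases
  case 1 show ?case by code_simp
next
  case 2 show ?case by code_simp
next
  case 3 show ?case by code_simp
next
  case 4 show ?case by code_simp
next
  case 5 show ?case by code_simp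
qed

lemma end_identities:
  assumes "d \<in> set end_list"
  shows "nxt d \<in> set end_list" "prv d \<in> set end_list" "prod.swap d \<in> set end_list"
    "nxt d \<noteq> d" "(nxt ^^ 5) d = d" "prv (nxt d) = d" "nxt (prv d) = d"
    "tri d \<noteq> d" "tri (tri (tri d)) = d"
    "prod.swap d \<noteq> d" "tri d \<noteq> prod.swap d" "tri (tri d) \<noteq> prod.swap d"
proof -
  note checks = end_list_checks(1-4)[unfolded list_all_iff, THEN bspec, OF assms]
  have "(nxt ^^ 5) d = nxt (nxt (nxt (nxt (nxt d))))" by (simp add: eval_nat_numeral)
  with checks(2) show "(nxt ^^ 5) d = d" by simp
qed (use end_list_checks(1-4)[unfolded list_all_iff, THEN bspec, OF assms] mem_end_list in blast)+

lemma same_origin: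
  assumes "(u, v) \<in> set end_list" "(u, v') \<in> set end_list"
  shows "\<exists>i. (u, v') = (nxt ^^ i) (u, v)"
proof -
  have fst: "fst (nxt d) = fst d" for d by (simp add: nxt_def case_prod_beta)
  have pow: "fst ((nxt ^^ i) d) = fst d" for i d by (induction i) (simp_all add: fst)
  define f where "f i = snd ((nxt ^^ i) (u, v))" for i
  have "[v, snd (nxt (u, v)), snd (nxt (nxt (u, v))), snd (nxt (nxt (nxt (u, v)))),
     snd (nxt (nxt (nxt (nxt (u, v)))))] = map f [0, 1, 2, 3, 4]"
    by (simp add: f_def eval_nat_numeral)
  moreover have "v' \<in> set [v, snd (nxt (u, v)), snd (nxt (nxt (u, v))), snd (nxt (nxt (nxt (u, v)))),
     snd (nxt (nxt (nxt (nxt (u, v)))))]"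
  proof -
    have "v' \<in> set (icosahedron_nbrs ! u)" using assms(2) end_list_iff by blast
    then show ?thesis using bspec[OF end_list_checks(5)[unfolded list_all_iff] assms(1)] by simp
  qed
  ultimately obtain i where "v' = f i" by auto
  then have "(u, v') = (nxt ^^ i) (u, v)" using pow[of i "(u, v)"] by (simp add: f_def prod_eq_iff)
  then show ?thesis ..
qed

text \<open>
  With this numbering of the vertices, connectedness follows by going down from every vertex to \<open>0\<close> and
  up again.
\<close>

lemma smaller_neighbour: "\<forall>u\<in>{1..<12}. \<exists>v\<in>set (icosahedron_nbrs ! u). v < u"
proof -
  have "\<forall>u\<in>set [1..<12]. \<exists>v\<in>set (icosahedron_nbrs ! u). v < u" by code_simp
  then show ?thesis by simp
qed

lemma icosahedron_connected:
  assumes X: "X \<subseteq> set end_list" "X \<noteq> {}"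
    and closed: "\<And>d. d \<in> X \<Longrightarrow> nxt d \<in> X" "\<And>d. d \<in> X \<Longrightarrow> prod.swap d \<in> X"
  shows "X = set end_list"
proof -
  have pow: "(nxt ^^ i) d \<in> X" if "d \<in> X" for d i using that by (induction i) (auto intro: closed(1))
  have spread: "(u, v') \<in> X" if "(u, v) \<in> X" "(u, v') \<in> set end_list" for u v v'
    using same_origin that X(1) pow[OF that(1)] by (metis subsetD)
  have nb: "(u, v) \<in> X \<Longrightarrow> (u, v') \<in> set end_list \<Longrightarrow> (v', u) \<in> X" for u v v'
    using closed(2)[OF spread] by (metis swap_simp)
  have down: "(u, v) \<in> X \<Longrightarrow> \<exists>v. (0, v) \<in> X" for u v
  proof (induction u arbitrary: v rule: less_induct)
    case (less u)
    show ?case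
    proof (cases "u = 0")
      case False
      have "u < 12" using less.prems X(1) end_list_iff by blast
      then obtain v' where v': "v' \<in> set (icosahedron_nbrs ! u)" "v' < u"
        using smaller_neighbour False by (metis atLeastLessThan_iff less_one linorder_not_less)
      then have "(u, v') \<in> set end_list" using \<open>u < 12\<close> end_list_iff by blast
      then show ?thesis using nb less v' by blast
    qed (use less in blast)
  qed
  have up: "\<exists>v. (u, v) \<in> X" if "u < 12" for u
    using that
  proof (induction u rule: less_induct)
    case (less u)
    show ?case
    proof (cases "u = 0")
      case True
      show ?thesis using X(2) down True by (metis ex_in_conv surj_pair)
    next
      case False
      then obtain v' where v': "v' \<in> set (icosahedron_nbrs ! u)" "v' < u"
        using smaller_neighbour less.prems by (metis atLeastLessThan_iff less_one linorder_not_less)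
      then have "(u, v') \<in> set end_list" using less.prems end_list_iff by blast
      then have "(v', u) \<in> set end_list" using end_identities(3)[of "(u, v')"] by simp
      moreover have "v' < 12" using v' less.prems by simp
      ultimately show ?thesis using nb less.IH v' by blast
    qed
  qed
  show ?thesis
  proof
    show "set end_list \<subseteq> X" using up spread by (metis end_list_iff subrelI)
  qed fact
qed

lemma generating_rotations:
  "list_all (\<lambda>d. is_end (relabel vertex_rotation d) \<and>
     nxt (relabel vertex_rotation d) = relabel vertex_rotation (nxt d)) end_list"
  "list_all (\<lambda>d. is_end (relabel edge_rotation d) \<and>
     nxt (relabel edge_rotation d) = relabel edge_rotation (nxt d)) end_list"
  "relabel vertex_rotation (0, 1) = nxt (0, 1)"
  "relabel edge_rotation (0, 1) = (1, 0)"
proof goal_cases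
  case 1 show ?case by code_simp
next
  case 2 show ?case by code_simp
next
  case 3 show ?case by code_simp
next
  case 4 show ?case by code_simp
qed

definition rotation :: "(nat \<times> nat \<Rightarrow> nat \<times> nat) \<Rightarrow> bool" where
  "rotation \<phi> \<longleftrightarrow> (\<forall>d\<in>set end_list. \<phi> d \<in> set end_list \<and> \<phi> (nxt d) = nxt (\<phi> d) \<and>
     \<phi> (prod.swap d) = prod.swap (\<phi> d))"

lemma rotation_inverse:
  assumes \<phi>: "rotation \<phi>" and d: "d \<in> set end_list"
  shows "\<exists>\<psi>. rotation \<psi> \<and> \<psi> (\<phi> d) = d"
proof -
  let ?D = "set end_list"
  have im: "\<phi> ` ?D = ?D"
  proof (rule icosahedron_connected)
    fix y assume "y \<in> \<phi> ` ?D"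
    then obtain x where x: "x \<in> ?D" "y = \<phi> x" by blast
    then have "nxt y = \<phi> (nxt x)" "prod.swap y = \<phi> (prod.swap x)" using \<phi> by (auto simp: rotation_def)
    then show "nxt y \<in> \<phi> ` ?D" "prod.swap y \<in> \<phi> ` ?D"
      using end_identities(1,3)[OF x(1)] by simp_all
  qed (use \<phi> d in \<open>auto simp: rotation_def\<close>)
  then have inj: "inj_on \<phi> ?D" by (simp add: eq_card_imp_inj_on)
  let ?\<psi> = "inv_into ?D \<phi>"
  have eq: "?\<psi> y = x" if "x \<in> ?D" "\<phi> x = y" for x y using inv_into_f_eq[OF inj that] .
  have "rotation ?\<psi>"
    unfolding rotation_def
  proof
    fix y assume "y \<in> ?D"
    then obtain x where x: "x \<in> ?D" "\<phi> x = y" using im by (metis imageE)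
    then have "\<phi> (nxt x) = nxt y" "\<phi> (prod.swap x) = prod.swap y"
      using \<phi> by (auto simp: rotation_def)
    then show "?\<psi> y \<in> ?D \<and> ?\<psi> (nxt y) = nxt (?\<psi> y) \<and> ?\<psi> (prod.swap y) = prod.swap (?\<psi> y)"
      using eq[OF x] eq[of "nxt x"] eq[of "prod.swap x"] x end_identities(1,3)[OF x(1)] by simp
  qed
  then show ?thesis using eq[OF d] by blast
qed

lemma rotation_comp: "rotation \<phi> \<Longrightarrow> rotation \<psi> \<Longrightarrow> rotation (\<phi> \<circ> \<psi>)"
  by (simp add: rotation_def)

text \<open>
  If a rotation \<open>\<phi>\<close> takes \<open>(0, 1)\<close> to \<open>d\<close>, then \<open>\<phi>\<close> preceded by one of the two generating rotations
  takes it to \<open>nxt d\<close> and to \<open>prod.swap d\<close>. So the orbit of \<open>(0, 1)\<close> is closed under both.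
\<close>

lemma rotation_transitive:
  assumes "d \<in> set end_list" "d' \<in> set end_list"
  shows "\<exists>\<phi>. rotation \<phi> \<and> \<phi> d = d'"
proof -
  have base: "(0, 1) \<in> set end_list" by code_simp
  have swap: "relabel xs (prod.swap d) = prod.swap (relabel xs d)" for xs d by (simp add: relabel_def)
  have "rotation (relabel xs)"
    if h: "\<forall>d\<in>set end_list. is_end (relabel xs d) \<and> nxt (relabel xs d) = relabel xs (nxt d)" for xs
    unfolding rotation_def
  proof (intro ballI conjI)
    fix d assume "d \<in> set end_list"
    from bspec[OF h this] show "relabel xs d \<in> set end_list" "relabel xs (nxt d) = nxt (relabel xs d)"
      unfolding mem_end_list by auto
  qed (rule swap)
  note gen = this[OF generating_rotations(1)[unfolded list_all_iff]]
    this[OF generating_rotations(2)[unfolded list_all_iff]]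
  have from_base: "\<exists>\<phi>. rotation \<phi> \<and> \<phi> (0, 1) = d" if "d \<in> set end_list" for d
  proof -
    define X where "X = {d \<in> set end_list. \<exists>\<phi>. rotation \<phi> \<and> \<phi> (0, 1) = d}"
    have "X = set end_list"
    proof (rule icosahedron_connected)
      have "rotation id" using end_identities by (simp add: rotation_def)
      then have "\<exists>\<phi>. rotation \<phi> \<and> \<phi> (0, 1) = (0, 1)" by (intro exI[of _ id] conjI) simp_all
      then have "(0, 1) \<in> X" using base unfolding X_def by (intro CollectI conjI)
      then show "X \<noteq> {}" by (metis empty_iff)
      fix d assume "d \<in> X"
      then obtain \<phi> where d: "d \<in> set end_list" and \<phi>: "rotation \<phi>" "\<phi> (0, 1) = d" by (auto simp: X_def)
      have "\<phi> (nxt (0, 1)) = nxt d \<and> \<phi> (prod.swap (0, 1)) = prod.swap d"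
        using \<phi>(1)[unfolded rotation_def, THEN bspec, OF base] unfolding \<phi>(2) by (intro conjI) simp_all
      then have "(\<phi> \<circ> relabel vertex_rotation) (0, 1) = nxt d"
        "(\<phi> \<circ> relabel edge_rotation) (0, 1) = prod.swap d"
        unfolding comp_apply generating_rotations(3,4) by simp_all
      then have "\<exists>\<psi>. rotation \<psi> \<and> \<psi> (0, 1) = nxt d" "\<exists>\<psi>. rotation \<psi> \<and> \<psi> (0, 1) = prod.swap d"
        using rotation_comp[OF \<phi>(1) gen(1)] rotation_comp[OF \<phi>(1) gen(2)] by (metis (no_types))+
      then show "nxt d \<in> X" "prod.swap d \<in> X"
        using end_identities(1,3)[OF d] unfolding X_def by (simp_all only: mem_Collect_eq simp_thms)
    qed (auto simp: X_def)
    then show ?thesis using that by (auto simp: X_def)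
  qed
  obtain \<alpha> \<beta> where \<alpha>: "rotation \<alpha>" "\<alpha> (0, 1) = d" and \<beta>: "rotation \<beta>" "\<beta> (0, 1) = d'"
    using from_base assms by meson
  obtain \<psi> where "rotation \<psi>" "\<psi> d = (0, 1)" using rotation_inverse[OF \<alpha>(1) base] \<alpha>(2) by metis
  then show ?thesis using rotation_comp[OF \<beta>(1)] \<beta>(2) by (intro exI[of _ "\<beta> \<circ> \<psi>"]) simp
qed

section \<open>The standard football graph\<close>

abbreviation std :: "(((nat \<times> nat) \<times> direction) set, (nat \<times> nat) \<times> direction) coloured_ribbon_graph" where
  "std \<equiv> standard_football_graph"

lemma ends_std: "ends std = set end_list \<times> UNIV"
  by (simp add: standard_football_graph_def dual_ribbon_graph_def truncation_def ends_icosahedron)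

lemma rot_inv_icosahedron:
  assumes "d \<in> set end_list"
  shows "rot_inv icosahedron d = prv d"
proof -
  have "inj_on nxt (set end_list)" using end_identities(6) by (metis inj_onI)
  then show ?thesis
    unfolding rot_inv_def rot_icosahedron ends_icosahedron
    using end_identities(2,7)[OF assms] by (rule inv_into_f_eq)
qed

lemma opp_std:
  assumes "d \<in> set end_list"
  shows "opp std (d, Along) = (prod.swap d, Along)" "opp std (d, Ccw) = (nxt d, Cw)"
    "opp std (d, Cw) = (prv d, Ccw)"
  using rot_inv_icosahedron[OF assms]
  by (simp_all add: standard_football_graph_def dual_ribbon_graph_def truncation_def
      opp_icosahedron rot_icosahedron)

text \<open>
  A pentagon consists of the edge-ends \<open>(d, Ccw)\<close> for the edge-ends \<open>d\<close> at one vertex of the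
  icosahedron; a hexagon alternates between \<open>Along\<close> and \<open>Cw\<close> and runs around one triangle.
\<close>

lemma rot_std:
  assumes "d \<in> set end_list"
  shows "rot std (d, Along) = (prod.swap d, Cw)" "rot std (d, Ccw) = (nxt d, Ccw)"
    "rot std (d, Cw) = (prv d, Along)"
proof -
  let ?T = "truncation icosahedron"
  have r: "rot ?T = (\<lambda>(d, c). (d, case c of Along \<Rightarrow> Ccw | Ccw \<Rightarrow> Cw | Cw \<Rightarrow> Along))"
    and e: "ends ?T = set end_list \<times> UNIV"
    by (simp_all add: truncation_def ends_icosahedron)
  have inj: "inj_on (rot ?T) (ends ?T)" by (auto simp: inj_on_def r split: direction.splits)
  have inv: "rot_inv ?T y = x" if "x \<in> set end_list \<times> UNIV" "rot ?T x = y" for x y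
    unfolding rot_inv_def using inv_into_f_eq[OF inj] that e by blast
  have inv': "rot_inv ?T (d, Along) = (d, Cw)" "rot_inv ?T (d, Ccw) = (d, Along)"
    "rot_inv ?T (d, Cw) = (d, Ccw)" if "d \<in> set end_list" for d
    by (rule inv; use that in \<open>simp add: r\<close>)+
  have s: "rot std x = rot_inv ?T (opp std x)" for x
    by (simp add: standard_football_graph_def dual_ribbon_graph_def face_next_def)
  show "rot std (d, Along) = (prod.swap d, Cw)" "rot std (d, Ccw) = (nxt d, Ccw)"
    "rot std (d, Cw) = (prv d, Along)"
    unfolding s opp_std[OF assms] using inv' end_identities(1-3)[OF assms] by simp_all
qed

lemma std_cases:
  assumes "x \<in> ends std"
  obtains d where "d \<in> set end_list" "x = (d, Along)"
  | d where "d \<in> set end_list" "x = (d, Ccw)"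
  | d where "d \<in> set end_list" "x = (d, Cw)"
  using assms unfolding ends_std
  by (cases x; cases "snd x") auto

lemma rot_std_mem: "x \<in> ends std \<Longrightarrow> rot std x \<in> ends std"
  by (erule std_cases) (simp_all add: rot_std ends_std end_identities(1-3))

lemma opp_std_mem: "x \<in> ends std \<Longrightarrow> opp std x \<in> ends std"
  by (erule std_cases) (simp_all add: opp_std ends_std end_identities(1-3))

lemma finite_ends_std: "finite (ends std)"
proof -
  have "(UNIV :: direction set) = {Along, Ccw, Cw}" using direction.exhaust by blast
  then have "finite (UNIV :: direction set)" by (metis finite.emptyI finite.insertI)
  then show ?thesis by (simp add: ends_std)
qed

lemma bij_rot_std: "bij_betw (rot std) (ends std) (ends std)"
proof -
  define g where "g x = (case x of (d, Along) \<Rightarrow> (nxt d, Cw) | (d, Ccw) \<Rightarrow> (prv d, Ccw)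
    | (d, Cw) \<Rightarrow> (prod.swap d, Along))" for x
  have "g (rot std x) = x" if "x \<in> ends std" for x
    using that by (rule std_cases) (simp_all add: rot_std g_def end_identities(6,7))
  then have "inj_on (rot std) (ends std)" by (metis inj_onI)
  then show ?thesis using rot_std_mem endo_inj_surj[OF finite_ends_std, of "rot std"] by (simp add: bij_betw_def image_subset_iff)
qed

lemma std_pentagon:
  assumes d: "d \<in> set end_list"
  shows "card (orbit (rot std) (d, Ccw)) = 5"
proof -
  have x: "(d, Ccw) \<in> ends std" using d by (simp add: ends_std)
  note period = funpow_period_dvd[OF finite_ends_std bij_rot_std x]
  have pow: "(rot std ^^ i) (d, Ccw) = ((nxt ^^ i) d, Ccw) \<and> (nxt ^^ i) d \<in> set end_list" for i
    by (induction i) (simp_all add: d rot_std end_identities(1))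
  have "card (orbit (rot std) (d, Ccw)) dvd 5"
    using period[of 5] pow end_identities(5)[OF d] by simp
  moreover have "card (orbit (rot std) (d, Ccw)) \<noteq> 1"
    using period[of 1] pow[of 1] end_identities(4)[OF d] by auto
  moreover have "prime (5::nat)" by simp
  ultimately show ?thesis using prime_nat_iff by blast
qed

lemma std_hexagon_walk:
  assumes d: "d \<in> set end_list"
  shows "rot std (d, Along) = (prod.swap d, Cw)" "(rot std ^^ 2) (d, Along) = (tri d, Along)"
    "(rot std ^^ 3) (d, Along) = (prod.swap (tri d), Cw)"
    "(rot std ^^ 4) (d, Along) = (tri (tri d), Along)"
    "(rot std ^^ 5) (d, Along) = (prod.swap (tri (tri d)), Cw)"
    "(rot std ^^ 6) (d, Along) = (d, Along)"
proof -
  have tri: "tri x \<in> set end_list" if "x \<in> set end_list" for x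
    using end_identities(2,3) that by (simp add: tri_def)
  have 1: "rot std (x, Along) = (prod.swap x, Cw)" "rot std (prod.swap x, Cw) = (tri x, Along)"
    if "x \<in> set end_list" for x
    using end_identities(3)[OF that] that by (simp_all add: rot_std tri_def)
  have 6: "tri (tri (tri d)) = d" using end_identities(9)[OF d] .
  show "rot std (d, Along) = (prod.swap d, Cw)" "(rot std ^^ 2) (d, Along) = (tri d, Along)"
    "(rot std ^^ 3) (d, Along) = (prod.swap (tri d), Cw)"
    "(rot std ^^ 4) (d, Along) = (tri (tri d), Along)"
    "(rot std ^^ 5) (d, Along) = (prod.swap (tri (tri d)), Cw)"
    "(rot std ^^ 6) (d, Along) = (d, Along)"
    using d tri[OF d] tri[OF tri[OF d]] 6 by (simp_all add: eval_nat_numeral 1)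
qed

text \<open>
  The walk closes up after six steps but neither after two, because a triangle of the icosahedron
  does not, nor after three, because \<open>Along\<close> and \<open>Cw\<close> alternate.
\<close>

lemma std_hexagon:
  assumes d: "d \<in> set end_list"
  shows "card (orbit (rot std) (d, Along)) = 6"
proof -
  have x: "(d, Along) \<in> ends std" using d by (simp add: ends_std)
  note period = funpow_period_dvd[OF finite_ends_std bij_rot_std x]
  let ?n = "card (orbit (rot std) (d, Along))"
  have "?n dvd 6" "\<not> ?n dvd 2" "\<not> ?n dvd 3"
    using period[of 6] period[of 2] period[of 3] std_hexagon_walk[OF d] end_identities(8)[OF d]
    by simp_all
  moreover have "k \<in> {1, 2, 3, 6}" if "k dvd 6" for k :: nat
  proof -
    have "k \<le> 6" using that by (simp add: dvd_imp_le)
    then have "k \<in> {0, 1, 2, 3, 4, 5, 6}" by auto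
    then show ?thesis using that by auto
  qed
  ultimately show ?thesis by fastforce
qed

lemma std_hexagon':
  assumes d: "d \<in> set end_list"
  shows "card (orbit (rot std) (d, Cw)) = 6"
proof -
  have x: "(d, Cw) \<in> ends std" using d by (simp add: ends_std)
  have "rot std (d, Cw) = (prv d, Along)" using d by (rule rot_std)
  then show ?thesis
    using orbit_same[OF finite_ends_std bij_rot_std x orbit.base] std_hexagon[of "prv d"]
      end_identities(2)[OF d] by simp
qed

lemmas std_len = std_pentagon std_hexagon std_hexagon'

interpretation std: football_map "ends std" "rot std" "opp std"
proof
  show "finite (ends std)" "bij_betw (rot std) (ends std) (ends std)"
    by (rule finite_ends_std bij_rot_std)+
  fix x assume x: "x \<in> ends std"
  show "opp std x \<in> ends std" using x by (rule opp_std_mem)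
  show "opp std (opp std x) = x"
    using x by (rule std_cases) (simp_all add: opp_std end_identities(1-3,6,7))
  show "card (orbit (rot std) x) = 5 \<or> card (orbit (rot std) x) = 6"
    using x by (rule std_cases) (simp_all add: std_len)
  show "card (orbit (rot std) (opp std x)) = 6" if "card (orbit (rot std) x) = 5"
    using x by (rule std_cases) (use that in \<open>simp_all add: std_len opp_std end_identities(1-3)\<close>)
  show "card (orbit (rot std) (opp std x)) = 5 \<longleftrightarrow> card (orbit (rot std) (opp std (rot std x))) = 6"
    if "card (orbit (rot std) x) = 6"
    using x by (rule std_cases)
      (use that in \<open>simp_all add: std_len opp_std rot_std end_identities(1-3)\<close>)
qed

lemma std_kind:
  assumes d: "d \<in> set end_list"
  shows "std.kind (d, Ccw) = (5, 6)" "std.kind (d, Cw) = (6, 5)" "std.kind (d, Along) = (6, 6)"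
  using d end_identities(1-3)[OF d] by (simp_all add: std.kind_def opp_std std_len)

lemma std_turn:
  assumes d: "d \<in> set end_list"
  shows "std.turn (d, Along) = (d, Cw)" "std.turn (d, Cw) = (d, Ccw)" "std.turn (d, Ccw) = (d, Along)"
  using d end_identities(1-3,6,7)[OF d] by (simp_all add: std.turn_def opp_std rot_std)

lemma std_trivalent: "x \<in> ends std \<Longrightarrow> (std.turn ^^ 3) x = x"
  by (erule std_cases) (simp_all add: std_turn eval_nat_numeral)

lemma std_connected:
  assumes X: "X \<subseteq> ends std" "X \<noteq> {}"
    and closed: "\<And>x. x \<in> X \<Longrightarrow> rot std x \<in> X \<and> opp std x \<in> X"
  shows "X = ends std"
proof -
  have turn: "std.turn x \<in> X" if "x \<in> X" for x using closed that by (simp add: std.turn_def)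
  define Y where "Y = {d \<in> set end_list. (d, Along) \<in> X}"
  have all: "(d, c') \<in> X" if "(d, c) \<in> X" for d c c'
  proof -
    have d: "d \<in> set end_list" using that X(1) by (auto simp: ends_std)
    show ?thesis
      using that turn[OF that] turn[OF turn[OF that]]
      by (cases c; cases c') (simp_all add: std_turn[OF d])
  qed
  have "Y = set end_list"
  proof (rule icosahedron_connected)
    obtain d c where dc: "(d, c) \<in> X" using X(2) by auto
    then have "d \<in> set end_list" using X(1) by (auto simp: ends_std)
    then have "d \<in> Y" using all[OF dc] by (simp add: Y_def)
    then show "Y \<noteq> {}" by (metis empty_iff)
    fix d assume "d \<in> Y"
    then have d: "d \<in> set end_list" "(d, c) \<in> X" for c
      unfolding Y_def using all[of d Along c] by blast+
    have "opp std (d, Along) \<in> X" "opp std (d, Ccw) \<in> X" using closed d(2) by blast+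
    then have "(prod.swap d, Along) \<in> X" "(nxt d, Along) \<in> X" using all by (simp_all add: opp_std d(1))
    then show "nxt d \<in> Y" "prod.swap d \<in> Y"
      using end_identities(1,3)[OF d(1)] by (simp_all add: Y_def)
  qed (auto simp: Y_def)
  have "ends std \<subseteq> X"
  proof
    fix x assume "x \<in> ends std"
    then have "fst x \<in> Y" using \<open>Y = set end_list\<close> by (auto simp: ends_std)
    then show "x \<in> X" using all[of "fst x" Along "snd x"] by (simp add: Y_def)
  qed
  then show ?thesis using X(1) by blast
qed

text \<open>The kind of an edge-end determines its direction component, and rotations act on the other one.\<close>

lemma std_homogeneous:
  assumes "x \<in> ends std" "y \<in> ends std" "std.kind x = std.kind y"
  shows "\<exists>\<phi>. \<phi> x = y \<and>
    (\<forall>z\<in>ends std. \<phi> z \<in> ends std \<and> \<phi> (rot std z) = rot std (\<phi> z) \<and> \<phi> (opp std z) = opp std (\<phi> z))"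
proof -
  obtain d c d' c' where xy: "x = (d, c)" "y = (d', c')" "d \<in> set end_list" "d' \<in> set end_list"
    using assms(1,2) by (auto simp: ends_std)
  then have "c = c'" using assms(3) by (cases c; cases c') (simp_all add: std_kind)
  obtain \<phi> where \<phi>: "rotation \<phi>" "\<phi> d = d'" using rotation_transitive xy by blast
  have r: "\<phi> e \<in> set end_list" "\<phi> (nxt e) = nxt (\<phi> e)" "\<phi> (prod.swap e) = prod.swap (\<phi> e)"
    if "e \<in> set end_list" for e using \<phi>(1) that by (auto simp: rotation_def)
  have p: "\<phi> (prv e) = prv (\<phi> e)" if e: "e \<in> set end_list" for e
  proof -
    have e': "prv e \<in> set end_list" "nxt (prv e) = e" using end_identities(2,7)[OF e] .
    then have "\<phi> e = nxt (\<phi> (prv e))" using r(2)[of "prv e"] by simp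
    then show ?thesis using end_identities(6)[OF r(1)[OF e'(1)]] by simp
  qed
  have "map_prod \<phi> id z \<in> ends std \<and> map_prod \<phi> id (rot std z) = rot std (map_prod \<phi> id z) \<and>
      map_prod \<phi> id (opp std z) = opp std (map_prod \<phi> id z)" if "z \<in> ends std" for z
    using that by (rule std_cases) (simp_all add: rot_std opp_std r p ends_std end_identities(1-3))
  then show ?thesis using xy \<open>c = c'\<close> \<phi>(2) by (intro exI[of _ "map_prod \<phi> id"]) simp
qed

text \<open>
  This makes the two faces at an edge different, so that the open star of an edge in the truncated
  icosahedron is evenly covered.
\<close>

lemma std_distinct_faces:
  assumes "x \<in> ends std"
  shows "opp std x \<notin> orbit (rot std) x"
proof
  assume o: "opp std x \<in> orbit (rot std) x"
  then have "std.len (opp std x) = std.len x"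
    using orbit_same[OF finite_ends_std bij_rot_std assms] by simp
  from assms show False
  proof (cases rule: std_cases)
    case (1 d)
    have "orbit (rot std) x = (\<lambda>i. (rot std ^^ i) x) ` {..<6}"
      using orbit_period(3)[OF finite_ends_std bij_rot_std assms] 1 by (simp add: std_len)
    also have "{..<6::nat} = {0, 1, 2, 3, 4, 5}" by auto
    finally have "orbit (rot std) x = {(d, Along), (prod.swap d, Cw), (tri d, Along),
        (prod.swap (tri d), Cw), (tri (tri d), Along), (prod.swap (tri (tri d)), Cw)}"
      using 1 std_hexagon_walk[OF 1(1)] by simp
    then show False using o 1 end_identities(10-12)[OF 1(1)] by (simp add: opp_std)
  qed (use \<open>std.len (opp std x) = std.len x\<close> in
      \<open>simp_all add: opp_std std_len end_identities(1,2)\<close>)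
qed

lemma std_presentation: "football_presentation std"
proof (rule football_presentation.intro)
  show "football_map (ends std) (rot std) (opp std)" by (rule std.football_map_axioms)
  have o: "origin std = orbit (rot std)" and v: "rverts std = orbit (rot std) ` ends std"
    and b: "black std = {F \<in> orbit (rot std) ` ends std. card F = 5}"
    by (simp_all add: standard_football_graph_def dual_ribbon_graph_def)
  show "football_presentation_axioms std"
  proof
    show "opp std d \<noteq> d" if "d \<in> ends std" for d
      using std_distinct_faces[OF that] self_in_orbit_finite[OF finite_ends_std bij_rot_std that] by metis
    show "rverts std = origin std ` ends std" by (simp add: o v)
    show "origin std d = origin std d' \<longleftrightarrow> d' \<in> orbit (rot std) d"
      if "d \<in> ends std" "d' \<in> ends std" for d d'
      using orbit_same[OF finite_ends_std bij_rot_std that(1)]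
        self_in_orbit_finite[OF finite_ends_std bij_rot_std that(2)] unfolding o by metis
    show "black std = origin std ` {d \<in> ends std. std.len d = 5}" by (auto simp: o b)
    show "ends std \<noteq> {}" using mem_end_list[of "(0, 1)"]
      by (auto simp: ends_std is_end_def icosahedron_nbrs_def)
  qed (rule std_connected)
qed

lemma std_all_kinds: "{(5, 6), (6, 5), (6, 6)} \<subseteq> std.kind ` ends std"
proof -
  have "(0, 1) \<in> set end_list" by code_simp
  then obtain d where "d \<in> set end_list" by blast
  note k = std_kind[OF this]
  have "(d, c) \<in> ends std" for c using \<open>d \<in> set end_list\<close> by (simp add: ends_std)
  then have "std.kind (d, c) \<in> std.kind ` ends std" for c by blast
  from this[of Ccw] this[of Cw] this[of Along] show ?thesis by (simp add: k)
qed

section \<open>The topology of the sphere\<close>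

lemma openin_minus_compact:
  fixes K :: "'a::t2_space set"
  assumes "compact K"
  shows "openin (top_of_set S) (S - K)"
  unfolding Diff_eq using assms by (intro openin_open_Int open_Compl compact_imp_closed)

lemma punctured_sphere_plane:
  assumes b: "b \<in> two_sphere"
  obtains h k where "homeomorphism (two_sphere - {b}) (UNIV :: complex set) h k"
proof -
  have "two_sphere - {b} homeomorphic (UNIV :: complex set)"
    by (rule homeomorphic_punctured_sphere_affine) (use b in auto)
  then show ?thesis using that unfolding homeomorphic_def by blast
qed

lemma connected_sphere_minus_finite:
  assumes A: "finite A"
  shows "connected (two_sphere - A)"
proof (cases "two_sphere \<inter> A = {}")
  case True
  then have "two_sphere - A = two_sphere" by blast
  then show ?thesis using connected_sphere[of "0 :: real ^ 3" 1] by simp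
next
  case False
  then obtain b where b: "b \<in> two_sphere" "b \<in> A" by blast
  obtain h k where hk: "homeomorphism (two_sphere - {b}) (UNIV :: complex set) h k"
    using punctured_sphere_plane[OF b(1)] .
  define F where "F = h ` (A \<inter> two_sphere - {b})"
  have "connected (UNIV - F)"
    by (rule connected_open_delete_finite) (use A in \<open>auto simp: F_def\<close>)
  moreover have "continuous_on (UNIV - F) k" using hk by (meson continuous_on_subset homeomorphism_def subset_UNIV)
  ultimately have "connected (k ` (UNIV - F))" by (rule connected_continuous_image[rotated])
  moreover have "k ` (UNIV - F) = two_sphere - A"
  proof
    show "k ` (UNIV - F) \<subseteq> two_sphere - A"
    proof
      fix x assume "x \<in> k ` (UNIV - F)"
      then obtain z where z: "z \<notin> F" "x = k z" by blast
      have "x \<in> two_sphere - {b}" "h x = z"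
        unfolding z(2) using homeomorphism_image2[OF hk] homeomorphism_apply2[OF hk] by blast+
      then show "x \<in> two_sphere - A" using z(1) by (auto simp: F_def)
    qed
    show "two_sphere - A \<subseteq> k ` (UNIV - F)"
    proof
      fix x assume x: "x \<in> two_sphere - A"
      then have xb: "x \<in> two_sphere - {b}" using b by blast
      have "h x \<notin> F"
      proof
        assume "h x \<in> F"
        then obtain y where y: "y \<in> A \<inter> two_sphere - {b}" "h x = h y" unfolding F_def by (elim imageE)
        then have "x = y" using homeomorphism_apply1[OF hk] xb by (metis Diff_iff IntE)
        then show False using x y(1) by blast
      qed
      then show "x \<in> k ` (UNIV - F)" using homeomorphism_apply1[OF hk xb] by (metis DiffI UNIV_I imageI)
    qed
  qed
  ultimately show ?thesis by simp
qed

lemma punctured_neighbourhood_sphere: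
  assumes N: "openin (top_of_set two_sphere) N" and v: "v \<in> N"
  obtains D where "openin (top_of_set two_sphere) D" "v \<in> D" "D \<subseteq> N" "connected (D - {v})"
proof -
  have vS: "v \<in> two_sphere" using assms openin_imp_subset by blast
  define b where "b = - v"
  have "v \<noteq> 0" using vS by auto
  then have "v + v \<noteq> 0" by (metis scaleR_2 scaleR_eq_0_iff zero_neq_numeral)
  then have b: "b \<in> two_sphere" "b \<noteq> v" using vS unfolding b_def by (auto simp: eq_neg_iff_add_eq_0)
  obtain h k where hk: "homeomorphism (two_sphere - {b}) (UNIV :: complex set) h k"
    using punctured_sphere_plane[OF b(1)] .
  have kh: "homeomorphism (UNIV :: complex set) (two_sphere - {b}) k h" using hk homeomorphism_sym by blast
  have open_S: "openin (top_of_set two_sphere) (two_sphere - {b})"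
    by (rule openin_delete) (rule openin_subtopology_self)
  have "openin (top_of_set (two_sphere - {b})) (N - {b})"
    using N openin_subset_trans[of two_sphere "N - {b}" "two_sphere - {b}"]
      openin_imp_subset[OF N] by (metis Diff_mono openin_delete order_refl Diff_subset)
  then have "openin (top_of_set UNIV) (h ` (N - {b}))" by (rule homeomorphism_imp_open_map[OF hk])
  then have "open (h ` (N - {b}))" by simp
  moreover have "h v \<in> h ` (N - {b})" using v b by blast
  ultimately obtain e where e: "0 < e" "ball (h v) e \<subseteq> h ` (N - {b})" by (meson open_contains_ball)
  define D where "D = k ` ball (h v) e"
  have kv: "k (h v) = v" using homeomorphism_apply1[OF hk] vS b(2) by simp
  show ?thesis
  proof
    have "openin (top_of_set (two_sphere - {b})) D"
      unfolding D_def by (rule homeomorphism_imp_open_map[OF kh]) simp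
    then show "openin (top_of_set two_sphere) D" using open_S openin_trans by blast
    show "v \<in> D" unfolding D_def using e(1) kv by (metis centre_in_ball imageI)
    show "D \<subseteq> N"
    proof
      fix x assume "x \<in> D"
      then obtain y where y: "y \<in> N - {b}" "x = k (h y)" using e(2) unfolding D_def by blast
      then have "y \<in> two_sphere - {b}" using openin_imp_subset[OF N] by blast
      then show "x \<in> N" using y homeomorphism_apply1[OF hk] by simp
    qed
    have "connected (ball (h v) e - {h v})"
      by (rule connected_open_delete) auto
    then have "connected (k ` (ball (h v) e - {h v}))"
      using hk by (meson connected_continuous_image continuous_on_subset homeomorphism_def subset_UNIV)
    moreover have "k ` (ball (h v) e - {h v}) = D - {v}"
      unfolding D_def using kv homeomorphism_apply2[OF hk]by (auto simp: image_iff)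
    ultimately show "connected (D - {v})" by simp
  qed
qed

text \<open>
  The Jordan curve theorem is transferred from the plane by removing a point off the curve; the
  bounded side stays away from the removed point.
\<close>

lemma Jordan_sphere:
  assumes c: "simple_path c" "pathfinish c = pathstart c" "path_image c \<subseteq> two_sphere"
    and b: "b \<in> two_sphere - path_image c"
  shows "\<not> connected (two_sphere - path_image c)"
proof -
  obtain h k where hk: "homeomorphism (two_sphere - {b}) (UNIV :: complex set) h k"
    using punctured_sphere_plane[OF DiffD1[OF b]] .
  have kh: "homeomorphism (UNIV :: complex set) (two_sphere - {b}) k h" using hk homeomorphism_sym by blast
  have sub: "path_image c \<subseteq> two_sphere - {b}" using b c(3) by blast
  have inj: "inj_on h (two_sphere - {b})" using homeomorphism_apply1[OF hk] by (metis inj_onI)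
  define C where "C = path_image (h \<circ> c)"
  have C: "C = h ` path_image c" by (simp add: C_def path_image_compose)
  have "simple_path (h \<circ> c)"
  proof (rule simple_path_continuous_image[OF c(1)])
    show "continuous_on (path_image c) h" using hk sub by (meson continuous_on_subset homeomorphism_def)
    show "inj_on h (path_image c)" using inj sub inj_on_subset by blast
  qed
  moreover have "pathfinish (h \<circ> c) = pathstart (h \<circ> c)" using c(2) by (simp add: pathfinish_def pathstart_def)
  ultimately have I: "inside C \<noteq> {}" "open (inside C)" "outside C \<noteq> {}" "bounded (inside C)"
    "inside C \<inter> outside C = {}" "inside C \<union> outside C = - C" "frontier (inside C) = C"
    unfolding C_def using Jordan_inside_outside by blast+
  define U where "U = k ` inside C"
  define V where "V = two_sphere - k ` closure (inside C)"
  have k_im: "k ` X \<subseteq> two_sphere - {b}" for X using homeomorphism_image2[OF hk] by blast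
  have open_S: "openin (top_of_set two_sphere) (two_sphere - {b})"
    by (rule openin_delete) (rule openin_subtopology_self)
  have "openin (top_of_set (two_sphere - {b})) U"
    unfolding U_def by (rule homeomorphism_imp_open_map[OF kh]) (simp add: I(2))
  then have U: "openin (top_of_set two_sphere) U" using open_S openin_trans by blast
  have "compact (closure (inside C))" using I(4) by simp
  then have "compact (k ` closure (inside C))"
    using kh by (meson compact_continuous_image continuous_on_subset homeomorphism_def subset_UNIV)
  then have V: "openin (top_of_set two_sphere) V"
    unfolding V_def by (rule openin_minus_compact)
  have cl: "closure (inside C) = inside C \<union> C"
    using I(2,7) by (metis Un_commute closure_Un_frontier)
  have kC: "k ` C = path_image c"
  proof -
    have "k (h x) = x" if "x \<in> path_image c" for x using that sub homeomorphism_apply1[OF hk] by blast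
    then show ?thesis unfolding C image_image by simp
  qed
  have k_inj: "k x = k y \<longleftrightarrow> x = y" for x y using homeomorphism_apply2[OF hk] by (metis UNIV_I)
  let ?W = "two_sphere - path_image c"
  have Usub: "U \<subseteq> ?W"
  proof
    fix x assume "x \<in> U"
    then obtain z where z: "z \<in> inside C" "x = k z" by (auto simp: U_def)
    then have "z \<notin> C" using I(6) by blast
    then have "x \<notin> k ` C" using z(2) k_inj by (metis imageE)
    then show "x \<in> ?W" using z(2) k_im[of "{z}"] unfolding kC by simp
  qed
  show ?thesis
  proof
    assume conn: "connected ?W"
    have "openin (top_of_set ?W) U" by (rule openin_subset_trans[OF U Usub Diff_subset])
    moreover have "openin (top_of_set ?W) (V \<inter> ?W)" using V by (auto simp: openin_open)
    moreover have "?W \<subseteq> U \<union> (V \<inter> ?W)" unfolding V_def U_def cl image_Un kC by blast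
    moreover have "U \<inter> (V \<inter> ?W) = {}" unfolding V_def U_def cl by blast
    moreover have "U \<noteq> {}" using I(1) by (simp add: U_def)
    moreover have "b \<in> V \<inter> ?W" using b k_im[of "closure (inside C)"] by (auto simp: V_def)
    ultimately show False using conn unfolding connected_openin by (metis empty_iff)
  qed
qed

section \<open>Maps on surfaces and their face charts\<close>

text \<open>
  Since every node is the end of an edge, every point of the surface lies in the image of a polygon
  that parametrises a face.
\<close>

locale map_with_charts =
  fixes S :: "'a::t2_space set" and M :: "('a, 'e) surface_map"
  assumes map_on_surface: "map_on_surface S M"
    and node_has_edge: "v \<in> nodes M \<Longrightarrow> \<exists>d\<in>oedges M. ocurve M d 0 = v"
begin

abbreviation "E \<equiv> oedges M"
abbreviation "W \<equiv> walk_next M"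
abbreviation "L \<equiv> left_face M"
abbreviation "\<gamma> \<equiv> ocurve M"
abbreviation "n \<equiv> sides M"

definition arc_of :: "'e \<times> bool \<Rightarrow> 'a set" where "arc_of d = \<gamma> d ` {0<..<1}"

lemma graph: "embedded_graph S M" using map_on_surface by (simp add: map_on_surface_def)

lemma fin: "finite E" using graph by (simp add: embedded_graph_def oedges_def)

lemma fin_nodes: "finite (nodes M)" using graph by (simp add: embedded_graph_def)

lemma bij: "bij_betw W E E" using map_on_surface by (simp add: map_on_surface_def)

lemma flip_flip [simp]: "flip (flip d) = d" and flip_ne [simp]: "flip d \<noteq> d"
  by (simp_all add: flip_def prod_eq_iff)

lemma flip_mem: "d \<in> E \<Longrightarrow> flip d \<in> E" by (auto simp: flip_def oedges_def)

lemma W_mem: "d \<in> E \<Longrightarrow> W d \<in> E" using bij by (auto simp: bij_betw_def)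

lemma W_pow_mem: "d \<in> E \<Longrightarrow> (W ^^ i) d \<in> E" using bij_betw_funpow_mem[OF bij] .

lemma curve_flip: "\<gamma> (flip d) t = \<gamma> d (1 - t)"
  by (simp add: ocurve_def flip_def)

lemma edge_of: "d \<in> E \<Longrightarrow> fst d \<in> edges M" by (auto simp: oedges_def)

lemma continuous_curve: assumes "d \<in> E" shows "continuous_on {0..1} (\<gamma> d)"
proof -
  have c: "continuous_on {0..1} (curve M (fst d))"
    using graph edge_of[OF assms] by (simp add: embedded_graph_def path_def)
  show ?thesis
  proof (cases "snd d")
    case True
    then have "\<gamma> d = curve M (fst d)" by (auto simp: ocurve_def)
    then show ?thesis using c by simp
  next
    case False
    have "continuous_on {0..1} (curve M (fst d) \<circ> (\<lambda>t. 1 - t))"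
      by (rule continuous_on_compose) (auto intro!: continuous_intros continuous_on_subset[OF c])
    moreover have "\<gamma> d = curve M (fst d) \<circ> (\<lambda>t. 1 - t)" using False by (auto simp: ocurve_def)
    ultimately show ?thesis by simp
  qed
qed

lemma curve_start: assumes "d \<in> E" shows "\<gamma> d 0 \<in> nodes M"
proof -
  have "curve M (fst d) 0 \<in> nodes M" "curve M (fst d) 1 \<in> nodes M"
    using graph edge_of[OF assms] unfolding embedded_graph_def pathstart_def pathfinish_def by blast+
  then show ?thesis by (simp add: ocurve_def)
qed

lemma curve_end: assumes "d \<in> E" shows "\<gamma> d 1 \<in> nodes M"
  using curve_start[OF flip_mem[OF assms]] by (simp add: curve_flip)

lemma curve_in_S: "d \<in> E \<Longrightarrow> t \<in> {0..1} \<Longrightarrow> \<gamma> d t \<in> S"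
proof -
  assume d: "d \<in> E" and t: "t \<in> {0..1}"
  have "path_image (curve M (fst d)) \<subseteq> S"
    using graph edge_of[OF d] unfolding embedded_graph_def by blast
  then have "curve M (fst d) s \<in> S" if "s \<in> {0..1}" for s using that by (auto simp: path_image_def)
  then show ?thesis using t by (simp add: ocurve_def)
qed

lemma curve_notin_nodes: "d \<in> E \<Longrightarrow> t \<in> {0<..<1} \<Longrightarrow> \<gamma> d t \<notin> nodes M"
proof -
  assume d: "d \<in> E" and t: "t \<in> {0<..<1}"
  have "curve M (fst d) s \<notin> nodes M" if "s \<in> {0<..<1}" for s
    using graph edge_of[OF d] that unfolding embedded_graph_def by blast
  then show ?thesis using t by (simp add: ocurve_def)
qed

lemma curve_eq:
  assumes d: "d \<in> E" "d' \<in> E" and t: "t \<in> {0<..<1}" and s: "s \<in> {0..1}" and eq: "\<gamma> d t = \<gamma> d' s"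
  shows "d' = d \<and> s = t \<or> d' = flip d \<and> s = 1 - t"
proof -
  have s': "s \<in> {0<..<1}"
    using curve_notin_nodes[OF d(1) t] curve_start[OF d(2)] curve_end[OF d(2)] eq s
    by (metis atLeastAtMost_iff greaterThanLessThan_iff order_le_less)
  define t' where "t' = (if snd d then t else 1 - t)"
  define s'' where "s'' = (if snd d' then s else 1 - s)"
  have i: "t' \<in> {0<..<1}" "s'' \<in> {0<..<1}" using t s' by (auto simp: t'_def s''_def)
  have eq': "curve M (fst d) t' = curve M (fst d') s''" using eq by (simp add: ocurve_def t'_def s''_def)
  then have "curve M (fst d) ` {0<..<1} \<inter> curve M (fst d') ` {0<..<1} \<noteq> {}" using i by blast
  then have f: "fst d = fst d'"
    using graph edge_of[OF d(1)] edge_of[OF d(2)] unfolding embedded_graph_def by blast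
  then have "t' = s''"
    using graph edge_of[OF d(1)] eq' i unfolding embedded_graph_def inj_on_def by metis
  then show ?thesis using f by (cases d; cases d') (auto simp: t'_def s''_def flip_def split: if_splits)
qed

lemma curve_inj: "d \<in> E \<Longrightarrow> inj_on (\<gamma> d) {0<..<1}"
proof (rule inj_onI)
  fix t s assume "d \<in> E" "t \<in> {0<..<1}" "s \<in> {0<..<1}" "\<gamma> d t = \<gamma> d s"
  then show "t = s" using curve_eq[of d d t s] flip_ne[of d] by auto
qed

lemma arc_of_flip: "arc_of (flip d) = arc_of d"
proof -
  have "(\<lambda>t::real. 1 - t) ` {0<..<1} = {0<..<1}"
    by (auto simp: image_iff intro!: bexI[of _ "1 - _"])
  then show ?thesis unfolding arc_of_def by (metis (no_types, lifting) curve_flip image_cong image_image)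
qed

lemma arc_of_disjoint: "d \<in> E \<Longrightarrow> d' \<in> E \<Longrightarrow> d' \<noteq> d \<Longrightarrow> d' \<noteq> flip d \<Longrightarrow> arc_of d \<inter> arc_of d' = {}"
proof (rule ccontr)
  assume d: "d \<in> E" "d' \<in> E" "d' \<noteq> d" "d' \<noteq> flip d" and "arc_of d \<inter> arc_of d' \<noteq> {}"
  then obtain t s where "t \<in> {0<..<1}" "s \<in> {0<..<1}" "\<gamma> d t = \<gamma> d' s" unfolding arc_of_def by blast
  then show False using curve_eq[OF d(1,2), of t s] d(3,4) by auto
qed

lemma arc_of_nodes: "d \<in> E \<Longrightarrow> arc_of d \<inter> nodes M = {}"
  unfolding arc_of_def using curve_notin_nodes[of d] by (auto simp: disjoint_iff)

lemma curve_image: assumes "d \<in> E" shows "\<gamma> d ` {0..1} = arc_of d \<union> {\<gamma> d 0, \<gamma> d 1}"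
proof -
  have "{0..1::real} = {0<..<1} \<union> {0, 1}" by auto
  then show ?thesis unfolding arc_of_def by (simp add: image_Un)
qed

lemma skeleton_eq: "skeleton M = nodes M \<union> (\<Union>d\<in>E. arc_of d)"
proof -
  have "curve M e ` {0..1} = arc_of (e, True) \<union> {\<gamma> (e, True) 0, \<gamma> (e, True) 1}" if "e \<in> edges M" for e
    using curve_image[of "(e, True)"] that by (simp add: ocurve_def oedges_def)
  moreover have "arc_of (e, False) = arc_of (e, True)" for e
    using arc_of_flip[of "(e, True)"] by (simp add: flip_def)
  moreover have "\<gamma> (e, True) 0 \<in> nodes M" "\<gamma> (e, True) 1 \<in> nodes M" if "e \<in> edges M" for e
    using that by (auto intro!: curve_start curve_end simp: oedges_def)
  ultimately show ?thesis
    unfolding skeleton_def oedges_def by (auto simp: UNIV_bool)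
qed

lemma curve_in_skeleton: "d \<in> E \<Longrightarrow> t \<in> {0..1} \<Longrightarrow> \<gamma> d t \<in> skeleton M"
proof -
  assume d: "d \<in> E" and "t \<in> {0..1}"
  then have "\<gamma> d t \<in> \<gamma> d ` {0..1}" by (intro imageI)
  then have "\<gamma> d t \<in> arc_of d \<union> {\<gamma> d 0, \<gamma> d 1}" unfolding curve_image[OF d] .
  then show ?thesis using curve_start[OF d] curve_end[OF d] d by (auto simp: skeleton_eq)
qed

lemma arc_of_subset: "d \<in> E \<Longrightarrow> arc_of d \<subseteq> S"
  unfolding arc_of_def using curve_in_S[of d] by (auto simp: image_subset_iff)

lemma face_component: "d \<in> E \<Longrightarrow> L d \<in> components (S - skeleton M)"
  using map_on_surface by (auto simp: map_on_surface_def faces_def)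

lemma face_subset: "d \<in> E \<Longrightarrow> L d \<subseteq> S - skeleton M"
  using face_component in_components_subset by blast

lemma face_connected: "d \<in> E \<Longrightarrow> connected (L d)"
  using face_component in_components_connected by blast

lemma face_eq_iff: "d \<in> E \<Longrightarrow> d' \<in> E \<Longrightarrow> L d = L d' \<longleftrightarrow> d' \<in> orbit W d"
  using map_on_surface by (simp add: map_on_surface_def)

lemma face_disjoint: "d \<in> E \<Longrightarrow> d' \<in> E \<Longrightarrow> L d \<inter> L d' \<noteq> {} \<Longrightarrow> L d = L d'"
  using components_nonoverlap[OF face_component face_component] by blast

lemma face_W: "d \<in> E \<Longrightarrow> L (W d) = L d"
  using face_eq_iff[of d "W d"] W_mem orbit.base by metis

lemma face_W_pow: "d \<in> E \<Longrightarrow> L ((W ^^ i) d) = L d"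
  by (induction i) (simp_all add: face_W W_pow_mem)

lemma sides_pos: "d \<in> E \<Longrightarrow> 0 < n d"
  using orbit_period(1)[OF fin bij] by (simp add: sides_def)

lemma W_sides: "d \<in> E \<Longrightarrow> (W ^^ n d) d = d"
  using orbit_period(2)[OF fin bij] by (simp add: sides_def)

lemma sides_orbit: "d \<in> E \<Longrightarrow> d' \<in> orbit W d \<Longrightarrow> n d' = n d"
  using orbit_same[OF fin bij] by (metis sides_def)

lemma sides_W: "d \<in> E \<Longrightarrow> n (W d) = n d"
  using sides_orbit orbit.base by metis

lemma sides_W_pow: "d \<in> E \<Longrightarrow> n ((W ^^ i) d) = n d"
  by (induction i) (simp_all add: sides_W W_pow_mem)

lemma orbit_W: "d \<in> E \<Longrightarrow> d' \<in> orbit W d \<Longrightarrow> \<exists>i<n d. d' = (W ^^ i) d"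
  using orbit_period(3)[OF fin bij, of d] unfolding sides_def by auto

lemma skeleton_subset: "skeleton M \<subseteq> S"
  unfolding skeleton_eq using arc_of_subset graph by (auto simp: embedded_graph_def)

definition corner_turn :: "'e \<times> bool \<Rightarrow> complex" where "corner_turn d = cis (2 * pi / n d)"

lemma corner_turn_pow: "corner_turn d ^ i = cis (2 * pi * i / n d)"
  unfolding corner_turn_def Complex.DeMoivre by (simp add: mult_ac)

lemma corner_turn_sides: "d \<in> E \<Longrightarrow> corner_turn d ^ n d = 1"
  using sides_pos[of d] by (simp add: corner_turn_pow)

lemma corner_turn_pow_mod: "d \<in> E \<Longrightarrow> corner_turn d ^ (i mod n d) = corner_turn d ^ i"
proof -
  assume d: "d \<in> E"
  have "corner_turn d ^ i = corner_turn d ^ (n d * (i div n d) + i mod n d)" by simp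
  also have "\<dots> = corner_turn d ^ (i mod n d)"
    unfolding power_add power_mult by (simp add: corner_turn_sides[OF d])
  finally show ?thesis by simp
qed

lemma ball_rotate: "z \<in> ball 0 1 \<Longrightarrow> z * corner_turn d ^ i \<in> ball 0 1"
  by (simp add: norm_mult corner_turn_pow)

text \<open>
  The parametrisations of the faces by polygons are chosen coherently: the charts for two oriented
  edges on the boundary of the same face differ by the rotation which takes one side to the other.
\<close>

definition coherent_charts :: "('e \<times> bool \<Rightarrow> complex \<Rightarrow> 'a) \<Rightarrow> bool" where
  "coherent_charts g \<longleftrightarrow> (\<forall>d\<in>E. continuous_on (cball 0 1) (g d) \<and> inj_on (g d) (ball 0 1) \<and>
     g d ` ball 0 1 = L d \<and> (\<forall>t\<in>{0..1}. g d (cis (2 * pi * t / n d)) = \<gamma> d t) \<and>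
     (\<forall>z. g (W d) z = g d (z * corner_turn d)))"

lemma coherent_charts_exist: "\<exists>g. coherent_charts g"
proof -
  have "\<exists>g. continuous_on (cball 0 1) g \<and> inj_on g (ball 0 1) \<and> g ` ball 0 1 = L d \<and>
      (\<forall>i<n d. \<forall>t\<in>{0..1}. g (cis (2 * pi * (real i + t) / n d)) = \<gamma> ((W ^^ i) d) t)"
    if "d \<in> E" for d
  proof -
    have "disc_with_boundary_walk M d" using map_on_surface that by (simp add: map_on_surface_def)
    then obtain g h where g: "continuous_on (cball 0 1) g" "homeomorphism (ball 0 1) (L d) g h"
      "\<forall>i<n d. \<forall>t\<in>{0..1}. g (cis (2 * pi * (real i + t) / n d)) = \<gamma> ((W ^^ i) d) t"
      unfolding disc_with_boundary_walk_def by blast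
    moreover have "inj_on g (ball 0 1)" using homeomorphism_apply1[OF g(2)] by (metis inj_onI)
    ultimately show ?thesis using homeomorphism_image1[OF g(2)] by blast
  qed
  then obtain c where c: "\<And>d. d \<in> E \<Longrightarrow> continuous_on (cball 0 1) (c d) \<and> inj_on (c d) (ball 0 1) \<and>
      c d ` ball 0 1 = L d \<and>
      (\<forall>i<n d. \<forall>t\<in>{0..1}. c d (cis (2 * pi * (real i + t) / n d)) = \<gamma> ((W ^^ i) d) t)"
    by metis
  \<comment> \<open>The number of sides is carried along so that one map rotates the charts of all faces.\<close>
  define R :: "nat \<times> (complex \<Rightarrow> 'a) \<Rightarrow> nat \<times> (complex \<Rightarrow> 'a)"
    where "R = (\<lambda>(k, f). (k, \<lambda>z. f (z * cis (2 * pi / k))))"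
  have R_pow: "(R ^^ i) (k, f) = (k, \<lambda>z. f (z * cis (2 * pi / k) ^ i))" for i k f
    by (induction i) (simp_all add: R_def mult_ac)
  have "(R ^^ card (orbit W d)) (n d, c d) = (n d, c d)" if "d \<in> E" for d
    using corner_turn_sides[OF that] by (simp add: R_pow corner_turn_def flip: sides_def)
  then obtain q where q: "\<forall>x\<in>E. q (W x) = R (q x) \<and>
      (\<exists>y\<in>orbit W x. \<exists>i. x = (W ^^ i) y \<and> q x = (R ^^ i) (n y, c y))"
    using equivariant_extension[OF fin bij, of R "\<lambda>d. (n d, c d)"] by blast
  have "coherent_charts (\<lambda>d. snd (q d))"
    unfolding coherent_charts_def
  proof
    fix d assume d: "d \<in> E"
    obtain y i where y: "y \<in> orbit W d" "d = (W ^^ i) y" "q d = (R ^^ i) (n y, c y)" using q d by blast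
    have yE: "y \<in> E" using y(1) d orbit_subset_carrier[OF bij] by blast
    have ny: "n y = n d" using sides_orbit[OF d y(1)] .
    let ?\<omega> = "corner_turn d"
    have qd: "q d = (n d, \<lambda>z. c y (z * ?\<omega> ^ i))"
      unfolding y(3) R_pow ny by (simp add: corner_turn_def)
    have cy: "continuous_on (cball 0 1) (c y)" "inj_on (c y) (ball 0 1)" "c y ` ball 0 1 = L y"
      "\<And>j t. j < n d \<Longrightarrow> t \<in> {0..1} \<Longrightarrow> c y (cis (2 * pi * (real j + t) / n d)) = \<gamma> ((W ^^ j) y) t"
      using c[OF yE] ny by auto
    have \<omega>: "?\<omega> ^ i \<noteq> 0" by (simp add: corner_turn_pow)
    have "continuous_on (cball 0 1) (\<lambda>z. c y (z * ?\<omega> ^ i))"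
      by (rule continuous_on_compose2[OF cy(1)]) (auto intro!: continuous_intros simp: norm_mult corner_turn_pow)
    moreover have "inj_on (\<lambda>z. c y (z * ?\<omega> ^ i)) (ball 0 1)"
    proof (rule inj_onI)
      fix z z' :: complex
      assume "z \<in> ball 0 1" "z' \<in> ball 0 1" and "c y (z * ?\<omega> ^ i) = c y (z' * ?\<omega> ^ i)"
      then have "z * ?\<omega> ^ i = z' * ?\<omega> ^ i" using inj_onD[OF cy(2)] ball_rotate by blast
      then show "z = z'" using \<omega> by (metis mult_right_cancel)
    qed
    moreover have "(\<lambda>z. c y (z * ?\<omega> ^ i)) ` ball 0 1 = L d"
    proof -
      have "(\<lambda>z. z * ?\<omega> ^ i) ` ball 0 1 = ball 0 1"
      proof
        show "ball 0 1 \<subseteq> (\<lambda>z. z * ?\<omega> ^ i) ` ball 0 1"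
        proof
          fix z :: complex assume "z \<in> ball 0 1"
          then have "z / ?\<omega> ^ i \<in> ball 0 1" by (simp add: norm_divide corner_turn_pow)
          then show "z \<in> (\<lambda>z. z * ?\<omega> ^ i) ` ball 0 1" using \<omega> by (intro image_eqI) auto
        qed
      qed (use ball_rotate[of _ d i] in auto)
      then have "c y ` (\<lambda>z. z * ?\<omega> ^ i) ` ball 0 1 = L y" using cy(3) by simp
      then show ?thesis using face_W_pow[OF yE] y(2) by (simp add: image_image)
    qed
    moreover have "c y (cis (2 * pi * t / n d) * ?\<omega> ^ i) = \<gamma> d t" if "t \<in> {0..1}" for t
    proof -
      let ?j = "i mod n d"
      have "cis (2 * pi * t / n d) * ?\<omega> ^ i = cis (2 * pi * t / n d) * ?\<omega> ^ ?j"
        using corner_turn_pow_mod[OF d] by simp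
      also have "\<dots> = cis (2 * pi * (real ?j + t) / n d)"
        by (simp add: corner_turn_pow cis_mult add_divide_distrib ring_distribs add_ac)
      finally have "c y (cis (2 * pi * t / n d) * ?\<omega> ^ i) = \<gamma> ((W ^^ ?j) y) t"
        using cy(4)[OF _ that] sides_pos[OF d] by simp
      moreover have "(W ^^ ?j) y = d" using funpow_mod_eq[OF W_sides[OF yE], of i] y(2) ny by simp
      ultimately show ?thesis by simp
    qed
    moreover have "snd (q (W d)) z = snd (q d) (z * ?\<omega>)" for z
      using q d by (simp add: qd R_def corner_turn_def)
    ultimately show "continuous_on (cball 0 1) (snd (q d)) \<and> inj_on (snd (q d)) (ball 0 1) \<and>
      snd (q d) ` ball 0 1 = L d \<and> (\<forall>t\<in>{0..1}. snd (q d) (cis (2 * pi * t / n d)) = \<gamma> d t) \<and>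
      (\<forall>z. snd (q (W d)) z = snd (q d) (z * corner_turn d))"
      by (simp add: qd)
  qed
  then show ?thesis by blast
qed

definition chart :: "'e \<times> bool \<Rightarrow> complex \<Rightarrow> 'a" where "chart = (SOME g. coherent_charts g)"

lemma chart:
  assumes "d \<in> E"
  shows "continuous_on (cball 0 1) (chart d)" "inj_on (chart d) (ball 0 1)" "chart d ` ball 0 1 = L d"
    "t \<in> {0..1} \<Longrightarrow> chart d (cis (2 * pi * t / n d)) = \<gamma> d t"
    "chart (W d) z = chart d (z * corner_turn d)"
proof -
  have "coherent_charts chart" unfolding chart_def by (rule someI_ex[OF coherent_charts_exist])
  then show "continuous_on (cball 0 1) (chart d)" "inj_on (chart d) (ball 0 1)" "chart d ` ball 0 1 = L d"
    "t \<in> {0..1} \<Longrightarrow> chart d (cis (2 * pi * t / n d)) = \<gamma> d t"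
    "chart (W d) z = chart d (z * corner_turn d)"
    using assms unfolding coherent_charts_def by blast+
qed

lemma chart_W_pow: "d \<in> E \<Longrightarrow> chart ((W ^^ i) d) z = chart d (z * corner_turn d ^ i)"
proof (induction i arbitrary: z)
  case (Suc i)
  have "corner_turn ((W ^^ i) d) = corner_turn d" using Suc.prems by (simp add: corner_turn_def sides_W_pow)
  then show ?case
    using Suc.IH[OF Suc.prems] chart(5)[OF W_pow_mem[OF Suc.prems, of i]] by (simp add: mult_ac)
qed simp

lemma chart_boundary:
  assumes d: "d \<in> E" and t: "t \<in> {0..1}"
  shows "chart d (cis (2 * pi * (real i + t) / n d)) = \<gamma> ((W ^^ i) d) t"
proof -
  have "cis (2 * pi * (real i + t) / n d) = cis (2 * pi * t / n d) * corner_turn d ^ i"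
    by (simp add: corner_turn_pow cis_mult add_divide_distrib ring_distribs add_ac)
  then show ?thesis
    using chart_W_pow[OF d, of i] chart(4)[OF W_pow_mem[OF d, of i] t] by (simp add: sides_W_pow d)
qed

lemma curve_continues: assumes "d \<in> E" shows "\<gamma> d 1 = \<gamma> (W d) 0"
  using chart_boundary[OF assms, of 1 0] chart_boundary[OF assms, of 0 1] by simp

lemma boundary_point:
  assumes d: "d \<in> E" and z: "norm z = 1"
  obtains i t where "i < n d" "0 \<le> t" "t < 1" "z = cis (2 * pi * (real i + t) / n d)"
    "chart d z = \<gamma> ((W ^^ i) d) t"
proof -
  let ?n = "real (n d)"
  have n: "0 < ?n" using sides_pos[OF d] by simp
  obtain a where a: "z = cis a" using z by (metis complex_norm_eq_1_exp_eq cis_conv_exp)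
  define x where "x = a * ?n / (2 * pi)"
  define y where "y = x - ?n * \<lfloor>x / ?n\<rfloor>"
  have "0 \<le> y" "y < ?n"
  proof -
    have "of_int \<lfloor>x / ?n\<rfloor> * ?n \<le> x" "x < (of_int \<lfloor>x / ?n\<rfloor> + 1) * ?n"
      unfolding pos_le_divide_eq[OF n, symmetric] pos_divide_less_eq[OF n, symmetric] by linarith+
    then show "0 \<le> y" "y < ?n" by (simp_all add: y_def algebra_simps)
  qed
  define i where "i = nat \<lfloor>y\<rfloor>"
  define t where "t = y - real i"
  have it: "i < n d" "0 \<le> t" "t < 1" using \<open>0 \<le> y\<close> \<open>y < ?n\<close> unfolding i_def t_def by linarith+
  have "a = 2 * pi * y / ?n + 2 * pi * \<lfloor>x / ?n\<rfloor>" using n by (simp add: y_def x_def field_simps)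
  then have "z = cis (2 * pi * y / ?n) * cis (2 * pi * \<lfloor>x / ?n\<rfloor>)" by (simp only: a cis_mult)
  also have "cis (2 * pi * \<lfloor>x / ?n\<rfloor>) = 1" by (rule cis_multiple_2pi) simp
  finally have "z = cis (2 * pi * (real i + t) / n d)" by (simp add: t_def)
  then show ?thesis using that it chart_boundary[OF d, of t i] by simp
qed

lemma chart_interior: "d \<in> E \<Longrightarrow> z \<in> ball 0 1 \<Longrightarrow> chart d z \<in> L d"
  using chart(3) by blast

lemma chart_boundary_skeleton:
  assumes "d \<in> E" "norm z = 1" shows "chart d z \<in> skeleton M"
proof -
  obtain i t where "0 \<le> t" "t < 1" "chart d z = \<gamma> ((W ^^ i) d) t" using boundary_point[OF assms] .
  then show ?thesis using curve_in_skeleton[OF W_pow_mem[OF assms(1)]] by simp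
qed

lemma cball_cases: "z \<in> cball 0 1 \<Longrightarrow> z \<in> ball 0 1 \<or> norm z = 1" for z :: complex by auto

lemma chart_in_S: "d \<in> E \<Longrightarrow> z \<in> cball 0 1 \<Longrightarrow> chart d z \<in> S"
  using cball_cases[of z] chart_interior face_subset chart_boundary_skeleton skeleton_subset by blast

lemma chart_eq_interior:
  assumes d: "d \<in> E" "d' \<in> E" and z: "z \<in> ball 0 1" "z' \<in> cball 0 1" and eq: "chart d z = chart d' z'"
  shows "z' \<in> ball 0 1 \<and> (\<exists>i<n d. d' = (W ^^ i) d \<and> z = z' * corner_turn d ^ i)"
proof -
  have "chart d z \<in> L d" using chart_interior d z by blast
  then have "chart d' z' \<notin> skeleton M" using eq face_subset[OF d(1)] by auto
  then have z': "z' \<in> ball 0 1" using cball_cases[OF z(2)] chart_boundary_skeleton[OF d(2)] by blast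
  then have "L d = L d'" using chart_interior[OF d(2)] eq \<open>chart d z \<in> L d\<close> face_disjoint[OF d] by auto
  then obtain i where i: "i < n d" "d' = (W ^^ i) d" using face_eq_iff[OF d] orbit_W[OF d(1)] by blast
  have "chart d z = chart d (z' * corner_turn d ^ i)" using eq chart_W_pow[OF d(1)] i(2) by simp
  then have "z = z' * corner_turn d ^ i"
    by (rule inj_onD[OF chart(2)[OF d(1)] _ z(1) ball_rotate[OF z']])
  then show ?thesis using z' i by blast
qed

lemma surface_point_cases:
  assumes "x \<in> S"
  obtains (face) d where "d \<in> E" "x \<in> L d"
  | (arc) d t where "d \<in> E" "t \<in> {0<..<1}" "x = \<gamma> d t"
  | (node) "x \<in> nodes M"
proof (cases "x \<in> skeleton M")
  case True
  then show ?thesis using that(2,3) by (auto simp: skeleton_eq arc_of_def)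
next
  case False
  then have "x \<in> \<Union> (components (S - skeleton M))" using assms by (simp add: Union_components)
  also have "components (S - skeleton M) = L ` E"
    using map_on_surface by (simp add: map_on_surface_def faces_def)
  finally show ?thesis using that(1) by blast
qed

lemma curve_chart: "d \<in> E \<Longrightarrow> t \<in> {0..1} \<Longrightarrow> \<exists>z. norm z = 1 \<and> \<gamma> d t = chart d z"
  using chart(4)[of d t] by (metis norm_cis)

lemma charts_cover:
  assumes "x \<in> S"
  obtains d z where "d \<in> E" "z \<in> cball 0 1" "x = chart d z"
  using assms
proof (cases rule: surface_point_cases)
  case (face d)
  then obtain z where "z \<in> ball 0 1" "x = chart d z" using chart(3) by blast
  then show ?thesis using that[of d z] face(1) by auto
next
  case (arc d t)
  then obtain z where "norm z = 1" "x = chart d z" using curve_chart[of d t] by auto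
  then show ?thesis using that[of d z] arc(1) by auto
next
  case node
  then obtain d where "d \<in> E" "x = \<gamma> d 0" using node_has_edge by metis
  moreover then obtain z where "norm z = 1" "x = chart d z" using curve_chart[of d 0] by auto
  ultimately show ?thesis using that[of d z] by auto
qed

lemma compact_chart: "d \<in> E \<Longrightarrow> compact (chart d ` X)" if "compact X" "X \<subseteq> cball 0 1" for X
  using chart(1) that by (meson compact_continuous_image continuous_on_subset)

lemma compact_S: "compact S"
proof -
  have "S = (\<Union>d\<in>E. chart d ` cball 0 1)"
  proof
    show "S \<subseteq> (\<Union>d\<in>E. chart d ` cball 0 1)"
    proof
      fix x assume "x \<in> S"
      then obtain d z where "d \<in> E" "z \<in> cball 0 1" "x = chart d z" by (rule charts_cover)
      then show "x \<in> (\<Union>d\<in>E. chart d ` cball 0 1)" by (intro UN_I image_eqI)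
    qed
    show "(\<Union>d\<in>E. chart d ` cball 0 1) \<subseteq> S" by (intro UN_least image_subsetI chart_in_S)
  qed
  moreover have "compact (\<Union>d\<in>E. chart d ` cball 0 1)"
    using fin by (intro compact_UN) (auto intro: compact_chart)
  ultimately show ?thesis by simp
qed

lemma faces_dense: "S \<subseteq> closure (\<Union>d\<in>E. L d)"
proof
  fix x assume "x \<in> S"
  then obtain d z where d: "d \<in> E" "z \<in> cball 0 1" "x = chart d z" by (rule charts_cover)
  have "chart d ` closure (ball 0 1) \<subseteq> closure (chart d ` ball 0 1)"
    using chart(1)[OF d(1)] by (intro image_closure_subset) (auto simp: closure_subset)
  then have "x \<in> closure (L d)" using d chart(3)[OF d(1)] by auto
  then show "x \<in> closure (\<Union>d\<in>E. L d)" using d(1) closure_mono[of "L d" "\<Union>d\<in>E. L d"] by blast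
qed

lemma arc_in_closure_face:
  assumes d: "d \<in> E" and t: "t \<in> {0..1}" shows "\<gamma> d t \<in> closure (L d)"
proof -
  obtain z where "norm z = 1" "\<gamma> d t = chart d z" using curve_chart[OF assms] by blast
  moreover have "chart d ` closure (ball 0 1) \<subseteq> closure (chart d ` ball 0 1)"
    using chart(1)[OF d] by (intro image_closure_subset) (auto simp: closure_subset)
  ultimately show ?thesis using chart(3)[OF d] by (auto simp: image_subset_iff)
qed

definition star :: "'e \<times> bool \<Rightarrow> 'a set" where
  "star d = L d \<union> L (flip d) \<union> arc_of d"

lemma star_flip: "star (flip d) = star d" by (auto simp: star_def arc_of_flip)

lemma star_mem: "d \<in> E \<Longrightarrow> x \<in> star d \<longleftrightarrow> x \<in> L d \<or> x \<in> L (flip d) \<or> (\<exists>t\<in>{0<..<1}. x = \<gamma> d t)"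
  by (auto simp: star_def arc_of_def)

lemma star_connected: assumes d: "d \<in> E" shows "connected (star d)"
proof -
  have c: "connected (L c \<union> arc_of c)" if c: "c \<in> E" for c
  proof (rule connected_intermediate_closure[OF face_connected[OF c]])
    have "\<gamma> c t \<in> closure (L c)" if "t \<in> {0<..<1}" for t using arc_in_closure_face[OF c, of t] that by simp
    then show "L c \<union> arc_of c \<subseteq> closure (L c)" using closure_subset by (auto simp: arc_of_def)
  qed simp
  have "\<gamma> d (1 / 2) \<in> arc_of d" by (auto simp: arc_of_def)
  then have "connected ((L d \<union> arc_of d) \<union> (L (flip d) \<union> arc_of (flip d)))"
    using arc_of_flip[of d] by (intro connected_Un[OF c[OF d] c[OF flip_mem[OF d]]]) auto
  then show ?thesis by (simp add: star_def arc_of_flip Un_ac)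
qed

lemma curve_notin_face:
  assumes "d \<in> E" "c \<in> E" "t \<in> {0..1}" shows "\<gamma> c t \<notin> L d"
  using curve_in_skeleton[OF assms(2,3)] face_subset[OF assms(1)] by auto

lemma node_notin_face: assumes "d \<in> E" "v \<in> nodes M" shows "v \<notin> L d"
  using face_subset[OF assms(1)] assms(2) by (auto simp: skeleton_eq)

lemma chart_notin_face:
  assumes d: "d \<in> E" "c \<in> E" and ne: "L c \<noteq> L d" and z: "z \<in> cball 0 1"
  shows "chart c z \<notin> L d"
proof
  assume x: "chart c z \<in> L d"
  then have "norm z \<noteq> 1" using chart_boundary_skeleton[OF d(2)] face_subset[OF d(1)] by auto
  then have "chart c z \<in> L c" using cball_cases[OF z] chart_interior[OF d(2)] by auto
  then show False using face_disjoint[OF d] x ne by auto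
qed

lemma chart_notin_arc:
  assumes d: "d \<in> E" "c \<in> E" and ne: "L c \<noteq> L d" "L c \<noteq> L (flip d)" and z: "z \<in> cball 0 1"
    and t: "t \<in> {0<..<1}"
  shows "chart c z \<noteq> \<gamma> d t"
proof
  assume x: "chart c z = \<gamma> d t"
  then have "chart c z \<notin> L c" using curve_notin_face[OF d(2,1), of t] t by simp
  then have "norm z = 1" using cball_cases[OF z] chart_interior[OF d(2)] by auto
  then obtain i s where s: "0 \<le> s" "s < 1" "chart c z = \<gamma> ((W ^^ i) c) s" using boundary_point[OF d(2)] by metis
  then have "(W ^^ i) c = d \<or> (W ^^ i) c = flip d"
    using curve_eq[OF d(1) W_pow_mem[OF d(2)] t, of s i] x by auto
  then show False using face_W_pow[OF d(2), of i] ne by metis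
qed

text \<open>
  The complement of a suitable union of open edges and open faces consists of the nodes, the other
  edges with their end points and the other faces with their boundaries, hence it is compact.
\<close>

lemma open_complement_of_cells:
  assumes A: "A \<subseteq> E" and B: "B \<subseteq> E" and U: "U \<subseteq> S" "U \<inter> nodes M = {}"
    and disj: "\<And>c t. c \<in> A \<Longrightarrow> t \<in> {0..1} \<Longrightarrow> \<gamma> c t \<notin> U"
      "\<And>c z. c \<in> B \<Longrightarrow> z \<in> cball 0 1 \<Longrightarrow> chart c z \<notin> U"
    and rest: "\<And>c t. c \<in> E - A \<Longrightarrow> t \<in> {0<..<1} \<Longrightarrow> \<gamma> c t \<in> U"
      "\<And>c. c \<in> E - B \<Longrightarrow> L c \<subseteq> U"
  shows "openin (top_of_set S) U"
proof -
  let ?K = "nodes M \<union> (\<Union>c\<in>A. \<gamma> c ` {0..1}) \<union> (\<Union>c\<in>B. chart c ` cball 0 1)"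
  have "compact (\<Union>c\<in>A. \<gamma> c ` {0..1})"
    using finite_subset[OF A fin] continuous_curve A by (intro compact_UN compact_continuous_image) auto
  moreover have "compact (\<Union>c\<in>B. chart c ` cball 0 1)"
    using finite_subset[OF B fin] compact_chart B by (intro compact_UN) auto
  ultimately have "compact ?K" using fin_nodes by (intro compact_Un) (simp_all add: finite_imp_compact)
  moreover have "S - ?K = U"
  proof
    show "S - ?K \<subseteq> U"
    proof
      fix x assume x: "x \<in> S - ?K"
      then have "x \<in> S" by (rule DiffD1)
      then show "x \<in> U"
      proof (cases rule: surface_point_cases)
        case (face c)
        have "c \<notin> B"
        proof
          assume "c \<in> B"
          obtain z where "z \<in> ball 0 1" "x = chart c z" using chart(3)[OF face(1)] face(2) by blast
          then have "x \<in> chart c ` cball 0 1" by auto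
          then show False using x \<open>c \<in> B\<close> by auto
        qed
        then show ?thesis using rest(2)[of c] face by auto
      next
        case (arc c t)
        have "c \<notin> A"
        proof
          assume "c \<in> A"
          have "x \<in> \<gamma> c ` {0..1}" using arc by auto
          then show False using x \<open>c \<in> A\<close> by auto
        qed
        then show ?thesis using rest(1)[of c t] arc by auto
      qed (use x in auto)
    qed
    have "x \<notin> ?K" if "x \<in> U" for x using that U(2) disj by blast
    then show "U \<subseteq> S - ?K" using U(1) by blast
  qed
  ultimately show ?thesis using openin_minus_compact by metis
qed

lemma face_open: assumes d: "d \<in> E" shows "openin (top_of_set S) (L d)"
proof (rule open_complement_of_cells[where A = E and B = "{c \<in> E. L c \<noteq> L d}"])
  show "L d \<subseteq> S" using face_subset[OF d] by blast
  show "L d \<inter> nodes M = {}" using node_notin_face[OF d] by blast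
qed (use d curve_notin_face chart_notin_face in auto)

lemma star_open: assumes d: "d \<in> E" shows "openin (top_of_set S) (star d)"
proof (rule open_complement_of_cells[where A = "E - {d, flip d}" and B = "{c \<in> E. L c \<noteq> L d \<and> L c \<noteq> L (flip d)}"])
  note fd = flip_mem[OF d]
  show "star d \<subseteq> S" using face_subset[OF d] face_subset[OF fd] arc_of_subset[OF d] by (auto simp: star_def)
  show "star d \<inter> nodes M = {}"
    using node_notin_face[OF d] node_notin_face[OF fd] arc_of_nodes[OF d] by (auto simp: star_def)
  show "\<gamma> c t \<notin> star d" if c: "c \<in> E - {d, flip d}" and t: "t \<in> {0..1}" for c t
  proof -
    have "\<gamma> c t \<notin> L d" "\<gamma> c t \<notin> L (flip d)" using curve_notin_face d fd c t by auto
    moreover have "\<gamma> c t \<noteq> \<gamma> d s" if "s \<in> {0<..<1}" for s using curve_eq[OF d, of c s t] that t c by auto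
    ultimately show ?thesis using star_mem[OF d] by auto
  qed
  show "chart c z \<notin> star d" if c: "c \<in> {c \<in> E. L c \<noteq> L d \<and> L c \<noteq> L (flip d)}" and z: "z \<in> cball 0 1" for c z
  proof -
    have "chart c z \<notin> L d" "chart c z \<notin> L (flip d)" using chart_notin_face[OF d] chart_notin_face[OF fd] c z by auto
    moreover have "chart c z \<noteq> \<gamma> d s" if "s \<in> {0<..<1}" for s using chart_notin_arc[OF d _ _ _ z that] c by auto
    ultimately show ?thesis using star_mem[OF d] by auto
  qed
  show "\<gamma> c t \<in> star d" if "c \<in> E - (E - {d, flip d})" "t \<in> {0<..<1}" for c t
  proof -
    have "\<gamma> c t \<in> arc_of c" using that(2) by (auto simp: arc_of_def)
    moreover have "arc_of c = arc_of d" using that(1) arc_of_flip[of d] by auto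
    ultimately show ?thesis by (simp add: star_def)
  qed
  show "L c \<subseteq> star d" if "c \<in> E - {c \<in> E. L c \<noteq> L d \<and> L c \<noteq> L (flip d)}" for c
    using that by (auto simp: star_def)
qed auto

end

section \<open>The rotation about a node\<close>

text \<open>Used with angles measured in full turns, where multiples of \<open>2 * pi\<close> become integers.\<close>

lemma cos_ge_near_integer:
  fixes x :: real
  assumes "0 \<le> y" "cos (2 * pi * y) \<le> cos (2 * pi * x)" "y \<le> 1 / 2"
  shows "\<exists>k::int. \<bar>x - of_int k\<bar> \<le> y"
proof -
  define k where "k = round x"
  have half: "\<bar>x - k\<bar> \<le> 1 / 2" using of_int_round_abs_le[of x] by (simp add: k_def abs_minus_commute)
  have "cos (2 * pi * x) = cos (2 * pi * (x - k) + 2 * pi * k)" by (simp add: algebra_simps)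
  also have "\<dots> = cos (2 * pi * (x - k))" unfolding cos_add cos_int_2pin sin_int_2pin by simp
  also have "\<dots> = cos (2 * pi * \<bar>x - k\<bar>)" using cos_abs_real[of "2 * pi * (x - of_int k)"] by (simp add: abs_mult)
  finally have c: "cos (2 * pi * y) \<le> cos (2 * pi * \<bar>x - k\<bar>)" using assms(2) by simp
  have "\<bar>x - k\<bar> \<le> y"
  proof (rule ccontr)
    assume "\<not> \<bar>x - k\<bar> \<le> y"
    then have "cos (2 * pi * \<bar>x - k\<bar>) < cos (2 * pi * y)"
      using assms(1) half by (intro cos_monotone_0_pi) auto
    then show False using c by simp
  qed
  then show ?thesis ..
qed

locale sphere_map = map_with_charts two_sphere M for M :: "(real ^ 3, 'e) surface_map"
begin

abbreviation turn :: "'e \<times> bool \<Rightarrow> 'e \<times> bool" where "turn d \<equiv> W (flip d)"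

lemma turn_mem: "d \<in> E \<Longrightarrow> turn d \<in> E" by (simp add: W_mem flip_mem)

lemma turn_start: "d \<in> E \<Longrightarrow> \<gamma> (turn d) 0 = \<gamma> d 0"
  using curve_continues[OF flip_mem] by (simp add: curve_flip)

lemma bij_turn: "bij_betw turn E E"
proof -
  have "inj_on turn E"
  proof (rule inj_onI)
    fix c d assume "c \<in> E" "d \<in> E" "turn c = turn d"
    then have "flip c = flip d"
      using inj_onD[OF bij_betw_imp_inj_on[OF bij] _ flip_mem flip_mem] by blast
    then show "c = d" by (metis flip_flip)
  qed
  moreover have "turn ` E \<subseteq> E" using turn_mem by (rule image_subsetI)
  ultimately show ?thesis using endo_inj_surj[OF fin, of turn] by (simp add: bij_betw_def)
qed

text \<open>
  The part of a polygon near its corner at \<open>1\<close> which is cut off by the chord between the points at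
  one third of the two adjacent sides.
\<close>

definition cap :: "nat \<Rightarrow> complex set" where
  "cap k = {z \<in> cball 0 1. cos (2 * pi * (1 / (3 * real k))) \<le> Re z}"

definition sector :: "'e \<times> bool \<Rightarrow> (real ^ 3) set" where
  "sector d = chart d ` cap (n d)"

lemma compact_cap: "compact (cap k)"
proof -
  have "cap k = cball 0 1 \<inter> {z. cos (2 * pi * (1 / (3 * real k))) \<le> Re z}" by (auto simp: cap_def)
  then show ?thesis by (simp add: compact_Int_closed closed_halfspace_Re_ge)
qed

lemma cap_angle:
  fixes x :: real
  assumes z: "z \<in> cap k" "z = of_real r * cis (2 * pi * x)" "0 \<le> r" and k: "2 \<le> k"
  shows "\<exists>j::int. \<bar>x - of_int j\<bar> \<le> 1 / (3 * real k)"
proof (rule cos_ge_near_integer)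
  have "1 / (3 * real k) \<le> 1 / 6" using k by (simp add: field_simps)
  then show "1 / (3 * real k) \<le> 1 / 2" by simp
  have "0 < cos (2 * pi * (1 / (3 * real k)))"
  proof (rule cos_gt_zero_pi)
    have "2 * pi * (1 / (3 * real k)) \<le> 2 * pi * (1 / 6)"
      using \<open>1 / (3 * real k) \<le> 1 / 6\<close> by (intro mult_left_mono) auto
    then show "2 * pi * (1 / (3 * real k)) < pi / 2" using pi_gt_zero by linarith
    have "0 \<le> 2 * pi * (1 / (3 * real k))" by simp
    then show "- (pi / 2) < 2 * pi * (1 / (3 * real k))" using pi_gt_zero by linarith
  qed
  moreover have "r \<le> 1" using z by (simp add: cap_def norm_mult)
  moreover have "cos (2 * pi * (1 / (3 * real k))) \<le> r * cos (2 * pi * x)"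
    using z(1) by (simp add: cap_def z(2))
  ultimately have *: "0 < r * cos (2 * pi * x)" "r \<le> 1"
    "cos (2 * pi * (1 / (3 * real k))) \<le> r * cos (2 * pi * x)" by linarith+
  then have "0 \<le> cos (2 * pi * x)" using z(3) by (simp add: zero_less_mult_iff)
  then have "r * cos (2 * pi * x) \<le> cos (2 * pi * x)" using *(2) by (simp add: mult_left_le_one_le z(3))
  then show "cos (2 * pi * (1 / (3 * real k))) \<le> cos (2 * pi * x)" using *(3) by linarith
qed simp

text \<open>
  The caps at different corners lie over disjoint arcs of the circle, each taking up a third of the
  two adjacent sides.
\<close>

lemma caps_disjoint:
  fixes i k :: nat
  assumes "w \<in> cap k" "w * cis (2 * pi * i / k) \<in> cap k" "i < k"
  shows "i = 0"
proof (cases "2 \<le> k")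
  case True
  obtain r a where w: "w = of_real r * cis a" "0 \<le> r" by (metis rcis_cmod_Arg rcis_def norm_ge_zero)
  define x where "x = a / (2 * pi)"
  have w1: "w = of_real r * cis (2 * pi * x)" using w(1) by (simp add: x_def)
  have w2: "w * cis (2 * pi * i / k) = of_real r * cis (2 * pi * (x + i / k))"
    by (simp add: w1 cis_mult algebra_simps)
  obtain j where j: "\<bar>x - of_int j\<bar> \<le> 1 / (3 * real k)" using cap_angle[OF assms(1) w1 w(2) True] by blast
  obtain l where l: "\<bar>x + i / k - of_int l\<bar> \<le> 1 / (3 * real k)" using cap_angle[OF assms(2) w2 w(2) True] by blast
  have "\<bar>real i / k - of_int (l - j)\<bar> \<le> 2 / (3 * real k)" using j l by simp
  then have "\<bar>real i / k - of_int (l - j)\<bar> * k \<le> 2 / 3" using True by (simp add: field_simps)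
  then have "\<bar>real i - of_int (l - j) * k\<bar> \<le> 2 / 3"
    using True by (simp add: abs_mult_pos' left_diff_distrib abs_mult_pos)
  then have "\<bar>of_int (int i - (l - j) * int k) :: real\<bar> \<le> 2 / 3" by simp
  then have "int i - (l - j) * int k = 0" by linarith
  then have "int k dvd int i" by (metis dvd_triv_right eq_iff_diff_eq_0)
  then show ?thesis using assms(3) by (metis dvd_imp_le int_dvd_int_iff leD neq0_conv)
qed (use assms(3) in auto)

lemma cap_boundary:
  assumes "z \<in> cap k" "norm z = 1" "2 \<le> k"
  obtains s where "\<bar>s\<bar> \<le> 1 / 3" "z = cis (2 * pi * s / k)"
proof -
  obtain a where a: "z = cis a" using assms(2) by (metis complex_norm_eq_1_exp_eq cis_conv_exp)
  define x where "x = a / (2 * pi)"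
  have z: "z = of_real 1 * cis (2 * pi * x)" using a by (simp add: x_def)
  obtain j where j: "\<bar>x - of_int j\<bar> \<le> 1 / (3 * real k)" using cap_angle[OF assms(1) z _ assms(3)] by auto
  define s where "s = (x - of_int j) * k"
  have "\<bar>s\<bar> = \<bar>x - of_int j\<bar> * k" by (simp add: s_def abs_mult)
  also have "\<dots> \<le> 1 / (3 * real k) * k" using j by (intro mult_right_mono) auto
  finally have "\<bar>s\<bar> \<le> 1 / 3" using assms(3) by simp
  moreover have "z = cis (2 * pi * s / k)"
  proof -
    have "2 * pi * x = 2 * pi * s / k + 2 * pi * of_int j"
      using assms(3) by (simp add: s_def field_simps)
    then have "z = cis (2 * pi * s / k) * cis (2 * pi * of_int j)" using z by (simp only: cis_mult) simp
    also have "cis (2 * pi * of_int j) = 1" by (rule cis_multiple_2pi) simp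
    finally show ?thesis by simp
  qed
  ultimately show ?thesis using that by blast
qed

text \<open>
  A sector is bounded by the edge \<open>a\<close> and by the previous edge of the same face. The latter, reversed,
  precedes \<open>a\<close> in the rotation about the node.
\<close>

lemma sector_boundary:
  assumes a: "a \<in> E" and k: "2 \<le> n a" and z: "z \<in> cap (n a)" "norm z = 1"
  obtains d s where "d \<in> E" "d = a \<or> turn d = a" "0 \<le> s" "s \<le> 1 / 3" "chart a z = \<gamma> d s"
proof -
  obtain s where s: "\<bar>s\<bar> \<le> 1 / 3" "z = cis (2 * pi * s / n a)" using cap_boundary[OF z k] .
  show ?thesis
  proof (cases "0 \<le> s")
    case True
    then show ?thesis using that[of a s] a s chart(4)[OF a, of s] by simp
  next
    case False
    obtain p where p: "p \<in> E" "W p = a" using bij a by (metis bij_betw_def imageE)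
    have np: "n p = n a" using sides_W[OF p(1)] p(2) by simp
    have "chart a z = chart p (z * corner_turn p)" using chart(5)[OF p(1), of z] p(2) by simp
    also have "z * corner_turn p = cis (2 * pi * (1 + s) / n p)"
      by (simp add: s(2) np corner_turn_def cis_mult add_divide_distrib ring_distribs add_ac)
    also have "chart p \<dots> = \<gamma> p (1 + s)" using chart(4)[OF p(1), of "1 + s"] s False by simp
    also have "\<dots> = \<gamma> (flip p) (- s)" by (simp add: curve_flip)
    finally show ?thesis using that[of "flip p" "- s"] flip_mem[OF p(1)] p(2) s False by simp
  qed
qed

lemma sectors_adjacent:
  assumes a: "a \<in> E" "2 \<le> n a" and b: "b \<in> E" "2 \<le> n b"
    and x: "x \<in> sector a" "x \<in> sector b" "x \<notin> nodes M"
  shows "\<exists>d\<in>E. (d = a \<or> turn d = a) \<and> (d = b \<or> turn d = b)"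
proof -
  obtain z where z: "z \<in> cap (n a)" "x = chart a z" using x(1) by (auto simp: sector_def)
  obtain w where w: "w \<in> cap (n b)" "x = chart b w" using x(2) by (auto simp: sector_def)
  have zw: "z \<in> cball 0 1" "w \<in> cball 0 1" using z w by (auto simp: cap_def)
  show ?thesis
  proof (cases "z \<in> ball 0 1")
    case True
    have "chart a z = chart b w" using z w by simp
    from chart_eq_interior[OF a(1) b(1) True zw(2) this]
    obtain i where i: "i < n a" "b = (W ^^ i) a" "z = w * corner_turn a ^ i" by blast
    have "n b = n a" using i(2) sides_W_pow[OF a(1)] by simp
    then have "i = 0" using caps_disjoint[of w "n a" i] z(1) w(1) i(1,3) by (simp add: corner_turn_pow)
    then show ?thesis using a(1) i(2) by auto
  next
    case False
    then have z1: "norm z = 1" using cball_cases[OF zw(1)] by simp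
    have "w \<notin> ball 0 1"
      using chart_interior[OF b(1), of w] face_subset[OF b(1)] chart_boundary_skeleton[OF a(1) z1] z w by auto
    then have w1: "norm w = 1" using cball_cases[OF zw(2)] by simp
    obtain c s where c: "c \<in> E" "c = a \<or> turn c = a" "0 \<le> s" "s \<le> 1 / 3" "chart a z = \<gamma> c s"
      using sector_boundary[OF a z(1) z1] .
    obtain d t where d: "d \<in> E" "d = b \<or> turn d = b" "0 \<le> t" "t \<le> 1 / 3" "chart b w = \<gamma> d t"
      using sector_boundary[OF b w(1) w1] .
    have "s \<noteq> 0" using c curve_start[OF c(1)] x(3) z(2) by auto
    then have "d = c \<and> t = s \<or> d = flip c \<and> t = 1 - s"
      using curve_eq[OF c(1) d(1), of s t] c d z(2) w(2) by auto
    then have "d = c" using c(4) d(4) by auto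
    then show ?thesis using c d by auto
  qed
qed

lemma start_in_sector:
  assumes d: "d \<in> E" and t: "0 \<le> t" "t \<le> 1 / 3"
  shows "\<gamma> d t \<in> sector d"
proof -
  have "0 < n d" using sides_pos[OF d] .
  have "cos (2 * pi * (1 / (3 * real (n d)))) \<le> cos (2 * pi * t / n d)"
    using t \<open>0 < n d\<close> by (intro cos_monotone_0_pi_le) (auto simp: field_simps)
  then have "cis (2 * pi * t / n d) \<in> cap (n d)" by (simp add: cap_def)
  then show ?thesis using chart(4)[OF d, of t] t unfolding sector_def by (auto intro!: image_eqI)
qed

lemma node_neighbourhood:
  assumes v: "v \<in> nodes M"
  obtains N where "openin (top_of_set two_sphere) N" "v \<in> N"
    "N \<subseteq> (\<Union>d\<in>{d\<in>E. \<gamma> d 0 = v}. sector d)"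
proof -
  let ?A = "{d\<in>E. \<gamma> d 0 = v}"
  \<comment> \<open>The part of each polygon outside the caps at those corners which lie at \<open>v\<close>.\<close>
  define bad where "bad d = cball 0 1 \<inter> (\<Inter>i\<in>{i. i < n d \<and> (W ^^ i) d \<in> ?A}.
    {z. Re (z * cnj (corner_turn d ^ i)) \<le> cos (2 * pi * (1 / (3 * real (n d))))})" for d
  let ?N = "two_sphere - (\<Union>d\<in>E. chart d ` bad d)"
  have "compact (bad d)" for d
    unfolding bad_def
    by (intro compact_Int_closed compact_cball closed_INT ballI closed_Collect_le continuous_intros)
  then have "compact (\<Union>d\<in>E. chart d ` bad d)"
    using fin by (intro compact_UN compact_chart) (auto simp: bad_def)
  then have "openin (top_of_set two_sphere) ?N" by (rule openin_minus_compact)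
  moreover have "v \<in> ?N"
  proof -
    have "v \<in> two_sphere" using v skeleton_subset by (auto simp: skeleton_eq)
    moreover have "v \<noteq> chart d z" if d: "d \<in> E" and z: "z \<in> bad d" for d z
    proof
      assume vz: "v = chart d z"
      have "z \<in> cball 0 1" using z by (simp add: bad_def)
      moreover have "z \<notin> ball 0 1" using chart_interior[OF d, of z] node_notin_face[OF d v] vz by auto
      ultimately have "norm z = 1" by auto
      then obtain i t where it: "i < n d" "0 \<le> t" "t < 1" "z = cis (2 * pi * (real i + t) / n d)"
        "chart d z = \<gamma> ((W ^^ i) d) t" using boundary_point[OF d] by blast
      have "t = 0" using curve_notin_nodes[OF W_pow_mem[OF d], of t i] it vz v by force
      then have "(W ^^ i) d \<in> ?A" "z = corner_turn d ^ i"
        using it vz W_pow_mem[OF d] by (auto simp: corner_turn_pow)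
      then have "Re (z * cnj z) \<le> cos (2 * pi * (1 / (3 * real (n d))))" using z it(1) by (auto simp: bad_def)
      moreover have "Re (z * cnj z) = 1" using \<open>norm z = 1\<close> by (simp flip: complex_norm_square)
      moreover have "cos (2 * pi * (1 / (3 * real (n d)))) < cos 0"
      proof (rule cos_monotone_0_pi)
        show "0 < 2 * pi * (1 / (3 * real (n d)))" using sides_pos[OF d] by simp
        have "1 \<le> real (n d)" using sides_pos[OF d] by simp
        then have "1 / (3 * real (n d)) \<le> 1 / 2" by (simp add: field_simps)
        then show "2 * pi * (1 / (3 * real (n d))) \<le> pi"
          using mult_left_mono[of "1 / (3 * real (n d))" "1 / 2" "2 * pi"] pi_gt_zero by linarith
      qed simp
      ultimately show False by simp
    qed
    ultimately show ?thesis by blast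
  qed
  moreover have "?N \<subseteq> (\<Union>d\<in>?A. sector d)"
  proof
    fix x assume x: "x \<in> ?N"
    then have "x \<in> two_sphere" by blast
    then obtain d z where d: "d \<in> E" "z \<in> cball 0 1" "x = chart d z" by (rule charts_cover)
    then have "z \<notin> bad d" using x by blast
    then obtain i where i: "i < n d" "(W ^^ i) d \<in> ?A"
      "cos (2 * pi * (1 / (3 * real (n d)))) < Re (z * cnj (corner_turn d ^ i))"
      using d(2) unfolding bad_def by (auto simp: not_le)
    define z' where "z' = z * cnj (corner_turn d ^ i)"
    have "z' \<in> cap (n ((W ^^ i) d))"
      using d(2) i(3) sides_W_pow[OF d(1), of i] by (simp add: cap_def z'_def norm_mult corner_turn_pow)
    moreover have "z' * corner_turn d ^ i = z"
    proof -
      have "norm (corner_turn d ^ i) = 1" by (simp add: corner_turn_pow)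
      then have "corner_turn d ^ i * cnj (corner_turn d ^ i) = 1" by (metis complex_norm_square of_real_1 one_power2)
      then show ?thesis by (simp add: z'_def mult_ac)
    qed
    then have "x = chart ((W ^^ i) d) z'" using chart_W_pow[OF d(1), of i z'] d(3) by simp
    ultimately have "x \<in> sector ((W ^^ i) d)" unfolding sector_def by blast
    then show "x \<in> (\<Union>d\<in>?A. sector d)" using i(2) by blast
  qed
  ultimately show ?thesis using that by blast
qed

text \<open>
  Small punctured neighbourhoods of a node are connected and covered by the sectors of the edges
  leaving it. Sectors of edges in different orbits of \<open>turn\<close> meet at most in the node, so there is
  only one orbit.
\<close>

lemma turn_transitive:
  assumes v: "v \<in> nodes M" and sides: "\<And>d. d \<in> E \<Longrightarrow> 2 \<le> n d"
    and X: "X \<subseteq> {d\<in>E. \<gamma> d 0 = v}" "X \<noteq> {}" and closed: "\<And>d. d \<in> X \<Longrightarrow> turn d \<in> X"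
  shows "X = {d\<in>E. \<gamma> d 0 = v}"
proof (rule ccontr)
  assume ne: "X \<noteq> {d\<in>E. \<gamma> d 0 = v}"
  let ?A = "{d\<in>E. \<gamma> d 0 = v}"
  obtain N where N: "openin (top_of_set two_sphere) N" "v \<in> N" "N \<subseteq> (\<Union>d\<in>?A. sector d)"
    using node_neighbourhood[OF v] .
  have "N - (nodes M - {v}) = N \<inter> (two_sphere - (nodes M - {v}))"
    using openin_imp_subset[OF N(1)] by blast
  moreover have "openin (top_of_set two_sphere) (two_sphere - (nodes M - {v}))"
    using fin_nodes by (intro openin_minus_compact finite_imp_compact) simp
  ultimately have "openin (top_of_set two_sphere) (N - (nodes M - {v}))" using N(1) openin_Int by metis
  then obtain D where D: "openin (top_of_set two_sphere) D" "v \<in> D" "D \<subseteq> N - (nodes M - {v})" "connected (D - {v})"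
    using punctured_neighbourhood_sphere[of "N - (nodes M - {v})" v] N(2) by auto
  have sub: "X \<subseteq> ?A" "?A - X \<subseteq> ?A" "X \<noteq> {}" "?A - X \<noteq> {}" using X ne by auto
  define P where "P Y = (D - {v}) \<inter> (\<Union>d\<in>Y. sector d)" for Y
  have "closedin (top_of_set (D - {v})) (P Y)" if "Y \<subseteq> ?A" for Y
  proof -
    have "compact (\<Union>d\<in>Y. sector d)"
      unfolding sector_def using that fin finite_subset[of Y E] compact_cap
      by (intro compact_UN compact_chart) (auto simp: cap_def)
    then show ?thesis unfolding P_def by (intro closedin_closed_Int compact_imp_closed)
  qed
  then have "closedin (top_of_set (D - {v})) (P X)" "closedin (top_of_set (D - {v})) (P (?A - X))"
    using sub by blast+
  moreover have "P Y \<noteq> {}" if Y: "Y \<subseteq> ?A" "Y \<noteq> {}" for Y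
  proof -
    obtain d where d: "d \<in> Y" "d \<in> E" "\<gamma> d 0 = v" using Y by blast
    obtain O' where O': "open O'" "D = two_sphere \<inter> O'" using D(1) by (auto simp: openin_open)
    have "(\<gamma> d \<longlongrightarrow> \<gamma> d 0) (at 0 within {0..1})"
      using continuous_curve[OF d(2)] by (simp add: continuous_on_def)
    then have "\<forall>\<^sub>F t in at 0 within {0..1}. \<gamma> d t \<in> O'"
      using O' D(2) d(3) topological_tendstoD by blast
    then obtain e where e: "0 < e" "\<And>t. t \<in> {0..1} \<Longrightarrow> t \<noteq> 0 \<Longrightarrow> dist t 0 < e \<Longrightarrow> \<gamma> d t \<in> O'"
      unfolding eventually_at by blast
    define t where "t = min (e / 2) (1 / 3)"
    have t: "0 < t" "t \<le> 1 / 3" "dist t 0 < e" using e(1) by (auto simp: t_def)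
    have "\<gamma> d t \<in> D" using e(2)[of t] t curve_in_S[OF d(2), of t] O'(2) by auto
    moreover have "\<gamma> d t \<noteq> v" using curve_notin_nodes[OF d(2), of t] t v by auto
    moreover have "\<gamma> d t \<in> sector d" using start_in_sector[OF d(2)] t by simp
    ultimately show ?thesis using d(1) unfolding P_def by blast
  qed
  then have "P X \<noteq> {}" "P (?A - X) \<noteq> {}" using sub by blast+
  moreover have "P X \<inter> P (?A - X) = {}"
  proof (rule ccontr)
    assume "P X \<inter> P (?A - X) \<noteq> {}"
    then obtain x a b where x: "x \<in> D" "x \<noteq> v" "a \<in> X" "x \<in> sector a" "b \<in> ?A - X" "x \<in> sector b"
      unfolding P_def by blast
    have "x \<notin> nodes M" using x(1,2) D(3) by blast
    then obtain d where d: "d \<in> E" "d = a \<or> turn d = a" "d = b \<or> turn d = b"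
      using sectors_adjacent[of a b x] x sides X(1) by blast
    have "d \<in> X" using d(2) invariant_inverse[OF fin bij_turn d(1) _ closed] x(3) by blast
    then have "b \<in> X" using d(3) closed by blast
    then show False using x(5) by blast
  qed
  moreover have "D - {v} \<subseteq> P X \<union> P (?A - X)"
  proof
    fix x assume x: "x \<in> D - {v}"
    then have "x \<in> N" using D(3) by blast
    then obtain d where "d \<in> ?A" "x \<in> sector d" using N(3) by blast
    then show "x \<in> P X \<union> P (?A - X)" using x by (cases "d \<in> X") (auto simp: P_def)
  qed
  ultimately show False using D(4) unfolding connected_closedin by blast
qed

end

context sphere_map
begin

section \<open>Connectedness of the dual graph\<close>

lemma E_nonempty: "E \<noteq> {}"
proof -
  have "axis 1 1 \<in> two_sphere" by simp
  then obtain d z where "d \<in> E" "z \<in> cball 0 1" "axis 1 1 = chart d z" by (rule charts_cover)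
  then show ?thesis by blast
qed

lemma face_nonempty: "d \<in> E \<Longrightarrow> L d \<noteq> {}"
  using chart_interior[of d 0] by auto

lemma invariant_face:
  assumes X: "X \<subseteq> E" and closed: "\<And>d. d \<in> X \<Longrightarrow> W d \<in> X" and c: "c \<in> X" "d \<in> E" "L d = L c"
  shows "d \<in> X"
proof -
  have "d \<in> orbit W c" using face_eq_iff[of c d] c X by auto
  then show ?thesis using c(1) by induction (auto intro: closed)
qed

text \<open>
  The sphere without the nodes is connected and covered by the open stars of the edges; stars of
  edges in different components of the dual graph are disjoint.
\<close>

theorem dual_connected:
  assumes X: "X \<subseteq> E" "X \<noteq> {}" and closed: "\<And>d. d \<in> X \<Longrightarrow> W d \<in> X" "\<And>d. d \<in> X \<Longrightarrow> flip d \<in> X"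
  shows "X = E"
proof (rule ccontr)
  assume ne: "X \<noteq> E"
  define Y where "Y = E - X"
  have Y: "Y \<subseteq> E" "Y \<noteq> {}" using X ne by (auto simp: Y_def)
  have Yflip: "flip d \<in> Y" if "d \<in> Y" for d
    using that closed(2)[of "flip d"] flip_mem[of d] by (auto simp: Y_def)
  let ?U = "\<Union>d\<in>X. star d" and ?V = "\<Union>d\<in>Y. star d" and ?S = "two_sphere - nodes M"
  have starS: "star d \<subseteq> ?S" if "d \<in> E" for d
    using star_open[OF that, THEN openin_imp_subset] arc_of_nodes[OF that]
      node_notin_face[OF that] node_notin_face[OF flip_mem[OF that]] unfolding star_def by blast
  have op: "openin (top_of_set ?S) (\<Union>d\<in>Z. star d)" if "Z \<subseteq> E" for Z
  proof (rule openin_Union, safe)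
    fix d assume "d \<in> Z"
    then have "d \<in> E" using that by blast
    then show "openin (top_of_set ?S) (star d)" by (intro openin_subset_trans[OF star_open starS Diff_subset])
  qed
  have disj: "star c \<inter> star d = {}" if c: "c \<in> X" and d: "d \<in> Y" for c d
  proof -
    have E: "c \<in> E" "d \<in> E" "flip c \<in> E" "flip d \<in> E" using c d X(1) Y(1) flip_mem by blast+
    have faces: "L a \<inter> L b = {}" if ab: "a \<in> X" "b \<in> Y" for a b
    proof (rule ccontr)
      assume "L a \<inter> L b \<noteq> {}"
      then have "L b = L a" using face_disjoint[of a b] ab X Y by auto
      then have "b \<in> X" using invariant_face[OF X(1) closed(1) ab(1)] ab(2) Y by blast
      then show False using ab(2) by (simp add: Y_def)
    qed
    have arcs: "arc_of c \<inter> arc_of d = {}"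
      using arc_of_disjoint[OF E(1,2)] c d closed(2)[OF c] by (auto simp: Y_def)
    have mixed: "arc_of a \<inter> L b = {}" if "a \<in> E" "b \<in> E" for a b
      using curve_notin_face[OF that(2,1)] by (auto simp: arc_of_def)
    show ?thesis
      using faces[OF c d] faces[OF closed(2)[OF c] d] faces[OF c Yflip[OF d]] faces[OF closed(2)[OF c] Yflip[OF d]]
        arcs mixed[OF E(1,2)] mixed[OF E(1,4)] mixed[OF E(2,1)] mixed[OF E(2,3)]
      unfolding star_def by blast
  qed
  have "?S \<subseteq> ?U \<union> ?V"
  proof
    fix x assume x: "x \<in> ?S"
    then have "x \<in> two_sphere" by blast
    then have "\<exists>d\<in>E. x \<in> star d"
    proof (cases rule: surface_point_cases)
      case (face d)
      then show ?thesis using star_mem[of d x] by blast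
    next
      case (arc d t)
      then show ?thesis using star_mem[of d x] by blast
    qed (use x in blast)
    then show "x \<in> ?U \<union> ?V" by (auto simp: Y_def)
  qed
  moreover have "?U \<inter> ?V = {}" using disj by blast
  moreover have "(\<Union>d\<in>Z. star d) \<noteq> {}" if Z: "Z \<subseteq> E" "Z \<noteq> {}" for Z
  proof -
    obtain d where d: "d \<in> Z" using Z(2) by blast
    then obtain y where "y \<in> star d" using face_nonempty[of d] Z(1) by (auto simp: star_def)
    then show ?thesis using d by blast
  qed
  note this[OF X] this[OF Y]
  moreover have "connected ?S" by (rule connected_sphere_minus_finite[OF fin_nodes])
  ultimately show False using op[OF X(1)] op[OF Y(1)] unfolding connected_openin by metis
qed

section \<open>Edges not separating the faces form a forest\<close>

lemma curve_eq_same: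
  assumes "d \<in> E" "s \<in> {0..1}" "t \<in> {0..1}" "s \<in> {0<..<1} \<or> t \<in> {0<..<1}" "\<gamma> d s = \<gamma> d t"
  shows "s = t"
proof -
  have "d \<noteq> flip d" using flip_ne[of d] by metis
  then show ?thesis
    using curve_eq[OF assms(1,1), of s t] curve_eq[OF assms(1,1), of t s] assms(2-5) by metis
qed

lemma arc_curve:
  assumes d: "d \<in> E" and ne: "\<gamma> d 0 \<noteq> \<gamma> d 1"
  shows "arc (\<gamma> d)"
proof -
  have "s = t" if st: "s \<in> {0..1}" "t \<in> {0..1}" "\<gamma> d s = \<gamma> d t" for s t
  proof (cases "s \<in> {0<..<1} \<or> t \<in> {0<..<1}")
    case True
    then show ?thesis using curve_eq_same[OF d st(1,2) _ st(3)] by blast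
  next
    case False
    then have "s \<in> {0, 1}" "t \<in> {0, 1}" using st by auto
    then show ?thesis using ne st(3) by auto
  qed
  then show ?thesis using continuous_curve[OF d] by (auto simp: arc_def path_def inj_on_def)
qed

lemma simple_path_loop:
  assumes d: "d \<in> E"
  shows "simple_path (\<gamma> d)"
proof -
  have "s = t \<or> s = 0 \<and> t = 1 \<or> s = 1 \<and> t = 0" if st: "s \<in> {0..1}" "t \<in> {0..1}" "\<gamma> d s = \<gamma> d t" for s t
  proof (cases "s \<in> {0<..<1} \<or> t \<in> {0<..<1}")
    case True
    then show ?thesis using curve_eq_same[OF d st(1,2) _ st(3)] by blast
  next
    case False
    then have "s \<in> {0, 1}" "t \<in> {0, 1}" using st by auto
    then show ?thesis by auto
  qed
  then show ?thesis using continuous_curve[OF d] by (auto simp: simple_path_def loop_free_def path_def)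
qed

lemma curves_meet_in_nodes:
  assumes c: "c \<in> E" and d: "d \<in> E" "d \<noteq> c" "d \<noteq> flip c" and x: "x \<in> \<gamma> c ` {0..1}" "x \<in> \<gamma> d ` {0..1}"
  shows "x \<in> {\<gamma> c 0, \<gamma> c 1} \<inter> {\<gamma> d 0, \<gamma> d 1}"
proof -
  have disj: "arc_of c \<inter> arc_of d = {}" using arc_of_disjoint[OF c d] .
  have ends: "{\<gamma> a 0, \<gamma> a 1} \<subseteq> nodes M" if "a \<in> E" for a using curve_start[OF that] curve_end[OF that] by simp
  show ?thesis
    using x disj ends[OF c] ends[OF d(1)] arc_of_nodes[OF c] arc_of_nodes[OF d(1)]
    unfolding curve_image[OF c] curve_image[OF d(1)] by blast
qed

text \<open>
  Joining edges of an embedded graph gives a simple path only if no edge is traversed twice. For a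
  walk through distinct nodes an edge can reappear only in the opposite direction and at once.
\<close>

lemma non_backtracking_cycle:
  assumes b: "\<And>i. b i \<in> E" "\<And>i. \<gamma> (b (Suc i)) 0 = \<gamma> (b i) 1" "\<And>i. b (Suc i) \<noteq> flip (b i)"
    and ij: "i < j" "\<gamma> (b i) 0 = \<gamma> (b j) 0" and inj: "inj_on (\<lambda>k. \<gamma> (b k) 0) {i..<j}"
  shows "\<exists>c. simple_path c \<and> pathfinish c = pathstart c \<and> path_image c \<subseteq> (\<Union>k. \<gamma> (b k) ` {0..1})"
proof -
  let ?x = "\<lambda>k. \<gamma> (b k) 0"
  have neq: "b l \<noteq> b k \<and> b l \<noteq> flip (b k)" if "i \<le> k" "k < l" "l < j" for k l
  proof
    show "b l \<noteq> b k" using inj_onD[OF inj, of l k] that by auto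
    show "b l \<noteq> flip (b k)"
    proof
      assume e: "b l = flip (b k)"
      then have "?x l = ?x (Suc k)" using b(2)[of k] by (simp add: curve_flip)
      then have "l = Suc k" using inj_onD[OF inj, of l "Suc k"] that by auto
      then show False using b(3)[of k] e by simp
    qed
  qed
  have ends: "\<gamma> (b k) 1 = ?x (Suc k)" for k using b(2) by simp
  \<comment> \<open>The edges before the last one form an arc.\<close>
  have chain: "\<exists>P. arc P \<and> pathstart P = ?x i \<and> pathfinish P = ?x (Suc k) \<and>
      path_image P = (\<Union>l\<in>{i..k}. \<gamma> (b l) ` {0..1})" if "i \<le> k" "Suc k < j" for k
    using that
  proof (induction k rule: dec_induct)
    case base
    have "?x i \<noteq> \<gamma> (b i) 1" using inj_onD[OF inj, of i "Suc i"] base ends[of i] by auto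
    then show ?case using arc_curve[OF b(1)] ends[of i]
      by (intro exI[of _ "\<gamma> (b i)"]) (auto simp: pathstart_def pathfinish_def path_image_def)
  next
    case (step k)
    then obtain P where P: "arc P" "pathstart P = ?x i" "pathfinish P = ?x (Suc k)"
      "path_image P = (\<Union>l\<in>{i..k}. \<gamma> (b l) ` {0..1})" by auto
    let ?d = "b (Suc k)"
    have dif: "?x (Suc k) \<noteq> ?x (Suc (Suc k))"
      using inj_onD[OF inj, of "Suc k" "Suc (Suc k)"] step by auto
    have arc: "arc (\<gamma> ?d)" using arc_curve[OF b(1)] dif ends by simp
    have "path_image P \<inter> path_image (\<gamma> ?d) \<subseteq> {pathstart (\<gamma> ?d)}"
    proof
      fix y assume y: "y \<in> path_image P \<inter> path_image (\<gamma> ?d)"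
      then obtain l where l: "i \<le> l" "l \<le> k" "y \<in> \<gamma> (b l) ` {0..1}" unfolding P(4) by auto
      have "y \<in> {?x l, ?x (Suc l)} \<inter> {?x (Suc k), ?x (Suc (Suc k))}"
        using curves_meet_in_nodes[OF b(1) b(1), of "Suc k" l y] neq[of l "Suc k"] l step y ends
        by (auto simp: path_image_def)
      moreover have "?x (Suc (Suc k)) \<noteq> ?x l" "?x (Suc (Suc k)) \<noteq> ?x (Suc l)"
        using inj_onD[OF inj, of "Suc (Suc k)" l] inj_onD[OF inj, of "Suc (Suc k)" "Suc l"] l step by auto
      ultimately show "y \<in> {pathstart (\<gamma> ?d)}" by (auto simp: pathstart_def)
    qed
    then have "arc (P +++ \<gamma> ?d)" using P(1,3) arc by (intro arc_join) (auto simp: pathstart_def)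
    moreover have "path_image (P +++ \<gamma> ?d) = (\<Union>l\<in>{i..Suc k}. \<gamma> (b l) ` {0..1})"
    proof -
      have "{i..Suc k} = insert (Suc k) {i..k}" using step by auto
      moreover have "path_image (P +++ \<gamma> ?d) = path_image P \<union> path_image (\<gamma> ?d)"
        using P(3) by (intro path_image_join) (simp add: pathstart_def)
      ultimately show ?thesis using P(4) by (auto simp: path_image_def)
    qed
    moreover have "pathfinish (P +++ \<gamma> ?d) = ?x (Suc (Suc k))" using ends by (simp add: pathfinish_def joinpaths_def)
    ultimately show ?case using P(2) by (intro exI[of _ "P +++ \<gamma> ?d"]) simp
  qed
  show ?thesis
  proof (cases "j = Suc i")
    case True
    then show ?thesis using simple_path_loop[OF b(1)] ij(2) ends[of i]
      by (intro exI[of _ "\<gamma> (b i)"]) (auto simp: pathstart_def pathfinish_def path_image_def)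
  next
    case False
    then obtain k where k: "j = Suc (Suc k)" "i \<le> k" using ij(1) by (metis Suc_lessE Suc_lessI le_simps(2) less_Suc_eq_le)
    obtain P where P: "arc P" "pathstart P = ?x i" "pathfinish P = ?x (Suc k)"
      "path_image P = (\<Union>l\<in>{i..k}. \<gamma> (b l) ` {0..1})" using chain[of k] k by auto
    let ?d = "b (Suc k)"
    have x_j: "\<gamma> ?d 1 = ?x i" using ends[of "Suc k"] ij(2) k by simp
    have "?x (Suc k) \<noteq> ?x i" using inj_onD[OF inj, of "Suc k" i] k by auto
    then have arc: "arc (\<gamma> ?d)" using arc_curve[OF b(1)] x_j by simp
    have "path_image P \<inter> path_image (\<gamma> ?d) \<subseteq> {pathstart P, pathstart (\<gamma> ?d)}"
    proof
      fix y assume y: "y \<in> path_image P \<inter> path_image (\<gamma> ?d)"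
      then obtain l where l: "i \<le> l" "l \<le> k" "y \<in> \<gamma> (b l) ` {0..1}" unfolding P(4) by auto
      have "y \<in> {\<gamma> ?d 0, \<gamma> ?d 1}"
        using curves_meet_in_nodes[OF b(1) b(1), of "Suc k" l y] neq[of l "Suc k"] l k y
        by (auto simp: path_image_def)
      then show "y \<in> {pathstart P, pathstart (\<gamma> ?d)}" using x_j P(2) by (auto simp: pathstart_def)
    qed
    then have "simple_path (P +++ \<gamma> ?d)"
      using P arc x_j by (intro simple_path_join_loop) (auto simp: pathstart_def pathfinish_def)
    moreover have "path_image (P +++ \<gamma> ?d) = path_image P \<union> path_image (\<gamma> ?d)"
      using P(3) by (intro path_image_join) (simp add: pathstart_def)
    then have "path_image (P +++ \<gamma> ?d) \<subseteq> (\<Union>k. \<gamma> (b k) ` {0..1})" unfolding P(4) by (auto simp: path_image_def)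
    moreover have "pathfinish (P +++ \<gamma> ?d) = pathstart (P +++ \<gamma> ?d)"
      using P(2) x_j by (simp add: pathfinish_def joinpaths_def pathstart_def)
    ultimately show ?thesis by blast
  qed
qed

text \<open>
  Without a leaf one can continue a walk forever without turning back; the first return to a node
  visited before closes a cycle.
\<close>

lemma cycle_exists:
  assumes B: "B \<subseteq> E" "B \<noteq> {}" and flipB: "\<And>d. d \<in> B \<Longrightarrow> flip d \<in> B"
    and no_leaf: "\<And>d. d \<in> B \<Longrightarrow> \<exists>k\<in>B. \<gamma> k 0 = \<gamma> d 0 \<and> k \<noteq> d"
  shows "\<exists>c. simple_path c \<and> pathfinish c = pathstart c \<and> path_image c \<subseteq> (\<Union>d\<in>B. \<gamma> d ` {0..1})"
proof -
  have "\<exists>k\<in>B. \<gamma> k 0 = \<gamma> d 1 \<and> k \<noteq> flip d" if "d \<in> B" for d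
    using no_leaf[OF flipB[OF that]] by (simp add: curve_flip)
  then obtain f where f: "\<And>d. d \<in> B \<Longrightarrow> f d \<in> B \<and> \<gamma> (f d) 0 = \<gamma> d 1 \<and> f d \<noteq> flip d" by metis
  obtain d0 where d0: "d0 \<in> B" using B(2) by blast
  define b where "b i = (f ^^ i) d0" for i
  have bB: "b i \<in> B" for i unfolding b_def using f d0 by (induction i) auto
  let ?x = "\<lambda>k. \<gamma> (b k) 0"
  have "\<exists>j. \<exists>i<j. ?x i = ?x j"
  proof -
    have "range ?x \<subseteq> (\<lambda>d. \<gamma> d 0) ` E" using bB B(1) by blast
    then have "finite (range ?x)" using fin finite_subset by blast
    then have "\<not> inj ?x" using finite_imageD by blast
    then show ?thesis by (metis (mono_tags, lifting) inj_def linorder_neqE_nat)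
  qed
  note ex = this
  define j where "j = (LEAST j. \<exists>i<j. ?x i = ?x j)"
  have "\<exists>i<j. ?x i = ?x j" unfolding j_def by (rule LeastI_ex[OF ex])
  then obtain i where i: "i < j" "?x i = ?x j" by (elim exE conjE)
  have min: "?x k \<noteq> ?x l" if "k < l" "l < j" for k l
    using not_less_Least[of l "\<lambda>j. \<exists>i<j. ?x i = ?x j"] that unfolding j_def by blast
  have "inj_on ?x {i..<j}"
  proof (rule linorder_inj_onI)
    fix k l assume "k < l" "k \<in> {i..<j}" "l \<in> {i..<j}"
    then show "?x k \<noteq> ?x l" using min[of k l] by simp
  qed auto
  moreover have "b k \<in> E" "\<gamma> (b (Suc k)) 0 = \<gamma> (b k) 1" "b (Suc k) \<noteq> flip (b k)" for k
    using bB[of k] B(1) f[OF bB[of k]] by (auto simp: b_def)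
  ultimately have "\<exists>c. simple_path c \<and> pathfinish c = pathstart c \<and> path_image c \<subseteq> (\<Union>k. \<gamma> (b k) ` {0..1})"
    by (intro non_backtracking_cycle[OF _ _ _ i])
  then obtain c where c: "simple_path c" "pathfinish c = pathstart c" "path_image c \<subseteq> (\<Union>k. \<gamma> (b k) ` {0..1})"
    by (elim exE conjE)
  have "(\<Union>k. \<gamma> (b k) ` {0..1}) \<subseteq> (\<Union>d\<in>B. \<gamma> d ` {0..1})" using bB by (intro UN_least UN_upper)
  then have "path_image c \<subseteq> (\<Union>d\<in>B. \<gamma> d ` {0..1})" by (rule order_trans[OF c(3)])
  then show ?thesis using c(1,2) by (intro exI[of _ c] conjI)
qed

text \<open>
  If the edges outside \<open>B\<close> connect all faces, then no closed curve in the edges of \<open>B\<close> separates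
  the sphere, so by the Jordan curve theorem \<open>B\<close> contains no cycle and has a leaf.
\<close>

theorem forest_has_leaf:
  assumes B: "B \<subseteq> E" "B \<noteq> {}" and flipB: "\<And>d. d \<in> B \<Longrightarrow> flip d \<in> B"
    and conn: "\<And>X. X \<subseteq> E \<Longrightarrow> X \<noteq> {} \<Longrightarrow> (\<And>d. d \<in> X \<Longrightarrow> W d \<in> X) \<Longrightarrow>
      (\<And>d. d \<in> X \<Longrightarrow> d \<notin> B \<Longrightarrow> flip d \<in> X) \<Longrightarrow> X = E"
  shows "\<exists>d\<in>B. \<forall>k\<in>B. \<gamma> k 0 = \<gamma> d 0 \<longrightarrow> k = d"
proof (rule ccontr)
  assume "\<not> ?thesis"
  then obtain c where c: "simple_path c" "pathfinish c = pathstart c" "path_image c \<subseteq> (\<Union>d\<in>B. \<gamma> d ` {0..1})"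
    using cycle_exists[OF B flipB] by metis
  define Q where "Q = (\<Union>d\<in>E. L d) \<union> (\<Union>d\<in>E - B. arc_of d)"
  have cS: "path_image c \<subseteq> two_sphere" using c(3) curve_in_S B(1) by blast
  have Lc: "L d \<inter> path_image c = {}" if "d \<in> E" for d
  proof -
    have "\<gamma> k t \<notin> L d" if "k \<in> B" "t \<in> {0..1}" for k t using curve_notin_face[OF \<open>d \<in> E\<close>] that B(1) by blast
    then show ?thesis using c(3) by blast
  qed
  have Ac: "arc_of d \<inter> path_image c = {}" if d: "d \<in> E - B" for d
  proof -
    have "arc_of d \<inter> \<gamma> k ` {0..1} = {}" if k: "k \<in> B" for k
    proof -
      have "k \<noteq> d" "k \<noteq> flip d" using d k flipB[OF k] flip_flip by (metis DiffD2)+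
      then have "arc_of d \<inter> arc_of k = {}" using arc_of_disjoint[of d k] d k B(1) by blast
      moreover have "{\<gamma> k 0, \<gamma> k 1} \<subseteq> nodes M" using k B(1) curve_start curve_end by blast
      moreover have "arc_of d \<inter> nodes M = {}" using arc_of_nodes d by blast
      moreover have "k \<in> E" using k B(1) by blast
      ultimately show ?thesis unfolding curve_image[OF \<open>k \<in> E\<close>] by blast
    qed
    then show ?thesis using c(3) by blast
  qed
  have "connected Q"
  proof -
    obtain d0 where d0: "d0 \<in> E" using E_nonempty by blast
    obtain x0 where x0: "x0 \<in> L d0" using face_nonempty[OF d0] by blast
    define C where "C = connected_component_set Q x0"
    have C_max: "T \<subseteq> C" if "connected T" "T \<subseteq> Q" "y \<in> T" "y \<in> C" for T y
      using that connected_component_maximal[of y T Q] connected_component_eq[of y Q x0] by (simp add: C_def)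
    have LQ: "L d \<subseteq> Q" if "d \<in> E" for d using that by (auto simp: Q_def)
    have x0C: "x0 \<in> C" using x0 LQ[OF d0] by (auto simp: C_def)
    define X where "X = {d\<in>E. L d \<subseteq> C}"
    have starC: "star d \<subseteq> C" if d: "d \<in> X" "d \<notin> B" for d
    proof -
      have dE: "d \<in> E" using d by (simp add: X_def)
      obtain y where y: "y \<in> L d" using face_nonempty[OF dE] by blast
      have "star d \<subseteq> Q" using dE flip_mem[OF dE] d(2) by (auto simp: star_def Q_def)
      moreover have "y \<in> star d" "y \<in> C" using y d(1) by (auto simp: star_def X_def)
      ultimately show ?thesis using C_max star_connected[OF dE] by blast
    qed
    have "X = E"
    proof (rule conn)
      have "d0 \<in> X" using C_max[OF face_connected[OF d0] LQ[OF d0] x0 x0C] d0 by (simp add: X_def)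
      then show "X \<noteq> {}" by blast
      show "W d \<in> X" if "d \<in> X" for d using that face_W[of d] W_mem[of d] by (auto simp: X_def)
      show "flip d \<in> X" if "d \<in> X" "d \<notin> B" for d
        using starC[OF that] that(1) flip_mem[of d] by (auto simp: X_def star_def)
    qed (auto simp: X_def)
    then have "Q \<subseteq> C" using starC unfolding Q_def star_def X_def by blast
    moreover have "C \<subseteq> Q" by (simp add: C_def connected_component_subset)
    ultimately have "Q = C" by blast
    then show ?thesis by (metis C_def connected_connected_component)
  qed
  moreover have "Q \<subseteq> two_sphere - path_image c"
    using Lc Ac face_subset arc_of_subset unfolding Q_def by blast
  moreover have "two_sphere - path_image c \<subseteq> closure Q"
  proof -
    have "closure (\<Union>d\<in>E. L d) \<subseteq> closure Q" by (rule closure_mono) (auto simp: Q_def)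
    then show ?thesis using faces_dense by blast
  qed
  ultimately have "connected (two_sphere - path_image c)" by (rule connected_intermediate_closure)
  moreover obtain p where "p \<in> two_sphere - path_image c"
    using E_nonempty face_nonempty \<open>Q \<subseteq> two_sphere - path_image c\<close> unfolding Q_def by blast
  ultimately show False using Jordan_sphere[OF c(1,2) cS] by blast
qed

end

section \<open>The branched cover defined by an equivariant map of oriented edges\<close>

text \<open>
  A continuous map of a compact space is closed, and disjoint open sheets are also closed in
  their union, so the map is closed on each sheet.
\<close>

lemma sheets_homeomorphic:
  fixes f :: "'a::t2_space \<Rightarrow> 'b::t2_space"
  assumes cont: "continuous_on S f" and S: "compact S"
    and V: "\<Union>\<V> = S \<inter> f -` U" "\<And>V. V \<in> \<V> \<Longrightarrow> openin (top_of_set S) V" "pairwise disjnt \<V>"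
    and bij: "\<And>V. V \<in> \<V> \<Longrightarrow> inj_on f V \<and> f ` V = U" and VV: "V \<in> \<V>"
  shows "\<exists>g. homeomorphism V U f g"
proof -
  have VS: "V \<subseteq> S" using V(1) VV by blast
  define O' where "O' = \<Union>(\<V> - {V})"
  have "openin (top_of_set S) O'" unfolding O'_def using V(2) by (intro openin_Union) auto
  then obtain A where A: "open A" "O' = S \<inter> A" by (auto simp: openin_open)
  have "V \<inter> O' = {}" using V(3) VV by (auto simp: O'_def pairwise_def disjnt_def)
  moreover have "S \<inter> f -` U = V \<union> O'" using VV V(1) by (auto simp: O'_def)
  ultimately have VA: "V = S \<inter> f -` U \<inter> - A" using A(2) VS by blast
  obtain g where "homeomorphism V U f g"
  proof (rule homeomorphism_injective_closed_map[of V f U])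
    show "continuous_on V f" using cont VS continuous_on_subset by blast
    show "f ` V = U" "inj_on f V" using bij VV by auto
    fix C assume "closedin (top_of_set V) C"
    then obtain K where K: "closed K" "C = V \<inter> K" by (auto simp: closedin_closed)
    have "f ` C = U \<inter> f ` (S \<inter> (K \<inter> - A))" unfolding K(2) VA by auto
    moreover have "compact (S \<inter> (K \<inter> - A))" using S K(1) A(1) by (intro compact_Int_closed closed_Int) auto
    then have "compact (f ` (S \<inter> (K \<inter> - A)))"
      using cont by (intro compact_continuous_image) (auto elim: continuous_on_subset)
    ultimately show "closedin (top_of_set U) (f ` C)" by (simp add: closedin_closed_Int compact_imp_closed)
  qed
  then show ?thesis by blast
qed

text \<open>
  An equivariant map of oriented edges between two maps. It has to be compatible with the nodes in
  \<open>q_start\<close>, which is not a formal consequence of equivariance: a node at which several orbits of the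
  rotation meet would be a pinch point of the surface.
\<close>

locale map_covering =
  source: map_with_charts S M + target: map_with_charts T N
  for S :: "'a::t2_space set" and M :: "('a, 'e) surface_map"
    and T :: "'b::t2_space set" and N :: "('b, 'k) surface_map" +
  fixes q :: "'e \<times> bool \<Rightarrow> 'k \<times> bool"
  assumes q_mem: "d \<in> oedges M \<Longrightarrow> q d \<in> oedges N"
    and q_walk: "d \<in> oedges M \<Longrightarrow> q (walk_next M d) = walk_next N (q d)"
    and q_flip: "d \<in> oedges M \<Longrightarrow> q (flip d) = flip (q d)"
    and q_sides: "d \<in> oedges M \<Longrightarrow> sides N (q d) = sides M d"
    and q_surj: "q ` oedges M = oedges N"
    and q_start: "c \<in> oedges M \<Longrightarrow> d \<in> oedges M \<Longrightarrow> ocurve M c 0 = ocurve M d 0 \<Longrightarrow>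
      ocurve N (q c) 0 = ocurve N (q d) 0"
    and distinct_faces: "k \<in> oedges N \<Longrightarrow> left_face N (flip k) \<noteq> left_face N k"
begin

abbreviation "E \<equiv> oedges M"
abbreviation "E' \<equiv> oedges N"
abbreviation "W \<equiv> walk_next M"
abbreviation "W' \<equiv> walk_next N"
abbreviation "L \<equiv> left_face M"
abbreviation "L' \<equiv> left_face N"
abbreviation "\<gamma> \<equiv> ocurve M"
abbreviation "\<gamma>' \<equiv> ocurve N"

lemma q_walk_pow: "d \<in> E \<Longrightarrow> q ((W ^^ i) d) = (W' ^^ i) (q d)"
  by (induction i) (simp_all add: q_walk source.W_pow_mem)

lemma q_turn: "d \<in> E \<Longrightarrow> target.corner_turn (q d) = source.corner_turn d"
  by (simp add: source.corner_turn_def target.corner_turn_def q_sides)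

lemma q_face: assumes "c \<in> E" "d \<in> E" "L c = L d" shows "L' (q c) = L' (q d)"
proof -
  obtain i where "d = (W ^^ i) c" using source.face_eq_iff source.orbit_W assms by metis
  then show ?thesis using q_walk_pow[OF assms(1)] target.face_W_pow[OF q_mem[OF assms(1)]] by simp
qed

lemma q_node_consistent:
  assumes c: "c \<in> E" and d: "d \<in> E" and t: "t \<in> {0, 1}" and s: "s \<in> {0, 1}" and eq: "\<gamma> c t = \<gamma> d s"
  shows "\<gamma>' (q c) t = \<gamma>' (q d) s"
proof -
  define c' where "c' = (if t = 0 then c else flip c)"
  define d' where "d' = (if s = 0 then d else flip d)"
  have E: "c' \<in> E" "d' \<in> E" using c d source.flip_mem by (auto simp: c'_def d'_def)
  have "\<gamma> c' 0 = \<gamma> c t" "\<gamma> d' 0 = \<gamma> d s" using t s by (auto simp: c'_def d'_def source.curve_flip)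
  moreover have "\<gamma>' (q c') 0 = \<gamma>' (q c) t" "\<gamma>' (q d') 0 = \<gamma>' (q d) s"
    using t s by (auto simp: c'_def d'_def q_flip c d target.curve_flip)
  ultimately show ?thesis using q_start[OF E] eq by simp
qed

lemma q_curve_consistent:
  assumes c: "c \<in> E" and d: "d \<in> E" and t: "t \<in> {0..1}" and s: "s \<in> {0..1}" and eq: "\<gamma> c t = \<gamma> d s"
  shows "\<gamma>' (q c) t = \<gamma>' (q d) s"
proof -
  have inner: "\<gamma>' (q a) u = \<gamma>' (q b) v"
    if "a \<in> E" "b \<in> E" "u \<in> {0<..<1}" "v \<in> {0..1}" "\<gamma> a u = \<gamma> b v" for a b u v
  proof -
    have "b = a \<and> v = u \<or> b = flip a \<and> v = 1 - u" using source.curve_eq that by blast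
    then show ?thesis
    proof
      assume "b = flip a \<and> v = 1 - u"
      then show ?thesis by (simp add: q_flip[OF that(1)] target.curve_flip)
    qed simp
  qed
  consider "t \<in> {0<..<1}" | "s \<in> {0<..<1}" | "t \<in> {0, 1}" "s \<in> {0, 1}" using t s by force
  then show ?thesis
  proof cases
    case 1 then show ?thesis using inner[OF c d _ s eq] by simp
  next
    case 2 then show ?thesis using inner[OF d c _ t eq[symmetric]] by simp
  next
    case 3 then show ?thesis using q_node_consistent[OF c d _ _ eq] by simp
  qed
qed

lemma q_chart_consistent:
  assumes c: "c \<in> E" and d: "d \<in> E" and z: "z \<in> cball 0 1" and w: "w \<in> cball 0 1"
    and eq: "source.chart c z = source.chart d w"
  shows "target.chart (q c) z = target.chart (q d) w"
proof -
  have inner: "target.chart (q a) u = target.chart (q b) v"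
    if ab: "a \<in> E" "b \<in> E" "u \<in> ball 0 1" "v \<in> cball 0 1" "source.chart a u = source.chart b v" for a b u v
  proof -
    obtain i where i: "b = (W ^^ i) a" "u = v * source.corner_turn a ^ i"
      using source.chart_eq_interior[OF ab] by blast
    then have "target.chart (q b) v = target.chart (q a) (v * target.corner_turn (q a) ^ i)"
      using target.chart_W_pow[OF q_mem[OF ab(1)]] q_walk_pow[OF ab(1)] by simp
    then show ?thesis using i(2) q_turn[OF ab(1)] by simp
  qed
  have boundary: "\<exists>b\<in>E. \<exists>t\<in>{0..1}. source.chart a u = \<gamma> b t \<and> target.chart (q a) u = \<gamma>' (q b) t"
    if a: "a \<in> E" and u: "norm u = 1" for a u
  proof -
    obtain i t where it: "0 \<le> t" "t < 1" "u = cis (2 * pi * (real i + t) / sides M a)"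
      "source.chart a u = \<gamma> ((W ^^ i) a) t" using source.boundary_point[OF a u] by blast
    have "target.chart (q a) u = \<gamma>' ((W' ^^ i) (q a)) t"
      using target.chart_boundary[OF q_mem[OF a], of t i] it q_sides[OF a] by simp
    then show ?thesis
      using it q_walk_pow[OF a] source.W_pow_mem[OF a]
      by (intro bexI[of _ "(W ^^ i) a"] bexI[of _ t]) auto
  qed
  consider "z \<in> ball 0 1" | "w \<in> ball 0 1" | "norm z = 1" "norm w = 1"
    using source.cball_cases[OF z] source.cball_cases[OF w] by blast
  then show ?thesis
  proof cases
    case 1 then show ?thesis using inner[OF c d _ w eq] by simp
  next
    case 2 then show ?thesis using inner[OF d c _ z eq[symmetric]] by simp
  next
    case 3
    obtain a t where a: "a \<in> E" "t \<in> {0..1}" "source.chart c z = \<gamma> a t" "target.chart (q c) z = \<gamma>' (q a) t"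
      using boundary[OF c 3(1)] by blast
    obtain b s where b: "b \<in> E" "s \<in> {0..1}" "source.chart d w = \<gamma> b s" "target.chart (q d) w = \<gamma>' (q b) s"
      using boundary[OF d 3(2)] by blast
    show ?thesis using q_curve_consistent[OF a(1) b(1) a(2) b(2)] a b eq by simp
  qed
qed

definition cover :: "'a \<Rightarrow> 'b" where
  "cover x = (SOME y. \<exists>d\<in>E. \<exists>z\<in>cball 0 1. x = source.chart d z \<and> y = target.chart (q d) z)"

lemma cover_chart:
  assumes d: "d \<in> E" and z: "z \<in> cball 0 1"
  shows "cover (source.chart d z) = target.chart (q d) z"
proof -
  have "\<exists>c\<in>E. \<exists>w\<in>cball 0 1. source.chart d z = source.chart c w \<and>
      cover (source.chart d z) = target.chart (q c) w"
    unfolding cover_def by (rule someI[of _ "target.chart (q d) z"]) (use d z in blast)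
  then obtain c w where "c \<in> E" "w \<in> cball 0 1" "source.chart d z = source.chart c w"
    "cover (source.chart d z) = target.chart (q c) w" by blast
  then show ?thesis using q_chart_consistent[OF d _ z] by metis
qed

lemma cover_curve:
  assumes d: "d \<in> E" and t: "t \<in> {0..1}"
  shows "cover (\<gamma> d t) = \<gamma>' (q d) t"
proof -
  let ?z = "cis (2 * pi * t / sides M d)"
  have "cover (source.chart d ?z) = target.chart (q d) ?z" by (rule cover_chart[OF d]) simp
  then show ?thesis
    using source.chart(4)[OF d t] target.chart(4)[OF q_mem[OF d] t] q_sides[OF d] by simp
qed

lemma cover_face: assumes d: "d \<in> E" shows "cover ` L d = L' (q d)"
proof -
  have "cover ` source.chart d ` ball 0 1 = target.chart (q d) ` ball 0 1"
    unfolding image_image using cover_chart[OF d] by (intro image_cong) auto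
  then show ?thesis using source.chart(3)[OF d] target.chart(3)[OF q_mem[OF d]] by simp
qed

lemma cover_inj_face: assumes d: "d \<in> E" shows "inj_on cover (L d)"
proof (rule inj_onI)
  fix x y assume "x \<in> L d" "y \<in> L d" and eq: "cover x = cover y"
  then obtain z w where zw: "z \<in> ball 0 1" "w \<in> ball 0 1" "x = source.chart d z" "y = source.chart d w"
    unfolding source.chart(3)[OF d, symmetric] by blast
  then have "target.chart (q d) z = target.chart (q d) w" using eq cover_chart[OF d] by simp
  then show "x = y" using inj_onD[OF target.chart(2)[OF q_mem[OF d]]] zw by metis
qed

lemma cover_arc: assumes d: "d \<in> E" shows "cover ` source.arc_of d = target.arc_of (q d)"
  unfolding source.arc_of_def target.arc_of_def image_image
  using cover_curve[OF d] by (intro image_cong) auto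

lemma cover_inj_arc: assumes d: "d \<in> E" shows "inj_on cover (source.arc_of d)"
proof (rule inj_onI)
  fix x y assume "x \<in> source.arc_of d" "y \<in> source.arc_of d" and eq: "cover x = cover y"
  then obtain s t where st: "s \<in> {0<..<1}" "t \<in> {0<..<1}" "x = \<gamma> d s" "y = \<gamma> d t"
    unfolding source.arc_of_def by blast
  then have "\<gamma>' (q d) s = \<gamma>' (q d) t" using eq cover_curve[OF d, of s] cover_curve[OF d, of t] by simp
  then show "x = y" using inj_onD[OF target.curve_inj[OF q_mem[OF d]]] st by metis
qed

lemma cover_node: assumes v: "v \<in> nodes M" shows "cover v \<in> nodes N"
proof -
  obtain d where d: "d \<in> E" "v = \<gamma> d 0" using source.node_has_edge[OF v] by metis
  then show ?thesis using cover_curve[OF d(1), of 0] target.curve_start[OF q_mem[OF d(1)]] by simp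
qed

lemma cover_continuous: "continuous_on S cover"
  unfolding continuous_on_closed_invariant
proof (intro allI impI)
  fix B :: "'b set" assume B: "closed B"
  define K where "K d = cball 0 1 \<inter> target.chart (q d) -` B" for d
  have "closed (K d)" if "d \<in> E" for d
    unfolding K_def Int_commute[of "cball 0 1"]
    using target.chart(1)[OF q_mem[OF that]] B by (simp add: continuous_on_closed_vimage)
  then have "compact (K d)" if "d \<in> E" for d
    using that by (metis K_def Int_lower1 bounded_cball bounded_subset compact_eq_bounded_closed)
  then have "compact (\<Union>d\<in>E. source.chart d ` K d)"
    using source.fin by (intro compact_UN source.compact_chart) (auto simp: K_def)
  moreover have "(\<Union>d\<in>E. source.chart d ` K d) \<inter> S = cover -` B \<inter> S"
  proof (intro set_eqI iffI)
    fix x assume "x \<in> (\<Union>d\<in>E. source.chart d ` K d) \<inter> S"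
    then obtain d z where "d \<in> E" "z \<in> K d" "x = source.chart d z" "x \<in> S" by blast
    then show "x \<in> cover -` B \<inter> S" using cover_chart[of d z] by (simp add: K_def)
  next
    fix x assume x: "x \<in> cover -` B \<inter> S"
    then have "x \<in> S" by blast
    then obtain d z where dz: "d \<in> E" "z \<in> cball 0 1" "x = source.chart d z" by (rule source.charts_cover)
    then have "z \<in> K d" using x cover_chart[of d z] by (simp add: K_def)
    then show "x \<in> (\<Union>d\<in>E. source.chart d ` K d) \<inter> S" using dz x by blast
  qed
  ultimately show "\<exists>A. closed A \<and> A \<inter> S = cover -` B \<inter> S" using compact_imp_closed by blast
qed

lemma cover_surj: "cover ` S = T"
proof
  show "cover ` S \<subseteq> T"
  proof
    fix y assume "y \<in> cover ` S"
    then obtain x where "x \<in> S" "y = cover x" by blast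
    moreover then obtain d z where "d \<in> E" "z \<in> cball 0 1" "x = source.chart d z" using source.charts_cover by metis
    ultimately show "y \<in> T" using cover_chart target.chart_in_S q_mem by simp
  qed
  show "T \<subseteq> cover ` S"
  proof
    fix y assume "y \<in> T"
    then obtain c z where cz: "c \<in> E'" "z \<in> cball 0 1" "y = target.chart c z" by (rule target.charts_cover)
    obtain d where d: "d \<in> E" "c = q d" using cz(1) q_surj by blast
    then have "y = cover (source.chart d z)" using cz cover_chart by simp
    then show "y \<in> cover ` S" using source.chart_in_S[OF d(1) cz(2)] by blast
  qed
qed

lemma cover_preserves_cells:
  assumes x: "x \<in> S"
  shows "cover x \<in> nodes N \<longleftrightarrow> x \<in> nodes M" "cover x \<in> skeleton N \<longleftrightarrow> x \<in> skeleton M"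
proof -
  have "(cover x \<in> nodes N \<longleftrightarrow> x \<in> nodes M) \<and> (cover x \<in> skeleton N \<longleftrightarrow> x \<in> skeleton M)"
    using x
  proof (cases rule: source.surface_point_cases)
    case (face d)
    then have "cover x \<in> L' (q d)" using cover_face by blast
    then have "cover x \<notin> skeleton N" using target.face_subset[OF q_mem[OF face(1)]] by blast
    moreover have "x \<notin> skeleton M" using source.face_subset face by blast
    ultimately show ?thesis by (simp add: source.skeleton_eq target.skeleton_eq)
  next
    case (arc d t)
    then have "cover x = \<gamma>' (q d) t" using cover_curve by simp
    then show ?thesis
      using target.curve_notin_nodes[OF q_mem[OF arc(1)] arc(2)] target.curve_in_skeleton[OF q_mem[OF arc(1)], of t]
        source.curve_notin_nodes[OF arc(1,2)] source.curve_in_skeleton[OF arc(1), of t] arc by simp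
  next
    case node
    then show ?thesis using cover_node by (simp add: source.skeleton_eq target.skeleton_eq)
  qed
  then show "cover x \<in> nodes N \<longleftrightarrow> x \<in> nodes M" "cover x \<in> skeleton N \<longleftrightarrow> x \<in> skeleton M" by auto
qed

lemma cover_preimage_nodes: "S \<inter> cover -` nodes N = nodes M"
  using cover_preserves_cells(1) source.skeleton_subset by (auto simp: source.skeleton_eq)

lemma cover_preimage_skeleton: "S \<inter> cover -` skeleton N = skeleton M"
  using cover_preserves_cells(2) source.skeleton_subset by auto

lemma cover_star: assumes d: "d \<in> E" shows "cover ` source.star d = target.star (q d)"
  using cover_face[OF d] cover_face[OF source.flip_mem[OF d]] cover_arc[OF d] q_flip[OF d]
  by (simp add: source.star_def target.star_def image_Un)

lemma cover_inj_star: assumes d: "d \<in> E" shows "inj_on cover (source.star d)"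
proof -
  have fd: "flip d \<in> E" using source.flip_mem[OF d] .
  have E': "q d \<in> E'" "flip (q d) \<in> E'" using q_mem[OF d] q_mem[OF fd] q_flip[OF d] by simp_all
  have faces: "L' (q d) \<inter> L' (flip (q d)) = {}"
    using target.face_disjoint[OF E'] distinct_faces[OF E'(1)] by metis
  have arcs: "L' c \<inter> target.arc_of (q d) = {}" if "c \<in> E'" for c
    using target.curve_notin_face[OF that E'(1)] by (auto simp: target.arc_of_def)
  have "inj_on cover (L d \<union> L (flip d))"
    using cover_inj_face[OF d] cover_inj_face[OF fd] cover_face[OF d] cover_face[OF fd] faces q_flip[OF d]
    unfolding inj_on_Un by auto
  moreover have "cover ` (L d \<union> L (flip d)) \<inter> cover ` source.arc_of d = {}"
    using cover_face[OF d] cover_face[OF fd] cover_arc[OF d] arcs[OF E'(1)] arcs[OF E'(2)] q_flip[OF d]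
    by (simp add: image_Un Int_Un_distrib2)
  ultimately show ?thesis
    unfolding source.star_def inj_on_Un[of cover "L d \<union> L (flip d)"] using cover_inj_arc[OF d] by blast
qed

lemma face_preimage:
  assumes c: "c \<in> E'"
  shows "\<Union>(L ` {d\<in>E. L' (q d) = L' c}) = S \<inter> cover -` L' c"
proof (intro set_eqI iffI)
  fix x assume "x \<in> \<Union>(L ` {d\<in>E. L' (q d) = L' c})"
  then obtain d where d: "d \<in> E" "L' (q d) = L' c" "x \<in> L d" by blast
  then have "cover x \<in> L' c" using cover_face[OF d(1)] by blast
  then show "x \<in> S \<inter> cover -` L' c" using source.face_subset[OF d(1)] d(3) by blast
next
  fix x assume x: "x \<in> S \<inter> cover -` L' c"
  then have "x \<in> S" by blast
  have "x \<notin> skeleton M"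
    using x cover_preserves_cells(2)[OF \<open>x \<in> S\<close>] target.face_subset[OF c] by blast
  then obtain d where d: "d \<in> E" "x \<in> L d"
    using source.surface_point_cases[OF \<open>x \<in> S\<close>] source.curve_in_skeleton
    by (metis UnCI atLeastAtMost_iff greaterThanLessThan_iff order_less_imp_le source.skeleton_eq)
  then have "cover x \<in> L' (q d)" using cover_face by blast
  then have "L' (q d) = L' c" using target.face_disjoint[OF q_mem[OF d(1)] c] x by blast
  then show "x \<in> \<Union>(L ` {d\<in>E. L' (q d) = L' c})" using d by blast
qed

text \<open>
  A face has as many sides as its image, so its boundary walk runs exactly once around the image.
  Together with the next lemma this determines the stars over the star of an edge.
\<close>

lemma side_over:
  assumes d: "d \<in> E" and c: "c \<in> E'" and L: "L' (q d) = L' c"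
  shows "\<exists>a\<in>E. q a = c \<and> L a = L d"
proof -
  obtain i where "c = (W' ^^ i) (q d)"
    using L target.face_eq_iff[OF q_mem[OF d] c] target.orbit_W[OF q_mem[OF d]] by blast
  then show ?thesis
    using q_walk_pow[OF d] source.W_pow_mem[OF d] source.face_W_pow[OF d]
    by (intro bexI[of _ "(W ^^ i) d"]) auto
qed

lemma side_over_unique:
  assumes a: "a \<in> E" "b \<in> E" and L: "L a = L b" and q: "q a = q b"
  shows "a = b"
proof -
  obtain i where i: "i < sides M a" "b = (W ^^ i) a"
    using L source.face_eq_iff[OF a] source.orbit_W[OF a(1)] by blast
  have "(W' ^^ i) (q a) = q a" using q i(2) q_walk_pow[OF a(1)] by simp
  then have "sides N (q a) dvd i"
    using funpow_period_dvd[OF target.fin target.bij q_mem[OF a(1)]] by (simp add: sides_def)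
  then have "i = 0" using i(1) q_sides[OF a(1)] by (metis dvd_imp_le leD neq0_conv)
  then show ?thesis using i(2) by simp
qed

lemma star_preimage:
  assumes c: "c \<in> E'"
  shows "\<Union>(source.star ` {d\<in>E. q d = c}) = S \<inter> cover -` target.star c"
proof (intro set_eqI iffI)
  fix x assume "x \<in> \<Union>(source.star ` {d\<in>E. q d = c})"
  then obtain d where d: "d \<in> E" "q d = c" "x \<in> source.star d" by blast
  then have "cover x \<in> target.star c" using cover_star[OF d(1)] by blast
  moreover have "x \<in> S" using source.star_open[OF d(1), THEN openin_imp_subset] d(3) by blast
  ultimately show "x \<in> S \<inter> cover -` target.star c" by blast
next
  fix x assume x: "x \<in> S \<inter> cover -` target.star c"
  then have xS: "x \<in> S" by blast
  have fc: "flip c \<in> E'" using target.flip_mem[OF c] .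
  from xS have "\<exists>d\<in>E. q d = c \<and> x \<in> source.star d"
  proof (cases rule: source.surface_point_cases)
    case (face d)
    then have y: "cover x \<in> L' (q d)" using cover_face by blast
    then have "cover x \<notin> target.arc_of c"
      using target.curve_notin_face[OF q_mem[OF face(1)] c] by (auto simp: target.arc_of_def)
    then have "L' (q d) = L' c \<or> L' (q d) = L' (flip c)"
      using x y target.face_disjoint[OF q_mem[OF face(1)] c] target.face_disjoint[OF q_mem[OF face(1)] fc]
      unfolding target.star_def by blast
    then show ?thesis
    proof
      assume "L' (q d) = L' c"
      then obtain a where "a \<in> E" "q a = c" "L a = L d" using side_over[OF face(1) c] by blast
      then show ?thesis using face(2) by (auto simp: source.star_def)
    next
      assume "L' (q d) = L' (flip c)"
      then obtain a where a: "a \<in> E" "q a = flip c" "L a = L d" using side_over[OF face(1) fc] by blast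
      then have "q (flip a) = c" "x \<in> source.star (flip a)"
        using face(2) q_flip[OF a(1)] by (auto simp: source.star_def source.flip_flip target.flip_flip)
      then show ?thesis using source.flip_mem[OF a(1)] by blast
    qed
  next
    case (arc d t)
    have y: "cover x = \<gamma>' (q d) t" using arc cover_curve by simp
    have "cover x \<notin> L' c" "cover x \<notin> L' (flip c)"
      using y arc(2) target.curve_notin_face[OF c q_mem[OF arc(1)], of t]
        target.curve_notin_face[OF fc q_mem[OF arc(1)], of t] by auto
    then have "cover x \<in> target.arc_of c" using x by (auto simp: target.star_def)
    moreover have "cover x \<in> target.arc_of (q d)" using y arc(2) by (auto simp: target.arc_of_def)
    ultimately have "c = q d \<or> c = flip (q d)"
      using target.arc_of_disjoint[OF q_mem[OF arc(1)] c] by blast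
    moreover have "x \<in> source.star d" "x \<in> source.star (flip d)"
      using arc source.star_flip[of d] by (auto simp: source.star_def source.arc_of_def)
    ultimately show ?thesis using arc(1) q_flip[OF arc(1)] source.flip_mem[OF arc(1)] by metis
  next
    case node
    then have "cover x \<in> nodes N" by (rule cover_node)
    then show ?thesis
      using x target.node_notin_face[OF c] target.node_notin_face[OF fc] target.arc_of_nodes[OF c]
      unfolding target.star_def by blast
  qed
  then show "x \<in> \<Union>(source.star ` {d\<in>E. q d = c})" by blast
qed

text \<open>
  The faces on the left of \<open>a\<close> and on the right of \<open>b\<close> lie over the two sides of one edge of the target,
  which are different faces.
\<close>

lemma stars_over_disjoint:
  assumes a: "a \<in> E" "b \<in> E" and q: "q a = q b" and ne: "a \<noteq> b"
  shows "source.star a \<inter> source.star b = {}"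
proof -
  note fa = source.flip_mem[OF a(1)] and fb = source.flip_mem[OF a(2)]
  have qf: "q (flip a) = flip (q a)" "q (flip b) = flip (q a)" using q_flip a q by auto
  have same: "L a \<inter> L b = {}" "L (flip a) \<inter> L (flip b) = {}"
  proof -
    show "L a \<inter> L b = {}" using source.face_disjoint[OF a] side_over_unique[OF a] q ne by blast
    have "flip a \<noteq> flip b" using ne source.flip_flip by metis
    then show "L (flip a) \<inter> L (flip b) = {}"
      using source.face_disjoint[OF fa fb] side_over_unique[OF fa fb] qf by metis
  qed
  have opposite: "L a \<inter> L (flip b) = {}" "L (flip a) \<inter> L b = {}"
    using source.face_disjoint[OF a(1) fb] q_face[OF a(1) fb] source.face_disjoint[OF fa a(2)]
      q_face[OF fa a(2)] qf q distinct_faces[OF q_mem[OF a(1)]] by metis+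
  have arcs: "source.arc_of a \<inter> source.arc_of b = {}"
  proof (rule source.arc_of_disjoint[OF a ne[symmetric]])
    show "b \<noteq> flip a" using qf(1) q target.flip_ne[of "q a"] by metis
  qed
  have mixed: "source.arc_of c \<inter> L d = {}" if "c \<in> E" "d \<in> E" for c d
    using source.curve_notin_face[OF that(2,1)] by (auto simp: source.arc_of_def)
  show ?thesis
    using same opposite arcs mixed[OF a(1) a(2)] mixed[OF a(1) fb] mixed[OF a(2) a(1)] mixed[OF a(2) fa]
    unfolding source.star_def by blast
qed

lemma evenly_covered:
  assumes V: "\<Union>\<V> = S \<inter> cover -` U" "\<And>V. V \<in> \<V> \<Longrightarrow> openin (top_of_set S) V" "pairwise disjnt \<V>"
    and bij: "\<And>V. V \<in> \<V> \<Longrightarrow> inj_on cover V \<and> cover ` V = U"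
    and U: "openin (top_of_set T) U" "U \<inter> nodes N = {}"
  shows "openin (top_of_set (T - nodes N)) U \<and>
    (\<exists>\<V>. \<Union>\<V> = (S - nodes M) \<inter> cover -` U \<and> (\<forall>V\<in>\<V>. openin (top_of_set (S - nodes M)) V) \<and>
      pairwise disjnt \<V> \<and> (\<forall>V\<in>\<V>. \<exists>g. homeomorphism V U cover g))"
proof
  have "U \<subseteq> T - nodes N" using openin_imp_subset[OF U(1)] U(2) by blast
  then show "openin (top_of_set (T - nodes N)) U" by (rule openin_subset_trans[OF U(1) _ Diff_subset])
  have "nodes M \<inter> cover -` U = {}" using cover_node U(2) by blast
  then have eq: "\<Union>\<V> = (S - nodes M) \<inter> cover -` U" unfolding V(1) by blast
  have "openin (top_of_set (S - nodes M)) V" if "V \<in> \<V>" for V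
  proof (rule openin_subset_trans[OF V(2)[OF that] _ Diff_subset])
    show "V \<subseteq> S - nodes M" using that eq by blast
  qed
  moreover have "\<exists>g. homeomorphism V U cover g" if "V \<in> \<V>" for V
    by (rule sheets_homeomorphic[OF cover_continuous source.compact_S V bij that])
  ultimately show "\<exists>\<V>. \<Union>\<V> = (S - nodes M) \<inter> cover -` U \<and> (\<forall>V\<in>\<V>. openin (top_of_set (S - nodes M)) V) \<and>
      pairwise disjnt \<V> \<and> (\<forall>V\<in>\<V>. \<exists>g. homeomorphism V U cover g)"
    using eq V(3) by (intro exI[of _ \<V>]) blast
qed

theorem cover_branched: "branched_cover S T (nodes N) cover"
proof -
  have minus: "S - cover -` nodes N = S - nodes M" using cover_preimage_nodes by blast
  have "covering_space (S - nodes M) cover (T - nodes N)"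
  proof
    show "continuous_on (S - nodes M) cover" using cover_continuous continuous_on_subset by blast
    show "cover ` (S - nodes M) = T - nodes N"
      using cover_surj cover_preserves_cells(1) by (auto simp: image_iff)
    fix y assume y: "y \<in> T - nodes N"
    then have "y \<in> T" by blast
    then show "\<exists>U. y \<in> U \<and> openin (top_of_set (T - nodes N)) U \<and>
      (\<exists>\<V>. \<Union>\<V> = (S - nodes M) \<inter> cover -` U \<and> (\<forall>V\<in>\<V>. openin (top_of_set (S - nodes M)) V) \<and>
        pairwise disjnt \<V> \<and> (\<forall>V\<in>\<V>. \<exists>g. homeomorphism V U cover g))"
    proof (cases rule: target.surface_point_cases)
      case (face c)
      have "L' c \<inter> nodes N = {}" using target.node_notin_face[OF face(1)] by blast
      moreover have "pairwise disjnt (L ` {d\<in>E. L' (q d) = L' c})"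
        unfolding pairwise_def disjnt_def using source.face_disjoint by blast
      moreover have "openin (top_of_set S) V" "inj_on cover V \<and> cover ` V = L' c"
        if V: "V \<in> L ` {d\<in>E. L' (q d) = L' c}" for V
      proof -
        obtain d where "d \<in> E" "L' (q d) = L' c" "V = L d" using V by blast
        then show "openin (top_of_set S) V" "inj_on cover V \<and> cover ` V = L' c"
          using source.face_open cover_inj_face cover_face by auto
      qed
      ultimately show ?thesis
        using evenly_covered[OF face_preimage[OF face(1)] _ _ _ target.face_open[OF face(1)]] face(2)
        by (intro exI[of _ "L' c"] conjI[OF face(2)]) simp
    next
      case (arc c t)
      have "target.star c \<inter> nodes N = {}"
        using target.node_notin_face[OF arc(1)] target.node_notin_face[OF target.flip_mem[OF arc(1)]]
          target.arc_of_nodes[OF arc(1)] by (auto simp: target.star_def)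
      moreover have "pairwise disjnt (source.star ` {d\<in>E. q d = c})"
        unfolding pairwise_def disjnt_def
      proof (intro ballI impI)
        fix A B assume AB: "A \<in> source.star ` {d\<in>E. q d = c}" "B \<in> source.star ` {d\<in>E. q d = c}" "A \<noteq> B"
        obtain a where a: "a \<in> E" "q a = c" "A = source.star a" using AB(1) by blast
        obtain b where b: "b \<in> E" "q b = c" "B = source.star b" using AB(2) by blast
        show "A \<inter> B = {}" unfolding a(3) b(3) using AB(3) a b by (intro stars_over_disjoint) auto
      qed
      moreover have "y \<in> target.star c" using arc by (auto simp: target.star_def target.arc_of_def)
      moreover have "openin (top_of_set S) V" "inj_on cover V \<and> cover ` V = target.star c"
        if V: "V \<in> source.star ` {d\<in>E. q d = c}" for V
      proof -
        obtain d where "d \<in> E" "q d = c" "V = source.star d" using V by blast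
        then show "openin (top_of_set S) V" "inj_on cover V \<and> cover ` V = target.star c"
          using source.star_open cover_inj_star cover_star by auto
      qed
      ultimately show ?thesis
        using evenly_covered[OF star_preimage[OF arc(1)] _ _ _ target.star_open[OF arc(1)]]
        by (intro exI[of _ "target.star c"] conjI) simp_all
    qed (use y in blast)
  qed
  moreover have "nodes N \<subseteq> T" using target.skeleton_subset by (auto simp: target.skeleton_eq)
  ultimately show ?thesis
    unfolding branched_cover_def minus cover_preimage_nodes
    using cover_continuous cover_surj target.fin_nodes source.fin_nodes by blast
qed

theorem cover_lift: "is_lift S M N cover"
  unfolding is_lift_def
proof (intro conjI ballI)
  fix d assume d: "d \<in> E"
  have "strict_mono_on {0..1::real} (\<lambda>t. t)" by (simp add: strict_mono_on_def)
  then show "\<exists>d'\<in>E'. \<exists>\<tau>. strict_mono_on {0..1} \<tau> \<and> \<tau> ` {0..1} = {0..1} \<and>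
      (\<forall>t\<in>{0..1}. cover (\<gamma> d t) = \<gamma>' d' (\<tau> t)) \<and> cover ` L d = L' d'"
    using cover_curve[OF d] cover_face[OF d] q_mem[OF d]
    by (intro bexI[of _ "q d"] exI[of _ "\<lambda>t. t"]) auto
qed (simp_all add: cover_preimage_nodes cover_preimage_skeleton)

end

section \<open>Football patterns on the sphere\<close>

locale spherical_football =
  fixes M :: "(real ^ 3, 'e) surface_map"
  assumes pattern: "football_pattern two_sphere M"

sublocale spherical_football \<subseteq> sphere_map M
proof
  show "map_on_surface two_sphere M" using pattern by (simp add: football_pattern_def)
  fix v assume "v \<in> nodes M"
  then have "3 \<le> card {d \<in> oedges M. ocurve M d 0 = v}" using pattern by (simp add: football_pattern_def)
  then have "{d \<in> oedges M. ocurve M d 0 = v} \<noteq> {}" by (metis card.empty not_numeral_le_zero)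
  then show "\<exists>d\<in>oedges M. ocurve M d 0 = v" by blast
qed

context spherical_football
begin

lemma sides_conditions:
  assumes "d \<in> E"
  shows "n d = 5 \<or> n d = 6" "n d = 5 \<Longrightarrow> n (flip d) = 6" "n d = 6 \<Longrightarrow> n (flip d) = 5 \<longleftrightarrow> n (flip (W d)) = 6"
  using pattern assms unfolding football_pattern_def by blast+

lemma edge_map: "football_map E W flip"
  by unfold_locales
    (use fin bij flip_mem sides_conditions in \<open>auto simp: sides_def\<close>)

sublocale edge_map: football_map E W flip by (rule edge_map)

lemma edge_map_turn: "edge_map.turn = turn"
  by (simp add: fun_eq_iff edge_map.turn_def)

lemma turn_pow_start: "d \<in> E \<Longrightarrow> \<gamma> ((turn ^^ i) d) 0 = \<gamma> d 0"
  by (induction i) (simp_all add: turn_start bij_betw_funpow_mem[OF bij_turn])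

lemma dual_presentation: "football_presentation (dual_graph M)"
proof (rule football_presentation.intro)
  have eqs: "ends (dual_graph M) = E" "rot (dual_graph M) = W" "opp (dual_graph M) = flip"
    "origin (dual_graph M) = L" "rverts (dual_graph M) = L ` E"
    "black (dual_graph M) = L ` {d \<in> E. n d = 5}"
    by (simp_all add: dual_graph_def)
  show "football_map (ends (dual_graph M)) (rot (dual_graph M)) (opp (dual_graph M))"
    unfolding eqs by (rule edge_map)
  show "football_presentation_axioms (dual_graph M)"
    unfolding football_presentation_axioms_def eqs
  proof (intro conjI allI impI)
    show "L ` {d \<in> E. n d = 5} = L ` {d \<in> E. card (orbit W d) = 5}" by (simp add: sides_def)
    show "X = E" if "X \<subseteq> E" "X \<noteq> {}" "\<forall>d. d \<in> X \<longrightarrow> W d \<in> X \<and> flip d \<in> X" for X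
      using dual_connected[OF that(1,2)] that(3) by blast
  qed (use face_eq_iff E_nonempty flip_ne in auto)
qed

lemma labelling_locale: "football_labelling E W flip (ends std) (rot std) (opp std)"
proof (rule football_labelling.intro[OF edge_map std.football_map_axioms], rule football_labelling_axioms.intro)
  show "X = E" if "X \<subseteq> E" "X \<noteq> {}" "\<And>d. d \<in> X \<Longrightarrow> W d \<in> X \<and> flip d \<in> X" for X
    using dual_connected[OF that(1,2)] that(3) by blast
  show "\<exists>d\<in>B. \<forall>i. (edge_map.turn ^^ i) d \<in> B \<longrightarrow> (edge_map.turn ^^ i) d = d"
    if B: "B \<subseteq> E" "B \<noteq> {}" "\<And>d. d \<in> B \<Longrightarrow> flip d \<in> B"
      "\<And>X. X \<subseteq> E \<Longrightarrow> X \<noteq> {} \<Longrightarrow> (\<And>d. d \<in> X \<Longrightarrow> W d \<in> X) \<Longrightarrow>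
        (\<And>d. d \<in> X \<Longrightarrow> d \<notin> B \<Longrightarrow> flip d \<in> X) \<Longrightarrow> X = E" for B
  proof -
    obtain d where d: "d \<in> B" "\<forall>k\<in>B. \<gamma> k 0 = \<gamma> d 0 \<longrightarrow> k = d" using forest_has_leaf[OF B] by blast
    then have "d \<in> E" using B(1) by blast
    then show ?thesis using d turn_pow_start unfolding edge_map_turn by (intro bexI[of _ d]) auto
  qed
qed (use std_homogeneous std_all_kinds std_trivalent in auto)

lemma covering_exists:
  "\<exists>q. \<forall>d\<in>E. q d \<in> ends std \<and> q (W d) = rot std (q d) \<and> q (flip d) = opp std (q d) \<and>
     std.len (q d) = n d"
proof -
  obtain q where "\<forall>d\<in>E. q d \<in> ends std \<and> q (W d) = rot std (q d) \<and> q (flip d) = opp std (q d) \<and>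
     std.kind (q d) = edge_map.kind d"
    using football_labelling.equivariant_labelling_exists[OF labelling_locale] by blast
  then show ?thesis by (intro exI[of _ q]) (simp add: std.kind_def edge_map.kind_def sides_def)
qed

end

text \<open>
  The isomorphism with the standard football graph turns the labels of the oriented edges of \<open>M\<close> into
  oriented edges of \<open>N\<close>. The map is compatible with nodes because the oriented edges leaving a node of \<open>M\<close>
  form one orbit of the rotation.
\<close>

lemma standard_pattern_lift:
  fixes M :: "(real ^ 3, 'e) surface_map" and N :: "(real ^ 3, 'k) surface_map"
  assumes M: "football_pattern two_sphere M" and N: "standard_football_pattern two_sphere N"
  shows "\<exists>f. branched_cover two_sphere two_sphere (nodes N) f \<and> is_lift two_sphere M N f"
proof -
  interpret M: spherical_football M by (rule spherical_football.intro[OF M])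
  interpret N: spherical_football N
    using N by (intro spherical_football.intro) (simp add: standard_football_pattern_def)
  obtain r where r: "\<And>d. d \<in> oedges M \<Longrightarrow> r d \<in> ends std \<and> r (walk_next M d) = rot std (r d) \<and>
      r (flip d) = opp std (r d) \<and> std.len (r d) = sides M d"
    using M.covering_exists by blast
  obtain p \<psi> where "football_covering (dual_graph N) std p \<psi>" and inj: "inj_on \<psi> (oedges N)"
    using N by (auto simp: standard_football_pattern_def football_graphs_isomorphic_def dual_graph_def)
  then have \<psi>: "\<And>k. k \<in> oedges N \<Longrightarrow> \<psi> k \<in> ends std \<and> \<psi> (walk_next N k) = rot std (\<psi> k) \<and>
      \<psi> (flip k) = opp std (\<psi> k)"
    by (simp add: football_covering_def dual_graph_def)
  have "\<psi> ` oedges N = ends std"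
    by (rule football_presentation.equivariant_surjective[OF std_presentation N.E_nonempty,
          where f = "walk_next N" and g = flip]) (use \<psi> N.W_mem N.flip_mem in auto)
  define q where "q d = inv_into (oedges N) \<psi> (r d)" for d
  have q: "q d \<in> oedges N" "\<psi> (q d) = r d" if "d \<in> oedges M" for d
    using r[OF that] \<open>\<psi> ` oedges N = ends std\<close> unfolding q_def by (metis inv_into_into, metis f_inv_into_f)
  have eqI: "k = l" if "k \<in> oedges N" "l \<in> oedges N" "\<psi> k = \<psi> l" for k l by (rule inj_onD[OF inj that(3,1,2)])
  have \<psi>_pow: "\<psi> ((walk_next N ^^ i) k) = (rot std ^^ i) (\<psi> k)" if "k \<in> oedges N" for k i
    using that \<psi> by (induction i) (simp_all add: N.W_pow_mem)
  have q_walk: "q (walk_next M d) = walk_next N (q d)" if d: "d \<in> oedges M" for d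
    using q[OF d] q[OF M.W_mem[OF d]] r[OF d] \<psi>[OF q(1)[OF d]] N.W_mem by (intro eqI) auto
  have q_flip: "q (flip d) = flip (q d)" if d: "d \<in> oedges M" for d
    using q[OF d] q[OF M.flip_mem[OF d]] r[OF d] \<psi>[OF q(1)[OF d]] N.flip_mem by (intro eqI) auto
  have len: "std.len (\<psi> k) = sides N k" if k: "k \<in> oedges N" for k
  proof -
    have "std.len (\<psi> k) dvd i \<longleftrightarrow> sides N k dvd i" for i
    proof -
      have "(rot std ^^ i) (\<psi> k) = \<psi> k \<longleftrightarrow> (walk_next N ^^ i) k = k"
        using \<psi>_pow[OF k, of i] eqI[OF N.W_pow_mem[OF k] k, of i] by metis
      then show ?thesis
        using funpow_period_dvd[OF std.fin std.bij, of "\<psi> k" i] funpow_period_dvd[OF N.fin N.bij k, of i] \<psi>[OF k]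
        by (simp add: sides_def)
    qed
    then show ?thesis by (meson dvd_antisym dvd_refl)
  qed
  have "map_covering two_sphere M two_sphere N q"
  proof unfold_locales
    show "q d \<in> oedges N" if "d \<in> oedges M" for d using q(1)[OF that] .
    show "q (walk_next M d) = walk_next N (q d)" if "d \<in> oedges M" for d using q_walk[OF that] .
    show "q (flip d) = flip (q d)" if "d \<in> oedges M" for d using q_flip[OF that] .
    show "sides N (q d) = sides M d" if "d \<in> oedges M" for d
      using len[OF q(1)[OF that]] q(2)[OF that] r[OF that] by simp
    show "q ` oedges M = oedges N"
    proof (rule N.dual_connected)
      show "q ` oedges M \<subseteq> oedges N" using q(1) by (rule image_subsetI)
      show "q ` oedges M \<noteq> {}" using M.E_nonempty by simp
      fix k assume "k \<in> q ` oedges M"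
      then obtain d where d: "d \<in> oedges M" "k = q d" by blast
      have "walk_next N k = q (walk_next M d)" "flip k = q (flip d)" using q_walk[OF d(1)] q_flip[OF d(1)] d(2) by simp_all
      then show "walk_next N k \<in> q ` oedges M" "flip k \<in> q ` oedges M"
        using M.W_mem[OF d(1)] M.flip_mem[OF d(1)] by simp_all
    qed
    show "ocurve N (q c) 0 = ocurve N (q d) 0"
      if cd: "c \<in> oedges M" "d \<in> oedges M" "ocurve M c 0 = ocurve M d 0" for c d
    proof -
      let ?A = "{b \<in> oedges M. ocurve M b 0 = ocurve M c 0}"
      let ?X = "{b \<in> ?A. ocurve N (q b) 0 = ocurve N (q c) 0}"
      have "?X = ?A"
      proof (rule M.turn_transitive)
        show "ocurve M c 0 \<in> nodes M" using M.curve_start[OF cd(1)] .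
        show "2 \<le> sides M b" if "b \<in> oedges M" for b using M.sides_conditions(1)[OF that] by auto
        show "?X \<noteq> {}" using cd(1) by blast
        fix b assume b: "b \<in> ?X"
        then have bE: "b \<in> oedges M" by simp
        have "q (M.turn b) = N.turn (q b)" using q_walk[OF M.flip_mem[OF bE]] q_flip[OF bE] by simp
        then show "M.turn b \<in> ?X"
          using b M.turn_mem[OF bE] M.turn_start[OF bE] N.turn_start[OF q(1)[OF bE]] by simp
      qed blast
      moreover have "d \<in> ?A" using cd by simp
      ultimately have "d \<in> ?X" by metis
      then show ?thesis by simp
    qed
    show "left_face N (flip k) \<noteq> left_face N k" if k: "k \<in> oedges N" for k
    proof
      assume "left_face N (flip k) = left_face N k"
      then have "flip k \<in> orbit (walk_next N) k" using N.face_eq_iff[OF k N.flip_mem[OF k]] by simp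
      then obtain i where "flip k = (walk_next N ^^ i) k" using N.orbit_W[OF k] by blast
      then have i: "opp std (\<psi> k) = (rot std ^^ i) (\<psi> k)" using \<psi>_pow[OF k, of i] \<psi>[OF k] by simp
      have "\<psi> k \<in> orbit (rot std) (\<psi> k)" using self_in_orbit_finite[OF std.fin std.bij] \<psi>[OF k] by blast
      then have "(rot std ^^ i) (\<psi> k) \<in> orbit (rot std) (\<psi> k)" by (rule funpow_in_orbit)
      then show False using std_distinct_faces[of "\<psi> k"] \<psi>[OF k] i by simp
    qed
  qed
  then show ?thesis using map_covering.cover_branched map_covering.cover_lift by blast
qed

theorem theorem2:
  fixes P :: "(real ^ 3, 'e) surface_map"
  assumes "football_pattern two_sphere P"
  shows "(\<exists>p q. finite_football_covering (dual_graph P) standard_football_graph p q) \<and>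
         (\<forall>P0 :: (real ^ 3, 'k) surface_map. standard_football_pattern two_sphere P0 \<longrightarrow>
            (\<exists>f. branched_cover two_sphere two_sphere (nodes P0) f \<and>
                 is_lift two_sphere P P0 f))"
proof (intro conjI allI impI)
  interpret P: spherical_football P by (rule spherical_football.intro[OF assms])
  obtain q where "\<forall>d\<in>oedges P. q d \<in> ends std \<and> q (walk_next P d) = rot std (q d) \<and>
      q (flip d) = opp std (q d) \<and> std.len (q d) = sides P d"
    using P.covering_exists by blast
  then have "\<exists>p. finite_football_covering (dual_graph P) std p q"
    by (intro equivariant_covering P.dual_presentation std_presentation)
      (simp add: dual_graph_def sides_def)
  then show "\<exists>p q. finite_football_covering (dual_graph P) std p q" by blast
qed (rule standard_pattern_lift[OF assms])

end
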